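(* Let $\{\Omega_k\}_{k\in\mathbb N}$ be a sequence of nonempty, bounded, open, convex subsets of $\mathbb R^3$ with $\operatorname{diam}(\Omega_k)=1$ for every $k\in\mathbb N$. Assume that, up to rigid motions (i.e. after replacing each $\Omega_k$ by its image under a suitable rigid motion of $\mathbb R^3$), $$\overline{\Omega_k}\to S:=\{(0,0,t):0\le t\le1\}\qquad\text{in the Hausdorff sense as }k\to\infty .$$ Then $$J_{\mathrm{Per}}(\Omega_k):=\mathrm{Per}(\Omega_k)\,\lambda_1^{\mathrm{Max}}(\Omega_k)\longrightarrow+\infty\qquad\text{as }k\to\infty .$$
   Context: $\mathrm{Per}(\Omega)$ is the De Giorgi perimeter of $\Omega$. Hausdorff convergence means convergence for the Hausdorff distance. First Maxwell eigenvalue. For $\Omega\subset\mathbb R^3$ nonempty, bounded, open and convex, let $\mathbf H(\operatorname{curl};\Omega)$ be the space of $\mathbf u\in L^2(\Omega)^3$ with distributional $\operatorname{curl}\mathbf u\in L^2(\Omega)^3$, and let $\mathbf H_0(\operatorname{curl};\Omega)$ be the closure of $C_c^\infty(\Omega)^3$ in $\mathbf H(\operatorname{curl};\Omega)$ (equivalently, the fields with zero tangential trace $\mathbf u\times\mathbf n=0$ on $\partial\Omega$). Set $\mathcal S(\Omega):=\{\mathbf E\in\mathbf H_0(\operatorname{curl};\Omega):\operatorname{div}\mathbf E=0\text{ in }\Omega\}$ and $$\lambda_1^{\mathrm{Max}}(\Omega):=\min_{\mathbf E\in\mathcal S(\Omega)\setminus\{0\}}\frac{\int_\Omega|\operatorname{curl}\mathbf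 E|^2\,dx}{\int_\Omega|\mathbf E|^2\,dx}.$$ *)

theory Defs
  imports "HOL-Analysis.Analysis"
begin

section \<open>Smooth functions with compact support\<close>

definition partial :: "3 \<Rightarrow> (real^3 \<Rightarrow> 'b::real_normed_vector) \<Rightarrow> real^3 \<Rightarrow> 'b"
  where "partial i f x = frechet_derivative f (at x) (axis i 1)"

primrec C_k :: "nat \<Rightarrow> (real^3 \<Rightarrow> 'b::real_normed_vector) \<Rightarrow> bool" where
  "C_k 0 f \<longleftrightarrow> continuous_on UNIV f"
| "C_k (Suc n) f \<longleftrightarrow> (\<forall>x. f differentiable (at x)) \<and> (\<forall>i. C_k n (partial i f))"

definition smooth :: "(real^3 \<Rightarrow> 'b::real_normed_vector) \<Rightarrow> bool"
  where "smooth f \<longleftrightarrow> (\<forall>n. C_k n f)"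

definition compact_support_in :: "(real^3) set \<Rightarrow> (real^3 \<Rightarrow> 'b::real_normed_vector) \<Rightarrow> bool"
  where "compact_support_in \<Omega> f \<longleftrightarrow>
    compact (closure {x. f x \<noteq> 0}) \<and> closure {x. f x \<noteq> 0} \<subseteq> \<Omega>"

text \<open>Test functions on \<open>\<Omega>\<close> are represented by their extension by zero to the whole space.\<close>

definition test_functions :: "(real^3) set \<Rightarrow> (real^3 \<Rightarrow> 'b::real_normed_vector) set"
  where "test_functions \<Omega> = {\<phi>. smooth \<phi> \<and> compact_support_in \<Omega> \<phi>}"


section \<open>Classical differential operators\<close>

definition grad :: "(real^3 \<Rightarrow> real) \<Rightarrow> real^3 \<Rightarrow> real^3"
  where "grad f x = (\<chi> i. partial i f x)"

definition divergence :: "(real^3 \<Rightarrow> real^3) \<Rightarrow> real^3 \<Rightarrow> real"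
  where "divergence f x = (\<Sum>i\<in>UNIV. partial i f x $ i)"

definition curl :: "(real^3 \<Rightarrow> real^3) \<Rightarrow> real^3 \<Rightarrow> real^3"
  where "curl f x = vector
    [partial 2 f x $ 3 - partial 3 f x $ 2,
     partial 3 f x $ 1 - partial 1 f x $ 3,
     partial 1 f x $ 2 - partial 2 f x $ 1]"


section \<open>The spaces \<open>H(curl)\<close> and \<open>H\<^sub>0(curl)\<close>\<close>

text \<open>Elements of these spaces are honest functions rather than equivalence classes modulo
  null sets; only their values on \<open>\<Omega>\<close> matter.\<close>

definition L2_fields :: "(real^3) set \<Rightarrow> (real^3 \<Rightarrow> real^3) set"
  where "L2_fields \<Omega> = {u. u \<in> borel_measurable (lebesgue_on \<Omega>) \<and>
    integrable (lebesgue_on \<Omega>) (\<lambda>x. (norm (u x))\<^sup>2)}"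

definition L2_norm_sq :: "(real^3) set \<Rightarrow> (real^3 \<Rightarrow> real^3) \<Rightarrow> real"
  where "L2_norm_sq \<Omega> u = (LINT x|lebesgue_on \<Omega>. (norm (u x))\<^sup>2)"

text \<open>\<open>has_weak_curl \<Omega> u w\<close>: both \<open>u\<close> and \<open>w\<close> are in \<open>L\<^sup>2(\<Omega>)\<close> and \<open>w\<close> is the distributional
  curl of \<open>u\<close> (unique up to a null set).\<close>

definition has_weak_curl :: "(real^3) set \<Rightarrow> (real^3 \<Rightarrow> real^3) \<Rightarrow> (real^3 \<Rightarrow> real^3) \<Rightarrow> bool"
  where "has_weak_curl \<Omega> u w \<longleftrightarrow> u \<in> L2_fields \<Omega> \<and> w \<in> L2_fields \<Omega> \<and>
    (\<forall>\<phi>\<in>test_functions \<Omega>.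
      (LINT x|lebesgue_on \<Omega>. u x \<bullet> curl \<phi> x) = (LINT x|lebesgue_on \<Omega>. w x \<bullet> \<phi> x))"

definition H_curl :: "(real^3) set \<Rightarrow> (real^3 \<Rightarrow> real^3) set"
  where "H_curl \<Omega> = {u. \<exists>w. has_weak_curl \<Omega> u w}"

text \<open>Closure of the test fields for the graph norm of \<open>H(curl)\<close>.\<close>

definition H0_curl :: "(real^3) set \<Rightarrow> (real^3 \<Rightarrow> real^3) set"
  where "H0_curl \<Omega> = {u \<in> H_curl \<Omega>. \<forall>w. has_weak_curl \<Omega> u w \<longrightarrow>
    (\<forall>e>0. \<exists>\<phi>\<in>test_functions \<Omega>.
      L2_norm_sq \<Omega> (\<lambda>x. u x - \<phi> x) + L2_norm_sq \<Omega> (\<lambda>x. w x - curl \<phi> x) < e\<^sup>2)}"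

definition weakly_div_free :: "(real^3) set \<Rightarrow> (real^3 \<Rightarrow> real^3) \<Rightarrow> bool"
  where "weakly_div_free \<Omega> u \<longleftrightarrow>
    (\<forall>\<psi>\<in>test_functions \<Omega>. (LINT x|lebesgue_on \<Omega>. u x \<bullet> grad \<psi> x) = 0)"


section \<open>The first Maxwell eigenvalue\<close>

definition Maxwell_space :: "(real^3) set \<Rightarrow> (real^3 \<Rightarrow> real^3) set"
  where "Maxwell_space \<Omega> = {E \<in> H0_curl \<Omega>. weakly_div_free \<Omega> E}"

definition Maxwell_quotients :: "(real^3) set \<Rightarrow> real set"
  where "Maxwell_quotients \<Omega> = {L2_norm_sq \<Omega> w / L2_norm_sq \<Omega> E | E w.
    E \<in> Maxwell_space \<Omega> \<and> has_weak_curl \<Omega> E w \<and> \<not> (AE x in lebesgue_on \<Omega>. E x = 0)}"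

text \<open>The minimum of the Rayleigh quotient is written as an infimum, with which it agrees
  because it is attained.\<close>

definition lambda1_Max :: "(real^3) set \<Rightarrow> ereal"
  where "lambda1_Max \<Omega> = (INF q\<in>Maxwell_quotients \<Omega>. ereal q)"


section \<open>De Giorgi perimeter\<close>

definition perimeter :: "(real^3) set \<Rightarrow> ereal"
  where "perimeter \<Omega> = (SUP \<phi> \<in> {\<phi> :: real^3 \<Rightarrow> real^3.
      C_k 1 \<phi> \<and> compact_support_in UNIV \<phi> \<and> (\<forall>x. norm (\<phi> x) \<le> 1)}.
    ereal (LINT x|lebesgue_on \<Omega>. divergence \<phi> x))"

definition J_Per :: "(real^3) set \<Rightarrow> ereal"
  where "J_Per \<Omega> = perimeter \<Omega> * lambda1_Max \<Omega>"


section \<open>Hausdorff distance and rigid motions\<close>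

text \<open>Meaningful for nonempty bounded sets, to which it is applied.\<close>

definition hausdorff_distance :: "'a::metric_space set \<Rightarrow> 'a set \<Rightarrow> real"
  where "hausdorff_distance A B = max (SUP a\<in>A. infdist a B) (SUP b\<in>B. infdist b A)"

text \<open>Reflections are allowed. For convergence to the segment below this makes no difference,
  since that segment is invariant under a reflection.\<close>

definition rigid_motion :: "(real^3 \<Rightarrow> real^3) \<Rightarrow> bool"
  where "rigid_motion T \<longleftrightarrow>
    (\<exists>R a. orthogonal_transformation R \<and> T = (\<lambda>x. R x + a))"

definition unit_segment :: "(real^3) set"
  where "unit_segment = {vector [0, 0, t] | t. 0 \<le> t \<and> t \<le> 1}"

end

theory Submission
  imports Defs
begin

text \<open>Let \<open>\<epsilon>\<close> be the largest distance of a point of \<open>\<Omega>\<close> from the line through two points realising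
  the diameter. The triangle with these three vertices has area \<open>\<epsilon>/2\<close>, so the perimeter is at
  least of order \<open>\<epsilon>\<close>; it therefore suffices to bound the eigenvalue below by a multiple of \<open>1/\<epsilon>\<^sup>2\<close>.

  Since \<open>E\<close> is orthogonal to gradients of test functions, its norm is at most that of \<open>E - grad \<psi>\<close>.
  Approximating \<open>E\<close> by test fields \<open>\<phi>\<close>, it is enough to find a test function \<open>\<psi>\<close> on \<open>\<Omega>\<close> with
  \<open>\<parallel>\<phi> - grad \<psi>\<parallel> \<le> C \<epsilon> \<parallel>curl \<phi>\<parallel>\<close>. For a unit vector \<open>e\<close> transversal to the diameter, integrating
  \<open>\<phi> \<bullet> e\<close> along \<open>e\<close> from either side of \<open>\<Omega>\<close> gives two potentials, whose difference \<open>g\<close> is the integral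
  of \<open>\<phi> \<bullet> e\<close> over the whole chord. They are glued with a cutoff \<open>\<chi>\<close> that is a function of the relative
  position \<open>(b - s) / (b - a)\<close> on the chord \<open>[a, b]\<close>. The derivatives of \<open>g\<close> are chord integrals of
  components of the curl, and the terms with \<open>grad \<chi>\<close> are absorbed by a Hardy inequality with weight
  \<open>1 / (b - a)\<close> in each direction orthogonal to \<open>e\<close>, which holds because \<open>a\<close> is convex and \<open>b\<close>
  is concave, with a constant that involves only the width of \<open>\<Omega>\<close> along \<open>e\<close>, not the size of the slopes.\<close>

section \<open>Calculus of C^k functions\<close>

text \<open>A cross-section may itself be far flatter than \<epsilon>, with chords that shrink to a
  point and are steep at the rim, so a cutoff at a fixed distance from the boundary would be
  arbitrarily expensive. Scaling the cutoff with the chord turns its gradient into slope over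
  length, and concavity trades the slopes for oscillations of \<open>a\<close> and \<open>b\<close>,
  which the width along \<open>e\<close> bounds. Along \<open>e\<close> itself the derivative of the
  cutoff has no slope, but for that term the Hardy constant is the squared length of the line of
  integration; it is therefore integrated along the thin direction \<open>f\<close> only, never
  along the diameter. Since the potential must be a classical test function, \<open>a\<close> and
  \<open>b\<close> are not the boundary of \<Omega> but smooth barriers squeezed between the support
  of the field and the boundary; they change with the field, the constants do not. A bound
  \<open>M\<close> on the derivative of one fixed transition function is all that enters them
  besides widths. The outcome is \<open>J_Per\<close> bounded below by a multiple of 1/\<epsilon> on
  the sets as given; rigid motions and Hausdorff distance serve to force \<epsilon> to 0.\<close>

lemma partial_eq:
  assumes "(f has_derivative D) (at x)"
  shows "partial i f x = D (axis i 1)"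
  unfolding partial_def using frechet_derivative_at[OF assms] by simp

text \<open>Lets the derivative be supplied as an explicit term, so that the inductions on
  \<open>n\<close> below apply to that term instead of to the \<open>frechet_derivative\<close> of a
  compound function.\<close>

lemma C_k_SucI:
  assumes "\<And>x. (f has_derivative D x) (at x)" "\<And>i. C_k n (\<lambda>x. D x (axis i 1))"
  shows "C_k (Suc n) f"
proof -
  have "partial i f = (\<lambda>x. D x (axis i 1))" for i
    using partial_eq[OF assms(1)] by blast
  with assms show ?thesis by (auto simp: differentiable_def)
qed

lemma C_k_SucD:
  assumes "C_k (Suc n) f"
  shows "C_k n f"
  using assms
proof (induction n arbitrary: f)
  case 0
  then show ?case
    by (auto simp: continuous_on_eq_continuous_at intro: differentiable_imp_continuous_within)
next
  case (Suc n)
  then show ?case by (metis C_k.simps(2))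
qed

lemma C_k_has_derivative:
  assumes "C_k (Suc n) f"
  shows "(f has_derivative frechet_derivative f (at x)) (at x)"
  using assms by (simp add: frechet_derivative_works[symmetric])

lemma C_k_frechet_derivative:
  assumes "C_k (Suc n) f"
  shows "C_k n (\<lambda>x. frechet_derivative f (at x) (axis i 1))"
  using assms by (simp add: partial_def[abs_def])

lemma C_k_continuous:
  assumes "C_k n f" shows "continuous_on UNIV f"
  using assms
proof (induction n)
  case (Suc n)
  then show ?case using C_k_SucD by blast
qed simp

lemma C_k_const [simp]: "C_k n (\<lambda>x. c)"
proof (induction n arbitrary: c)
  case (Suc n)
  show ?case by (rule C_k_SucI[where D="\<lambda>x h. 0"]) (auto simp: Suc)
qed simp

lemma C_k_linear:
  assumes "bounded_linear f" shows "C_k n f"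
proof (cases n)
  case 0
  then show ?thesis using assms by (simp add: linear_continuous_on)
next
  case (Suc m)
  show ?thesis unfolding Suc
    by (rule C_k_SucI[where D="\<lambda>x. f"]) (auto simp: bounded_linear_imp_has_derivative assms)
qed

lemma C_k_compose_linear:
  assumes "bounded_linear L" "C_k n f" shows "C_k n (\<lambda>x. L (f x))"
  using assms(2)
proof (induction n arbitrary: f)
  case 0
  then show ?case using assms(1) by (auto intro: bounded_linear.continuous_on)
next
  case (Suc n)
  show ?case
  proof (rule C_k_SucI)
    show "((\<lambda>x. L (f x)) has_derivative (\<lambda>h. L (frechet_derivative f (at x) h))) (at x)" for x
      by (rule bounded_linear.has_derivative[OF assms(1) C_k_has_derivative[OF Suc.prems]])
    show "C_k n (\<lambda>x. L (frechet_derivative f (at x) (axis i 1)))" for i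
      by (intro Suc.IH C_k_frechet_derivative Suc.prems)
  qed
qed

lemma C_k_add:
  assumes "C_k n f" "C_k n g" shows "C_k n (\<lambda>x. f x + g x)"
  using assms
proof (induction n arbitrary: f g)
  case 0
  then show ?case by (auto intro: continuous_intros)
next
  case (Suc n)
  show ?case
  proof (rule C_k_SucI)
    show "((\<lambda>x. f x + g x) has_derivative
      (\<lambda>h. frechet_derivative f (at x) h + frechet_derivative g (at x) h)) (at x)" for x
      using Suc.prems by (intro has_derivative_add C_k_has_derivative)
    show "C_k n (\<lambda>x. frechet_derivative f (at x) (axis i 1) + frechet_derivative g (at x) (axis i 1))" for i
      by (intro Suc.IH C_k_frechet_derivative Suc.prems)
  qed
qed

lemma C_k_scaleR:
  fixes f :: "real^3 \<Rightarrow> real" and g :: "real^3 \<Rightarrow> 'b::real_normed_vector"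
  assumes "C_k n f" "C_k n g" shows "C_k n (\<lambda>x. f x *\<^sub>R g x)"
  using assms
proof (induction n arbitrary: f g)
  case 0
  then show ?case by (auto intro: continuous_intros)
next
  case (Suc n)
  show ?case
  proof (rule C_k_SucI)
    show "((\<lambda>x. f x *\<^sub>R g x) has_derivative
      (\<lambda>h. f x *\<^sub>R frechet_derivative g (at x) h + frechet_derivative f (at x) h *\<^sub>R g x)) (at x)" for x
      using Suc.prems by (intro has_derivative_scaleR C_k_has_derivative)
    show "C_k n (\<lambda>x. f x *\<^sub>R frechet_derivative g (at x) (axis i 1)
        + frechet_derivative f (at x) (axis i 1) *\<^sub>R g x)" for i
      by (intro C_k_add Suc.IH C_k_frechet_derivative Suc.prems C_k_SucD[OF Suc.prems(1)]
          C_k_SucD[OF Suc.prems(2)])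
  qed
qed

lemma C_k_mult:
  fixes f g :: "real^3 \<Rightarrow> real"
  assumes "C_k n f" "C_k n g" shows "C_k n (\<lambda>x. f x * g x)"
  using C_k_scaleR[OF assms] by simp

lemma C_k_cmult:
  fixes f :: "real^3 \<Rightarrow> real"
  assumes "C_k n f" shows "C_k n (\<lambda>x. c * f x)"
  using C_k_mult[OF C_k_const assms] .

lemma C_k_diff:
  fixes f g :: "real^3 \<Rightarrow> real"
  assumes "C_k n f" "C_k n g" shows "C_k n (\<lambda>x. f x - g x)"
  using C_k_add[OF assms(1) C_k_cmult[OF assms(2), of "-1"]] by simp

lemma C_k_sum:
  assumes "\<And>i. i \<in> I \<Longrightarrow> C_k n (f i)" shows "C_k n (\<lambda>x. \<Sum>i\<in>I. f i x)"
  using assms by (induction I rule: infinite_finite_induct) (auto intro: C_k_add)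

lemma C_k_inner_right: "C_k n (\<lambda>x. c \<bullet> x)"
  by (rule C_k_linear) (rule bounded_linear_inner_right)

lemma C_k_inverse:
  fixes f :: "real^3 \<Rightarrow> real"
  assumes "C_k n f" "\<And>x. f x \<noteq> 0" shows "C_k n (\<lambda>x. inverse (f x))"
  using assms(1)
proof (induction n)
  case 0
  then show ?case using assms(2) by (auto intro: continuous_intros)
next
  case (Suc n)
  show ?case
  proof (rule C_k_SucI)
    show "((\<lambda>x. inverse (f x)) has_derivative
      (\<lambda>h. - (inverse (f x) * frechet_derivative f (at x) h * inverse (f x)))) (at x)" for x
      using Suc.prems by (intro Deriv.has_derivative_inverse C_k_has_derivative assms)
    have "C_k n (\<lambda>x. (-1) * ((inverse (f x) * partial i f x) * inverse (f x)))" for i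
      using Suc C_k_SucD by (intro C_k_cmult C_k_mult) auto
    then show "C_k n (\<lambda>x. - (inverse (f x) * frechet_derivative f (at x) (axis i 1) * inverse (f x)))" for i
      by (simp add: partial_def)
  qed
qed

lemma C_k_divide:
  fixes f g :: "real^3 \<Rightarrow> real"
  assumes "C_k n f" "C_k n g" "\<And>x. g x \<noteq> 0" shows "C_k n (\<lambda>x. f x / g x)"
  using C_k_mult[OF assms(1) C_k_inverse[OF assms(2,3)]] by (simp add: divide_inverse)

lemma C_k_exp:
  fixes f :: "real^3 \<Rightarrow> real"
  assumes "C_k n f" shows "C_k n (\<lambda>x. exp (f x))"
  using assms
proof (induction n)
  case 0
  then show ?case by (auto intro: continuous_intros)
next
  case (Suc n)
  show ?case
  proof (rule C_k_SucI)
    show "((\<lambda>x. exp (f x)) has_derivative (\<lambda>h. frechet_derivative f (at x) h * exp (f x))) (at x)" for x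
      using has_derivative_exp[OF C_k_has_derivative[OF Suc.prems]] by (simp add: mult.commute)
    have "C_k n (\<lambda>x. partial i f x * exp (f x))" for i
      using Suc C_k_SucD by (intro C_k_mult) auto
    then show "C_k n (\<lambda>x. frechet_derivative f (at x) (axis i 1) * exp (f x))" for i
      by (simp add: partial_def)
  qed
qed

lemma C_k_ln:
  fixes f :: "real^3 \<Rightarrow> real"
  assumes "C_k n f" "\<And>x. f x > 0" shows "C_k n (\<lambda>x. ln (f x))"
proof (cases n)
  case 0
  have "\<And>x. f x \<noteq> 0" using assms(2) by (metis less_irrefl)
  with 0 assms show ?thesis by (auto intro!: continuous_intros)
next
  case (Suc m)
  have nz: "\<And>x. f x \<noteq> 0" using assms(2) by (metis less_irrefl)
  show ?thesis unfolding Suc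
  proof (rule C_k_SucI)
    show "((\<lambda>x. ln (f x)) has_derivative (\<lambda>h. frechet_derivative f (at x) h * inverse (f x))) (at x)" for x
      using has_derivative_ln[OF assms(2) C_k_has_derivative[OF assms(1)[unfolded Suc]]]
      by (simp add: divide_inverse mult.commute)
    have "C_k m (\<lambda>x. partial i f x * inverse (f x))" for i
      using assms Suc nz C_k_SucD by (intro C_k_mult C_k_inverse) auto
    then show "C_k m (\<lambda>x. frechet_derivative f (at x) (axis i 1) * inverse (f x))" for i
      by (simp add: partial_def)
  qed
qed

section \<open>Smooth transition functions built from exp(-1/t)\<close>

definition flat :: "nat \<Rightarrow> real \<Rightarrow> real"
  where "flat m t = (if t \<le> 0 then 0 else exp (- (1 / t)) / t ^ m)"

lemma flat_tendsto_0: "(flat m \<longlongrightarrow> 0) (at 0)"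
proof -
  have R: "(flat m \<longlongrightarrow> 0) (at_right 0)"
  proof -
    \<comment> \<open>Under t = 1/s the claim becomes that the exponential beats every
      power.\<close>
    have "((\<lambda>x::real. x ^ m / exp x) \<longlongrightarrow> 0) at_top" for m :: nat
      by (rule tendsto_power_div_exp_0)
    from filterlim_compose[OF this filterlim_inverse_at_top_right]
    have "((\<lambda>t::real. inverse t ^ m / exp (inverse t)) \<longlongrightarrow> 0) (at_right 0)" .
    moreover have "eventually (\<lambda>t. inverse t ^ m / exp (inverse t) = flat m t) (at_right (0::real))"
      unfolding eventually_at_right_field
      by (rule exI[of _ 1]) (auto simp: flat_def exp_minus field_simps power_inverse)
    ultimately show ?thesis by (rule Lim_transform_eventually)
  qed
  have L: "(flat m \<longlongrightarrow> 0) (at_left 0)"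
  proof (rule tendsto_eventually)
    show "eventually (\<lambda>t. flat m t = 0) (at_left 0)"
      unfolding eventually_at_left_field by (rule exI[of _ "-1"]) (auto simp: flat_def)
  qed
  show ?thesis using L R filterlim_split_at by blast
qed

text \<open>The powers of \<open>1 / t\<close> make the family closed under differentiation; the
  induction in \<open>C_k_flat\<close>, over all \<open>m\<close> simultaneously, rests on
  this.\<close>

lemma flat_DERIV: "(flat m has_real_derivative flat (m + 2) t - m * flat (m + 1) t) (at t)"
proof -
  consider "t > 0" | "t < 0" | "t = 0" by linarith
  then show ?thesis
  proof cases
    case 1
    have "((\<lambda>t. exp (- (1 / t)) / t ^ m) has_real_derivative
      (exp (- (1/t)) * (1 / t^2) * t^m - exp (- (1/t)) * (m * t^(m-1))) / (t^m * t^m)) (at t)"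
      using 1 by (auto intro!: derivative_eq_intros simp: power2_eq_square)
    also have "(exp (- (1/t)) * (1 / t^2) * t^m - exp (- (1/t)) * (m * t^(m-1))) / (t^m * t^m)
      = flat (m + 2) t - m * flat (m + 1) t"
      using 1 by (cases m) (auto simp: flat_def field_simps power2_eq_square)
    finally have D: "((\<lambda>t. exp (- (1 / t)) / t ^ m) has_real_derivative
      flat (m + 2) t - m * flat (m + 1) t) (at t)" .
    show ?thesis
      by (rule has_field_derivative_transform_within_open[OF D, of "{0<..}"]) (use 1 in \<open>auto simp: flat_def\<close>)
  next
    case 2
    have D: "((\<lambda>t. 0) has_real_derivative flat (m + 2) t - m * flat (m + 1) t) (at t)"
      using 2 by (auto simp: flat_def)
    show ?thesis
      by (rule has_field_derivative_transform_within_open[OF D, of "{..<0}"]) (use 2 in \<open>auto simp: flat_def\<close>)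
  next
    case 3
    \<comment> \<open>The difference quotient of \<open>flat m\<close> at 0 is
      \<open>flat (m + 1)\<close> itself, on both sides.\<close>
    have "((\<lambda>h. (flat m (0 + h) - flat m 0) / h) \<longlongrightarrow> 0) (at 0)"
    proof (rule Lim_transform_eventually[OF flat_tendsto_0[of "m+1"]])
      show "eventually (\<lambda>h. flat (m+1) h = (flat m (0 + h) - flat m 0) / h) (at 0)"
        unfolding eventually_at by (rule exI[of _ 1]) (auto simp: flat_def)
    qed
    then have "(flat m has_real_derivative 0) (at 0)" by (simp add: DERIV_def)
    then show ?thesis using 3 by (simp add: flat_def)
  qed
qed

lemma C_k_flat:
  assumes "C_k n f" shows "C_k n (\<lambda>x. flat m (f x))"
  using assms
proof (induction n arbitrary: m)
  case 0
  have "continuous_on UNIV (flat m)"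
    by (meson DERIV_continuous_on has_field_derivative_at_within flat_DERIV)
  then show ?case using 0 by (auto intro: continuous_on_compose2)
next
  case (Suc n)
  show ?case
  proof (rule C_k_SucI)
    show "((\<lambda>x. flat m (f x)) has_derivative
      (\<lambda>h. (flat (m + 2) (f x) - m * flat (m + 1) (f x)) * frechet_derivative f (at x) h)) (at x)" for x
      using has_derivative_compose[OF C_k_has_derivative[OF Suc.prems] flat_DERIV[unfolded has_field_derivative_def]]
      by simp
    have "C_k n (\<lambda>x. (flat (m + 2) (f x) - m * flat (m + 1) (f x)) * partial i f x)" for i
      using Suc C_k_SucD by (intro C_k_mult C_k_cmult C_k_diff) auto
    then show "C_k n (\<lambda>x. (flat (m + 2) (f x) - m * flat (m + 1) (f x)) * frechet_derivative f (at x) (axis i 1))" for i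
      by (simp add: partial_def)
  qed
qed

definition step :: "real \<Rightarrow> real"
  where "step t = flat 0 t / (flat 0 t + flat 0 (1 - t))"

text \<open>The quotient-rule derivative of \<open>step\<close> after the products
  \<open>flat 0 t * flat 2 t\<close> have cancelled, which makes its sign visible.\<close>

definition step' :: "real \<Rightarrow> real"
  where "step' t = (flat 2 t * flat 0 (1 - t) + flat 0 t * flat 2 (1 - t)) / (flat 0 t + flat 0 (1 - t))\<^sup>2"

lemma flat_nonneg [simp]: "flat m t \<ge> 0"
  by (simp add: flat_def)

lemma flat_sum_pos: "flat 0 t + flat 0 (1 - t) > 0"
proof -
  have "flat 0 t > 0 \<or> flat 0 (1 - t) > 0" by (auto simp: flat_def)
  then show ?thesis using flat_nonneg[of 0 t] flat_nonneg[of 0 "1 - t"] by linarith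
qed

lemma step_bounds: "0 \<le> step t" "step t \<le> 1"
  using flat_sum_pos[of t] by (auto simp: step_def divide_simps)

lemma step_eq_0: "t \<le> 0 \<Longrightarrow> step t = 0"
  by (simp add: step_def flat_def)

lemma step_eq_1: "t \<ge> 1 \<Longrightarrow> step t = 1"
  by (simp add: step_def flat_def)

lemma step'_nonneg: "step' t \<ge> 0"
  by (simp add: step'_def)

lemma step_DERIV: "(step has_real_derivative step' t) (at t)"
proof -
  have 1: "(flat 0 has_real_derivative flat 2 t) (at t)" for t
    using flat_DERIV[of 0 t] by (simp add: numeral_2_eq_2)
  have 2: "((\<lambda>t. flat 0 (1 - t)) has_real_derivative - flat 2 (1 - t)) (at t)"
  proof -
    have "((\<lambda>t. 1 - t) has_real_derivative - 1) (at t)" by (auto intro!: derivative_eq_intros)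
    from DERIV_chain'[OF this 1] show ?thesis by simp
  qed
  show ?thesis unfolding step_def[abs_def]
    by (rule DERIV_cong[OF DERIV_divide[OF 1 DERIV_add[OF 1 2]]])
      (use flat_sum_pos[of t] in \<open>auto simp: step'_def power2_eq_square algebra_simps\<close>)
qed

lemma step'_outside: "t \<le> 0 \<or> t \<ge> 1 \<Longrightarrow> step' t = 0"
  by (auto simp: step'_def flat_def)

lemma continuous_on_flat: "continuous_on A (flat m)"
  by (meson DERIV_continuous_on has_field_derivative_at_within flat_DERIV)

lemma continuous_on_step': "continuous_on A step'"
proof -
  have *: "continuous_on A (\<lambda>t. flat m (1 - t))" for m
    by (rule continuous_on_compose2[OF continuous_on_flat[of UNIV m]]) (auto intro: continuous_intros)
  have "flat 0 t + flat 0 (1 - t) \<noteq> 0" for t using flat_sum_pos[of t] by simp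
  then show ?thesis unfolding step'_def[abs_def]
    by (intro continuous_intros continuous_on_flat *) auto
qed

text \<open>Continuous and zero outside [0, 1]. The bound is an absolute constant, the only trace
  that the choice of the cutoff leaves in the final estimate.\<close>

lemma step'_bounded: "\<exists>M. \<forall>t. step' t \<le> M"
proof -
  have "bounded (step' ` {0..1})"
    by (intro compact_imp_bounded compact_continuous_image continuous_on_step') auto
  then obtain B where B: "\<And>t. t \<in> {0..1} \<Longrightarrow> norm (step' t) \<le> B"
    unfolding bounded_iff by blast
  have "B \<ge> 0" using B[of 0] norm_ge_zero[of "step' 0"] by (simp del: norm_ge_zero)
  have "step' t \<le> B" for t
    using B[of t] step'_outside[of t] \<open>B \<ge> 0\<close> by (cases "t \<in> {0..1}") auto
  then show ?thesis by blast
qed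

lemma C_k_step:
  fixes f :: "real^3 \<Rightarrow> real"
  assumes "C_k n f" shows "C_k n (\<lambda>x. step (f x))"
  unfolding step_def
  using flat_sum_pos by (intro C_k_divide C_k_add C_k_flat C_k_diff assms C_k_const) (metis less_irrefl)

section \<open>A weighted Hardy inequality on an interval\<close>

text \<open>Cauchy-Schwarz as a nonnegative variance: the square of \<open>f\<close> minus its mean
  \<open>m / L\<close> is expanded and integrated.\<close>

lemma integral_power2_le:
  fixes f :: "real \<Rightarrow> real"
  assumes "continuous_on {a..b} f" "a \<le> b"
  shows "(integral {a..b} f)\<^sup>2 \<le> (b - a) * integral {a..b} (\<lambda>x. (f x)\<^sup>2)"
proof (cases "a = b")
  case False
  define L where "L = b - a"
  define m where "m = integral {a..b} f"
  have L: "L > 0" using assms False by (simp add: L_def)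
  have "0 \<le> integral {a..b} (\<lambda>x. (f x - m / L)\<^sup>2)"
    by (intro integral_nonneg integrable_continuous_interval continuous_intros assms) auto
  also have "(\<lambda>x. (f x - m / L)\<^sup>2) = (\<lambda>x. ((f x)\<^sup>2 - (2 * m / L) * f x) + (m / L)\<^sup>2)"
    by (auto simp: power2_eq_square algebra_simps)
  also have "integral {a..b} \<dots> = integral {a..b} (\<lambda>x. (f x)\<^sup>2 - (2 * m / L) * f x)
      + integral {a..b} (\<lambda>x. (m / L)\<^sup>2)"
    by (rule integral_add) (intro integrable_continuous_interval continuous_intros assms)+
  also have "integral {a..b} (\<lambda>x. (f x)\<^sup>2 - (2 * m / L) * f x)
      = integral {a..b} (\<lambda>x. (f x)\<^sup>2) - integral {a..b} (\<lambda>x. (2 * m / L) * f x)"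
    by (rule integral_diff) (intro integrable_continuous_interval continuous_intros assms)+
  also have "integral {a..b} (\<lambda>x. (2 * m / L) * f x) = (2 * m / L) * m"
    by (simp add: m_def)
  also have "integral {a..b} (\<lambda>x. (m / L)\<^sup>2) = (m / L)\<^sup>2 * L"
    using assms by (simp add: L_def)
  also have "integral {a..b} (\<lambda>x. (f x)\<^sup>2) - (2 * m / L) * m + (m / L)\<^sup>2 * L
      = integral {a..b} (\<lambda>x. (f x)\<^sup>2) - m\<^sup>2 / L"
  proof -
    have "(m / L)\<^sup>2 * L = m\<^sup>2 / L" "(2 * m / L) * m = 2 * (m\<^sup>2 / L)"
      using L by (simp_all add: power2_eq_square)
    then show ?thesis by linarith
  qed
  finally show ?thesis using L by (simp add: m_def[symmetric] L_def[symmetric] field_simps)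
qed simp

text \<open>A concave \<open>b\<close> rises up to a maximum point \<open>m\<close> and falls
  afterwards, so the integral of the positive part of \<open>b'\<close> is the rise
  \<open>b m - b \<alpha>\<close>. Large slopes are harmless: only the oscillation \<open>D\<close>
  counts.\<close>

lemma integral_pos_part_deriv_concave_le:
  fixes b b' :: "real \<Rightarrow> real"
  assumes "\<alpha> \<le> \<beta>"
    and b: "\<And>t. (b has_real_derivative b' t) (at t)" and cb: "continuous_on UNIV b'"
    and tan: "\<And>t u. b u \<le> b t + b' t * (u - t)"
    and osc: "\<And>t u. t \<in> {\<alpha>..\<beta>} \<Longrightarrow> u \<in> {\<alpha>..\<beta>} \<Longrightarrow> \<bar>b t - b u\<bar> \<le> D"
  shows "integral {\<alpha>..\<beta>} (\<lambda>t. max (b' t) 0) \<le> D"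
proof -
  have cont: "continuous_on {\<alpha>..\<beta>} b"
    by (meson DERIV_continuous_on b has_field_derivative_at_within)
  obtain m where m: "m \<in> {\<alpha>..\<beta>}" "\<And>t. t \<in> {\<alpha>..\<beta>} \<Longrightarrow> b t \<le> b m"
    using continuous_attains_sup[OF compact_Icc _ cont] assms(1) by auto
  have int: "(\<lambda>t. max (b' t) 0) integrable_on {\<alpha>..\<beta>}"
    by (intro integrable_continuous_interval continuous_intros continuous_on_subset[OF cb]) auto
  have "integral {\<alpha>..\<beta>} (\<lambda>t. max (b' t) 0)
      = integral {\<alpha>..m} (\<lambda>t. max (b' t) 0) + integral {m..\<beta>} (\<lambda>t. max (b' t) 0)"
    using Henstock_Kurzweil_Integration.integral_combine[OF _ _ int] m(1) by (metis atLeastAtMost_iff)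
  also have "integral {m..\<beta>} (\<lambda>t. max (b' t) 0) = 0"
  proof -
    \<comment> \<open>The tangent at \<open>t\<close> has at \<open>m\<close> a value at least
      \<open>b m\<close>, hence at least \<open>b t\<close>; since \<open>m < t\<close>, its slope
      is not positive.\<close>
    have "max (b' t) 0 = 0" if "t \<in> {m<..<\<beta>}" for t
    proof -
      have "b' t * (t - m) \<le> 0" using tan[of m t] m(2)[of t] m(1) that by (auto simp: algebra_simps)
      then show ?thesis using that by (auto simp: mult_le_0_iff)
    qed
    then have "integral {m<..<\<beta>} (\<lambda>t. max (b' t) 0) = integral {m<..<\<beta>} (\<lambda>t. 0)"
      by (intro integral_cong) auto
    then show ?thesis by (simp add: integral_open_interval_real)
  qed
  also have "integral {\<alpha>..m} (\<lambda>t. max (b' t) 0) = integral {\<alpha>..m} b'"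
  proof -
    have "max (b' t) 0 = b' t" if "t \<in> {\<alpha><..<m}" for t
    proof -
      have "b' t * (m - t) \<ge> 0" using tan[of m t] m(2)[of t] m(1) that by (auto simp: algebra_simps)
      then show ?thesis using that by (auto simp: zero_le_mult_iff)
    qed
    then have "integral {\<alpha><..<m} (\<lambda>t. max (b' t) 0) = integral {\<alpha><..<m} b'"
      by (intro integral_cong) auto
    then show ?thesis by (simp add: integral_open_interval_real)
  qed
  also have "integral {\<alpha>..m} b' = b m - b \<alpha>"
    using m(1) b
    by (intro integral_unique fundamental_theorem_of_calculus)
       (auto simp: has_real_derivative_iff_has_vector_derivative[symmetric] intro: has_field_derivative_at_within)
  finally show ?thesis using osc[OF m(1), of \<alpha>] assms(1) by auto
qed

text \<open>Cauchy-Schwarz for \<open>g t\<close> as the integral of \<open>g'\<close>, with the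
  weight inserted at no cost: to the left of \<open>t\<close> the quotient \<open>l t / l u\<close>
  is at least 1.\<close>

lemma weighted_primitive_bound:
  fixes g g' l :: "real \<Rightarrow> real"
  assumes g: "\<And>t. (g has_real_derivative g' t) (at t)" and cg: "continuous_on UNIV g'"
    and "g \<alpha> = 0" and t: "t \<in> {\<alpha>..m}" and cl: "continuous_on {\<alpha>..m} l"
    and pos: "\<And>u. u \<in> {\<alpha>..m} \<Longrightarrow> l u > 0"
    and mono: "\<And>u. u \<in> {\<alpha>..t} \<Longrightarrow> l u \<le> l t"
  shows "(g t)\<^sup>2 \<le> (t - \<alpha>) * l t * integral {\<alpha>..m} (\<lambda>u. (g' u)\<^sup>2 / l u)"
proof -
  have sub: "{\<alpha>..t} \<subseteq> {\<alpha>..m}" using t by auto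
  have cg': "continuous_on A g'" for A by (rule continuous_on_subset[OF cg]) auto
  have nz: "\<And>u. u \<in> {\<alpha>..m} \<Longrightarrow> l u \<noteq> 0" using pos by force
  have cq: "continuous_on {\<alpha>..m} (\<lambda>u. (g' u)\<^sup>2 / l u)"
    by (intro continuous_intros cg' cl) (use nz in auto)
  have "integral {\<alpha>..t} g' = g t - g \<alpha>"
    using t g by (intro integral_unique fundamental_theorem_of_calculus)
       (auto simp: has_real_derivative_iff_has_vector_derivative[symmetric] intro: has_field_derivative_at_within)
  then have g_le: "(g t)\<^sup>2 \<le> (t - \<alpha>) * integral {\<alpha>..t} (\<lambda>u. (g' u)\<^sup>2)"
    using integral_power2_le[OF cg', of \<alpha> t] t \<open>g \<alpha> = 0\<close> by simp
  have "integral {\<alpha>..t} (\<lambda>u. (g' u)\<^sup>2) \<le> integral {\<alpha>..t} (\<lambda>u. l t * ((g' u)\<^sup>2 / l u))"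
  proof (rule integral_le)
    show "(\<lambda>u. (g' u)\<^sup>2) integrable_on {\<alpha>..t}"
      by (intro integrable_continuous_interval continuous_intros cg')
    show "(\<lambda>u. l t * ((g' u)\<^sup>2 / l u)) integrable_on {\<alpha>..t}"
      by (intro integrable_continuous_interval continuous_intros continuous_on_subset[OF cq sub])
    show "(g' u)\<^sup>2 \<le> l t * ((g' u)\<^sup>2 / l u)" if "u \<in> {\<alpha>..t}" for u
    proof -
      have "l u > 0" using pos that sub by blast
      with mult_right_mono[OF mono[OF that], of "(g' u)\<^sup>2"] show ?thesis by (simp add: field_simps)
    qed
  qed
  also have "\<dots> = l t * integral {\<alpha>..t} (\<lambda>u. (g' u)\<^sup>2 / l u)"
    by (rule integral_mult_right)
  also have "l t * integral {\<alpha>..t} (\<lambda>u. (g' u)\<^sup>2 / l u) \<le> l t * integral {\<alpha>..m} (\<lambda>u. (g' u)\<^sup>2 / l u)"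
    by (intro mult_left_mono integral_subset_le sub)
      (use pos t less_imp_le[OF pos[OF t]] in \<open>auto intro!: integrable_continuous_interval continuous_on_subset[OF cq] divide_nonneg_pos\<close>)
  finally show ?thesis
    using order_trans[OF g_le mult_left_mono] t by (simp add: mult.assoc)
qed

text \<open>Up to the point \<open>m\<close> of greatest width, concavity makes \<open>b - a\<close>
  nondecreasing, so \<open>weighted_primitive_bound\<close> yields
  \<open>(g t)^2 / (b t - a t) \<le> (t - \<alpha>) * G\<close>. Of the two powers of a slope, one
  is absorbed by the factor \<open>t - \<alpha>\<close> and the other is integrated; each costs one
  \<open>D\<close>.\<close>

lemma hardy_left:
  fixes a b a' b' g g' :: "real \<Rightarrow> real" and \<alpha> m :: real
  defines "G \<equiv> integral {\<alpha>..m} (\<lambda>u. (g' u)\<^sup>2 / (b u - a u))"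
  assumes "\<alpha> \<le> m"
    and g: "\<And>t. (g has_real_derivative g' t) (at t)" and cg: "continuous_on UNIV g'"
    and a: "\<And>t. (a has_real_derivative a' t) (at t)" and ca: "continuous_on UNIV a'"
    and b: "\<And>t. (b has_real_derivative b' t) (at t)" and cb: "continuous_on UNIV b'"
    and ta: "\<And>t u. a t + a' t * (u - t) \<le> a u"
    and tb: "\<And>t u. b u \<le> b t + b' t * (u - t)"
    and pos: "\<And>t. t \<in> {\<alpha>..m} \<Longrightarrow> a t < b t"
    and top: "\<And>t. t \<in> {\<alpha>..m} \<Longrightarrow> b t - a t \<le> b m - a m"
    and oa: "\<And>t u. t \<in> {\<alpha>..m} \<Longrightarrow> u \<in> {\<alpha>..m} \<Longrightarrow> \<bar>a t - a u\<bar> \<le> D"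
    and ob: "\<And>t u. t \<in> {\<alpha>..m} \<Longrightarrow> u \<in> {\<alpha>..m} \<Longrightarrow> \<bar>b t - b u\<bar> \<le> D"
    and g0: "g \<alpha> = 0"
  shows "integral {\<alpha>..m} (\<lambda>t. (g t)\<^sup>2 * ((a' t)\<^sup>2 + (b' t)\<^sup>2) / (b t - a t)) \<le> 4 * D\<^sup>2 * G"
    and "integral {\<alpha>..m} (\<lambda>t. (g t)\<^sup>2 / (b t - a t)) \<le> (m - \<alpha>)\<^sup>2 * G"
proof -
  have cont: "continuous_on A f" if "\<And>t. (f has_real_derivative f' t) (at t)" for A and f f' :: "real \<Rightarrow> real"
    by (meson DERIV_continuous_on that has_field_derivative_at_within)
  have sub: "continuous_on UNIV f \<Longrightarrow> continuous_on A f" for A and f :: "real \<Rightarrow> real"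
    by (rule continuous_on_subset) auto
  note [continuous_intros] = cont[OF g] cont[OF a] cont[OF b] sub[OF cg] sub[OF ca] sub[OF cb]
  have nz: "\<And>t. t \<in> {\<alpha>..m} \<Longrightarrow> b t - a t \<noteq> 0" using pos by force
  have G: "G \<ge> 0" unfolding G_def
    by (intro integral_nonneg integrable_continuous_interval continuous_intros)
       (use nz pos in \<open>auto intro!: divide_nonneg_pos\<close>)
  have D: "D \<ge> 0" using oa[of \<alpha> \<alpha>] assms(2) by auto
  \<comment> \<open>The tangents at \<open>t\<close>, evaluated at \<open>m\<close>, bound the width
    at \<open>m\<close> by the width at \<open>t\<close> plus
    \<open>(b' t - a' t) * (m - t)\<close>.\<close>
  have slope: "a' t \<le> b' t" if "t \<in> {\<alpha>..<m}" for t
  proof -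
    have "(b' t - a' t) * (m - t) \<ge> 0"
      using tb[of m t] ta[of t m] top[of t] that by (auto simp: algebra_simps)
    then show ?thesis using that by (auto simp: zero_le_mult_iff)
  qed
  have mono: "b u - a u \<le> b t - a t" if "t \<in> {\<alpha>..m}" "u \<in> {\<alpha>..t}" for t u
  proof (cases "t = m")
    case True
    then show ?thesis using top that by auto
  next
    case False
    then have "(b' t - a' t) * (u - t) \<le> 0"
      using slope[of t] that by (auto simp: mult_le_0_iff)
    then show ?thesis using tb[of u t] ta[of t u] by (simp add: algebra_simps)
  qed
  have key: "(g t)\<^sup>2 \<le> (t - \<alpha>) * (b t - a t) * G" if "t \<in> {\<alpha>..m}" for t
    unfolding G_def
    by (rule weighted_primitive_bound[OF g cg g0 that]) (use pos mono that in \<open>auto intro!: continuous_intros\<close>)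
  then have key': "(g t)\<^sup>2 / (b t - a t) \<le> (t - \<alpha>) * G" if "t \<in> {\<alpha>..m}" for t
    using pos[OF that] key[OF that] by (simp add: divide_simps mult_ac)
  have "integral {\<alpha>..m} (\<lambda>t. (g t)\<^sup>2 / (b t - a t)) \<le> integral {\<alpha>..m} (\<lambda>t. (m - \<alpha>) * G)"
  proof (rule integral_le)
    show "(\<lambda>t. (g t)\<^sup>2 / (b t - a t)) integrable_on {\<alpha>..m}"
      by (intro integrable_continuous_interval continuous_intros) (use nz in auto)
    show "(g t)\<^sup>2 / (b t - a t) \<le> (m - \<alpha>) * G" if "t \<in> {\<alpha>..m}" for t
      using key'[OF that] mult_right_mono[of "t - \<alpha>" "m - \<alpha>" G] that G by auto
  qed auto
  then show "integral {\<alpha>..m} (\<lambda>t. (g t)\<^sup>2 / (b t - a t)) \<le> (m - \<alpha>)\<^sup>2 * G"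
    using assms(2) by (simp add: power2_eq_square mult_ac)
  define p where "p t = max (b' t) 0" for t
  define q where "q t = max (- a' t) 0" for t
  have cpq [continuous_intros]: "continuous_on A p" "continuous_on A q" for A
    unfolding p_def[abs_def] q_def[abs_def] by (intro continuous_intros)+
  have ip: "integral {\<alpha>..m} p \<le> D"
    using integral_pos_part_deriv_concave_le[OF assms(2) b cb tb ob] by (simp add: p_def[abs_def])
  have "integral {\<alpha>..m} (\<lambda>t. max (- a' t) 0) \<le> D"
  proof (rule integral_pos_part_deriv_concave_le[OF assms(2), of "\<lambda>t. - a t"])
    show "((\<lambda>t. - a t) has_real_derivative - a' t) (at t)" for t by (rule DERIV_minus[OF a])
    show "- a u \<le> - a t + - a' t * (u - t)" for t u using ta[of t u] by simp
    show "\<bar>- a t - - a u\<bar> \<le> D" if "t \<in> {\<alpha>..m}" "u \<in> {\<alpha>..m}" for t u using oa[OF that] by simp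
  qed (intro continuous_intros)
  then have iq: "integral {\<alpha>..m} q \<le> D" by (simp add: q_def[abs_def])
  \<comment> \<open>Where the weight increases, \<open>a' \<le> b'\<close>, so both slopes are controlled by \<open>p\<close> and \<open>q\<close>; the tangent
    inequalities at \<open>t\<close>, evaluated at \<open>\<alpha>\<close>, bound \<open>(t - \<alpha>) p\<close> and \<open>(t - \<alpha>) q\<close> by \<open>D\<close>.\<close>
  have pw: "(g t)\<^sup>2 * ((a' t)\<^sup>2 + (b' t)\<^sup>2) / (b t - a t) \<le> 2 * D * G * (p t + q t)"
    if t: "t \<in> {\<alpha><..<m}" for t
  proof -
    have p: "(t - \<alpha>) * p t \<le> D"
    proof (cases "b' t \<ge> 0")
      case True
      have "(t - \<alpha>) * b' t \<le> b t - b \<alpha>" using tb[of \<alpha> t] by (simp add: algebra_simps)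
      also have "\<dots> \<le> D" using ob[of t \<alpha>] t by auto
      finally show ?thesis using True by (simp add: p_def)
    qed (use D in \<open>simp add: p_def\<close>)
    have q: "(t - \<alpha>) * q t \<le> D"
    proof (cases "a' t \<le> 0")
      case True
      have "(t - \<alpha>) * (- a' t) \<le> a \<alpha> - a t" using ta[of t \<alpha>] by (simp add: algebra_simps)
      also have "\<dots> \<le> D" using oa[of t \<alpha>] t by auto
      finally show ?thesis using True by (simp add: q_def)
    qed (use D in \<open>simp add: q_def\<close>)
    have pq: "p t \<ge> 0" "q t \<ge> 0" by (auto simp: p_def q_def)
    have "(a' t)\<^sup>2 + (b' t)\<^sup>2 \<le> 2 * ((p t)\<^sup>2 + (q t)\<^sup>2)"
    proof -
      have ab: "a' t \<le> b' t" using slope t by auto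
      \<comment> \<open>As \<open>a' t \<le> b' t\<close>, a positive \<open>a' t\<close> is at most
        \<open>p t\<close>, and a negative \<open>b' t\<close> has modulus at most
        \<open>q t\<close>.\<close>
      have "\<bar>a' t\<bar> \<le> max (p t) (q t)" "\<bar>b' t\<bar> \<le> max (p t) (q t)"
        using ab by (auto simp: p_def q_def)
      then have "(a' t)\<^sup>2 \<le> (max (p t) (q t))\<^sup>2" "(b' t)\<^sup>2 \<le> (max (p t) (q t))\<^sup>2"
        by (metis abs_ge_zero power2_abs power_mono)+
      moreover have "(max (p t) (q t))\<^sup>2 \<le> (p t)\<^sup>2 + (q t)\<^sup>2" by (simp add: max_def)
      moreover have "x + y \<le> 2 * s" if "x \<le> z" "y \<le> z" "z \<le> s" for x y z s :: real
        using that by linarith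
      ultimately show ?thesis by blast
    qed
    then have "(g t)\<^sup>2 / (b t - a t) * ((a' t)\<^sup>2 + (b' t)\<^sup>2) \<le> ((t - \<alpha>) * G) * (2 * ((p t)\<^sup>2 + (q t)\<^sup>2))"
      using key'[of t] t G by (intro mult_mono) auto
    also have "\<dots> = 2 * G * (((t - \<alpha>) * p t) * p t + ((t - \<alpha>) * q t) * q t)"
      by (simp add: power2_eq_square algebra_simps)
    also have "\<dots> \<le> 2 * G * (D * p t + D * q t)"
      using p q pq G by (intro mult_left_mono add_mono mult_right_mono) auto
    finally show ?thesis by (simp add: algebra_simps add_divide_distrib)
  qed
  have "integral {\<alpha><..<m} (\<lambda>t. (g t)\<^sup>2 * ((a' t)\<^sup>2 + (b' t)\<^sup>2) / (b t - a t))
      \<le> integral {\<alpha><..<m} (\<lambda>t. 2 * D * G * (p t + q t))"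
  proof (rule integral_le)
    show "(\<lambda>t. (g t)\<^sup>2 * ((a' t)\<^sup>2 + (b' t)\<^sup>2) / (b t - a t)) integrable_on {\<alpha><..<m}"
      unfolding integrable_on_open_interval_real
      by (intro integrable_continuous_interval continuous_intros) (use nz in auto)
    show "(\<lambda>t. 2 * D * G * (p t + q t)) integrable_on {\<alpha><..<m}"
      unfolding integrable_on_open_interval_real
      by (intro integrable_continuous_interval continuous_intros)
  qed (use pw in auto)
  also have "\<dots> = 2 * D * G * (integral {\<alpha>..m} p + integral {\<alpha>..m} q)"
    unfolding integral_open_interval_real
    by (subst integral_add[symmetric])
       (simp_all add: integrable_on_open_interval_real integrable_continuous_interval cpq)
  also have "\<dots> \<le> 2 * D * G * (D + D)"
    using D G ip iq by (intro mult_left_mono) auto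
  finally show "integral {\<alpha>..m} (\<lambda>t. (g t)\<^sup>2 * ((a' t)\<^sup>2 + (b' t)\<^sup>2) / (b t - a t)) \<le> 4 * D\<^sup>2 * G"
    by (simp add: integral_open_interval_real power2_eq_square algebra_simps)
qed

text \<open>Cutting at the point of greatest width leaves two halves, each with a zero of
  \<open>g\<close> at its outer end; the right half becomes a left half by reflection at 0.\<close>

lemma hardy_concave_weight:
  fixes a b a' b' g g' :: "real \<Rightarrow> real" and \<alpha> \<beta> :: real
  defines "G \<equiv> integral {\<alpha>..\<beta>} (\<lambda>u. (g' u)\<^sup>2 / (b u - a u))"
  assumes "\<alpha> \<le> \<beta>"
    and g: "\<And>t. (g has_real_derivative g' t) (at t)" and cg: "continuous_on UNIV g'"
    and a: "\<And>t. (a has_real_derivative a' t) (at t)" and ca: "continuous_on UNIV a'"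
    and b: "\<And>t. (b has_real_derivative b' t) (at t)" and cb: "continuous_on UNIV b'"
    and ta: "\<And>t u. a t + a' t * (u - t) \<le> a u"
    and tb: "\<And>t u. b u \<le> b t + b' t * (u - t)"
    and pos: "\<And>t. t \<in> {\<alpha>..\<beta>} \<Longrightarrow> a t < b t"
    and oa: "\<And>t u. t \<in> {\<alpha>..\<beta>} \<Longrightarrow> u \<in> {\<alpha>..\<beta>} \<Longrightarrow> \<bar>a t - a u\<bar> \<le> D"
    and ob: "\<And>t u. t \<in> {\<alpha>..\<beta>} \<Longrightarrow> u \<in> {\<alpha>..\<beta>} \<Longrightarrow> \<bar>b t - b u\<bar> \<le> D"
    and g0: "g \<alpha> = 0" "g \<beta> = 0"
  shows "integral {\<alpha>..\<beta>} (\<lambda>t. (g t)\<^sup>2 * ((a' t)\<^sup>2 + (b' t)\<^sup>2) / (b t - a t)) \<le> 4 * D\<^sup>2 * G" (is ?A)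
    and "integral {\<alpha>..\<beta>} (\<lambda>t. (g t)\<^sup>2 / (b t - a t)) \<le> (\<beta> - \<alpha>)\<^sup>2 * G" (is ?B)
proof -
  have cont: "continuous_on A f" if "\<And>t. (f has_real_derivative f' t) (at t)" for A and f f' :: "real \<Rightarrow> real"
    by (meson DERIV_continuous_on that has_field_derivative_at_within)
  have sub: "continuous_on UNIV f \<Longrightarrow> continuous_on A f" for A and f :: "real \<Rightarrow> real"
    by (rule continuous_on_subset) auto
  note [continuous_intros] = cont[OF g] cont[OF a] cont[OF b] sub[OF cg] sub[OF ca] sub[OF cb]
  have nz: "\<And>t. t \<in> {\<alpha>..\<beta>} \<Longrightarrow> b t - a t \<noteq> 0" using pos by force
  have "continuous_on {\<alpha>..\<beta>} (\<lambda>t. b t - a t)" by (intro continuous_intros)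
  then obtain m where m: "m \<in> {\<alpha>..\<beta>}" "\<And>t. t \<in> {\<alpha>..\<beta>} \<Longrightarrow> b t - a t \<le> b m - a m"
    using continuous_attains_sup[OF compact_Icc, of \<alpha> \<beta> "\<lambda>t. b t - a t"] assms(2) by auto
  let ?F = "\<lambda>t. (g t)\<^sup>2 * ((a' t)\<^sup>2 + (b' t)\<^sup>2) / (b t - a t)"
  let ?H = "\<lambda>t. (g t)\<^sup>2 / (b t - a t)"
  let ?Q = "\<lambda>u. (g' u)\<^sup>2 / (b u - a u)"
  have refl: "integral {- v..- u} (\<lambda>t. f (- t)) = integral {u..v} f" for u v and f :: "real \<Rightarrow> real"
    by (rule Henstock_Kurzweil_Integration.integral_reflect_real)
  have L: "integral {\<alpha>..m} ?F \<le> 4 * D\<^sup>2 * integral {\<alpha>..m} ?Q" "integral {\<alpha>..m} ?H \<le> (m - \<alpha>)\<^sup>2 * integral {\<alpha>..m} ?Q"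
    using m by (intro hardy_left[where D=D, OF _ g cg a ca b cb ta tb]; use pos oa ob g0 in auto)+
  have neg: "((\<lambda>t. f (- t)) has_real_derivative - f' (- t)) (at t)"
    if "\<And>t. (f has_real_derivative f' t) (at t)" for f f' :: "real \<Rightarrow> real" and t
  proof -
    have "(uminus has_real_derivative - 1) (at t)" by (auto intro!: derivative_eq_intros)
    from DERIV_chain'[OF this that] show ?thesis by simp
  qed
  have cn: "continuous_on UNIV (\<lambda>t. - f (- t))" if "continuous_on UNIV f" for f :: "real \<Rightarrow> real"
    by (intro continuous_intros continuous_on_compose2[OF that]) auto
  \<comment> \<open>Reflection flips the sign of all derivatives, which the squares do not see, and
    preserves the convexity of \<open>a\<close> and the concavity of \<open>b\<close>.\<close>
  have R: "integral {- \<beta>..- m} (\<lambda>t. (g (- t))\<^sup>2 * ((- a' (- t))\<^sup>2 + (- b' (- t))\<^sup>2) / (b (- t) - a (- t)))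
      \<le> 4 * D\<^sup>2 * integral {- \<beta>..- m} (\<lambda>t. (- g' (- t))\<^sup>2 / (b (- t) - a (- t)))"
    "integral {- \<beta>..- m} (\<lambda>t. (g (- t))\<^sup>2 / (b (- t) - a (- t)))
      \<le> (- m - (- \<beta>))\<^sup>2 * integral {- \<beta>..- m} (\<lambda>t. (- g' (- t))\<^sup>2 / (b (- t) - a (- t)))"
  proof -
    have ta': "a (- t) + - a' (- t) * (u - t) \<le> a (- u)" for t u
      using ta[of "- t" "- u"] by (simp add: algebra_simps)
    have tb': "b (- u) \<le> b (- t) + - b' (- t) * (u - t)" for t u
      using tb[of "- u" "- t"] by (simp add: algebra_simps)
    show "integral {- \<beta>..- m} (\<lambda>t. (g (- t))\<^sup>2 * ((- a' (- t))\<^sup>2 + (- b' (- t))\<^sup>2) / (b (- t) - a (- t)))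
      \<le> 4 * D\<^sup>2 * integral {- \<beta>..- m} (\<lambda>t. (- g' (- t))\<^sup>2 / (b (- t) - a (- t)))"
      by (rule hardy_left(1)[where D=D, OF _ neg[OF g] cn[OF cg] neg[OF a] cn[OF ca] neg[OF b] cn[OF cb] ta' tb'])
        (use m pos oa ob g0 in auto)
    show "integral {- \<beta>..- m} (\<lambda>t. (g (- t))\<^sup>2 / (b (- t) - a (- t)))
      \<le> (- m - (- \<beta>))\<^sup>2 * integral {- \<beta>..- m} (\<lambda>t. (- g' (- t))\<^sup>2 / (b (- t) - a (- t)))"
      by (rule hardy_left(2)[where D=D, OF _ neg[OF g] cn[OF cg] neg[OF a] cn[OF ca] neg[OF b] cn[OF cb] ta' tb'])
        (use m pos oa ob g0 in auto)
  qed
  have R': "integral {m..\<beta>} ?F \<le> 4 * D\<^sup>2 * integral {m..\<beta>} ?Q"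
      "integral {m..\<beta>} ?H \<le> (\<beta> - m)\<^sup>2 * integral {m..\<beta>} ?Q"
    using R refl[of \<beta> m ?F] refl[of \<beta> m ?H] refl[of \<beta> m ?Q] by simp_all
  have comb: "integral {\<alpha>..\<beta>} f = integral {\<alpha>..m} f + integral {m..\<beta>} f"
    if "continuous_on {\<alpha>..\<beta>} f" for f :: "real \<Rightarrow> real"
    using Henstock_Kurzweil_Integration.integral_combine[OF _ _ integrable_continuous_interval[OF that]] m(1)
    by (metis atLeastAtMost_iff)
  have cF: "continuous_on {\<alpha>..\<beta>} ?F" and cH: "continuous_on {\<alpha>..\<beta>} ?H" and cQ: "continuous_on {\<alpha>..\<beta>} ?Q"
    by (intro continuous_intros; use nz in auto)+
  have G: "G = integral {\<alpha>..m} ?Q + integral {m..\<beta>} ?Q" unfolding G_def by (rule comb[OF cQ])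
  have Q0: "integral {\<alpha>..m} ?Q \<ge> 0" "integral {m..\<beta>} ?Q \<ge> 0"
    by (intro integral_nonneg integrable_continuous_interval continuous_on_subset[OF cQ];
        use m pos in \<open>fastforce intro!: divide_nonneg_pos\<close>)+
  show ?A using L(1) R'(1) unfolding comb[OF cF] G by (simp add: algebra_simps)
  have "(m - \<alpha>)\<^sup>2 * integral {\<alpha>..m} ?Q \<le> (\<beta> - \<alpha>)\<^sup>2 * integral {\<alpha>..m} ?Q"
    "(\<beta> - m)\<^sup>2 * integral {m..\<beta>} ?Q \<le> (\<beta> - \<alpha>)\<^sup>2 * integral {m..\<beta>} ?Q"
    using m(1) Q0 by (intro mult_right_mono power_mono; auto)+
  then show ?B using L(2) R'(2) unfolding comb[OF cH] G by (simp add: algebra_simps)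
qed

section \<open>Smooth concave barriers inside a convex set\<close>

text \<open>The tangent inequality is Jensen's inequality for \<open>exp\<close>:
  \<open>S y / S x\<close> is the average of \<open>exp (\<delta> i)\<close> with weights
  \<open>w i\<close>, hence at least \<open>exp\<close> of the average \<open>m\<close>, and
  \<open>m = - N * Db x (y - x)\<close>.\<close>

lemma softmin_tangent:
  fixes \<alpha> :: "'i \<Rightarrow> real^3" and \<beta> :: "'i \<Rightarrow> real" and N :: real
  assumes D: "finite D" "D \<noteq> {}" and N: "N > 0"
  defines "S \<equiv> \<lambda>x. \<Sum>i\<in>D. exp (- N * (\<alpha> i \<bullet> x + \<beta> i))"
  defines "Db \<equiv> \<lambda>x h. (\<Sum>i\<in>D. exp (- N * (\<alpha> i \<bullet> x + \<beta> i)) * (\<alpha> i \<bullet> h)) / S x"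
  shows "((\<lambda>x. - ln (S x) / N) has_derivative Db x) (at x)"
    and "- ln (S y) / N \<le> - ln (S x) / N + Db x (y - x)"
    and "C_k n (\<lambda>x. - ln (S x) / N)"
proof -
  have pos: "S x > 0" for x unfolding S_def using D by (intro sum_pos) auto
  have dS: "(S has_derivative (\<lambda>h. \<Sum>i\<in>D. exp (- N * (\<alpha> i \<bullet> x + \<beta> i)) * (- N * (\<alpha> i \<bullet> h)))) (at x)" for x
    unfolding S_def by (auto intro!: derivative_eq_intros sum.cong simp: algebra_simps)
  have "((\<lambda>x. (- 1 / N) * ln (S x)) has_derivative
      (\<lambda>h. (- 1 / N) * (inverse (S x) * (\<Sum>i\<in>D. exp (- N * (\<alpha> i \<bullet> x + \<beta> i)) * (- N * (\<alpha> i \<bullet> h)))))) (at x)"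
    using has_derivative_ln[OF pos dS] by (intro has_derivative_mult_right) (simp add: mult.commute)
  also have "(\<lambda>h. (- 1 / N) * (inverse (S x) * (\<Sum>i\<in>D. exp (- N * (\<alpha> i \<bullet> x + \<beta> i)) * (- N * (\<alpha> i \<bullet> h))))) = Db x"
  proof
    fix h
    have "(\<Sum>i\<in>D. exp (- N * (\<alpha> i \<bullet> x + \<beta> i)) * (- N * (\<alpha> i \<bullet> h)))
        = - N * (\<Sum>i\<in>D. exp (- N * (\<alpha> i \<bullet> x + \<beta> i)) * (\<alpha> i \<bullet> h))"
      by (simp add: sum_distrib_left mult_ac sum_negf)
    then show "(- 1 / N) * (inverse (S x) * (\<Sum>i\<in>D. exp (- N * (\<alpha> i \<bullet> x + \<beta> i)) * (- N * (\<alpha> i \<bullet> h)))) = Db x h"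
      using N pos[of x] by (simp add: Db_def field_simps)
  qed
  finally show "((\<lambda>x. - ln (S x) / N) has_derivative Db x) (at x)" by simp
  define w where "w i = exp (- N * (\<alpha> i \<bullet> x + \<beta> i)) / S x" for i
  define \<delta> where "\<delta> i = - N * (\<alpha> i \<bullet> (y - x))" for i
  define m where "m = (\<Sum>i\<in>D. w i * \<delta> i)"
  have w1: "(\<Sum>i\<in>D. w i) = 1"
    using pos[of x] by (simp add: w_def sum_divide_distrib[symmetric] S_def)
  have w0: "w i \<ge> 0" for i using pos[of x] by (simp add: w_def)
  have m: "m = - N * Db x (y - x)"
    by (simp add: m_def Db_def w_def \<delta>_def sum_divide_distrib sum_distrib_left mult_ac)
  have "S y / S x = (\<Sum>i\<in>D. w i * exp (\<delta> i))"
  proof -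
    have "exp (- N * (\<alpha> i \<bullet> y + \<beta> i)) = exp (- N * (\<alpha> i \<bullet> x + \<beta> i)) * exp (\<delta> i)" for i
      unfolding exp_add[symmetric] \<delta>_def by (simp add: algebra_simps)
    then have "S y = (\<Sum>i\<in>D. exp (- N * (\<alpha> i \<bullet> x + \<beta> i)) * exp (\<delta> i))"
      unfolding S_def by simp
    then show ?thesis unfolding w_def by (simp add: sum_divide_distrib[symmetric])
  qed
  also have "\<dots> = exp m * (\<Sum>i\<in>D. w i * exp (\<delta> i - m))"
    unfolding sum_distrib_left by (intro sum.cong refl) (simp add: exp_diff)
  finally have eq: "S y / S x = exp m * (\<Sum>i\<in>D. w i * exp (\<delta> i - m))" .
  \<comment> \<open>The inequality \<open>exp s \<ge> 1 + s\<close> at the deviations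
    \<open>\<delta> i - m\<close>, whose weighted sum is 0.\<close>
  have "(\<Sum>i\<in>D. w i * exp (\<delta> i - m)) \<ge> (\<Sum>i\<in>D. w i * (1 + (\<delta> i - m)))"
    by (intro sum_mono mult_left_mono exp_ge_add_one_self w0)
  also have "(\<Sum>i\<in>D. w i * (1 + (\<delta> i - m))) = (\<Sum>i\<in>D. w i) + m - (\<Sum>i\<in>D. w i) * m"
    by (simp add: m_def sum.distrib sum_subtractf algebra_simps sum_distrib_right)
  also have "\<dots> = 1" using w1 by simp
  finally have "S y / S x \<ge> exp m" unfolding eq by simp
  then have "m \<le> ln (S y / S x)"
    using pos by (metis exp_gt_zero ln_exp ln_le_cancel_iff divide_pos_pos)
  also have "ln (S y / S x) = ln (S y) - ln (S x)" using pos[of x] pos[of y] by (simp add: ln_div)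
  finally show "- ln (S y) / N \<le> - ln (S x) / N + Db x (y - x)"
    using N unfolding m by (simp add: field_simps)
  have "C_k n (\<lambda>x. (- 1 / N) * ln (S x))"
    unfolding S_def
    by (intro C_k_cmult C_k_ln C_k_sum C_k_exp C_k_add C_k_inner_right C_k_const)
      (use pos in \<open>simp add: S_def\<close>)
  then show "C_k n (\<lambda>x. - ln (S x) / N)" by simp
qed

text \<open>A sum of \<open>n\<close> positive terms lies between its largest term and
  \<open>n\<close> times it, so the soft minimum is below the minimum by at most
  \<open>ln n / N\<close>. Through the fourth property, normals orthogonal to \<open>e\<close> make
  it constant along \<open>e\<close>.\<close>

lemma softmin_exists:
  fixes \<alpha> :: "'i \<Rightarrow> real^3" and \<beta> :: "'i \<Rightarrow> real" and N :: real
  assumes D: "finite D" "D \<noteq> {}" and N: "N > 0"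
  obtains b Db where "\<And>n. C_k n b" "\<And>x. (b has_derivative Db x) (at x)"
    "\<And>x y. b y \<le> b x + Db x (y - x)"
    "\<And>x y. \<forall>i\<in>D. \<alpha> i \<bullet> x = \<alpha> i \<bullet> y \<Longrightarrow> b x = b y"
    "\<And>i x. i \<in> D \<Longrightarrow> b x \<le> \<alpha> i \<bullet> x + \<beta> i"
    "\<And>m x. \<forall>i\<in>D. m \<le> \<alpha> i \<bullet> x + \<beta> i \<Longrightarrow> m - ln (card D) / N \<le> b x"
proof -
  define S where "S = (\<lambda>x. \<Sum>i\<in>D. exp (- N * (\<alpha> i \<bullet> x + \<beta> i)))"
  define Db where "Db = (\<lambda>x h. (\<Sum>i\<in>D. exp (- N * (\<alpha> i \<bullet> x + \<beta> i)) * (\<alpha> i \<bullet> h)) / S x)"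
  have Spos: "S x > 0" for x unfolding S_def using D by (intro sum_pos) auto
  show ?thesis
  proof (rule that[where b="\<lambda>x. - ln (S x) / N" and Db=Db])
    show "C_k n (\<lambda>x. - ln (S x) / N)" for n
      using softmin_tangent(3)[OF D N] unfolding S_def .
    show "((\<lambda>x. - ln (S x) / N) has_derivative Db x) (at x)" for x
      using softmin_tangent(1)[OF D N] unfolding S_def Db_def .
    show "- ln (S y) / N \<le> - ln (S x) / N + Db x (y - x)" for x y
      using softmin_tangent(2)[OF D N] unfolding S_def Db_def .
    show "- ln (S x) / N = - ln (S y) / N" if "\<forall>i\<in>D. \<alpha> i \<bullet> x = \<alpha> i \<bullet> y" for x y
      using that by (simp add: S_def)
    show "- ln (S x) / N \<le> \<alpha> i \<bullet> x + \<beta> i" if "i \<in> D" for i x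
    proof -
      have "exp (- N * (\<alpha> i \<bullet> x + \<beta> i)) \<le> S x"
        unfolding S_def using that D by (intro member_le_sum) auto
      then have "- N * (\<alpha> i \<bullet> x + \<beta> i) \<le> ln (S x)"
        using Spos by (metis exp_gt_zero ln_exp ln_le_cancel_iff)
      then show ?thesis using N by (simp add: field_simps)
    qed
    show "m - ln (card D) / N \<le> - ln (S x) / N" if m: "\<forall>i\<in>D. m \<le> \<alpha> i \<bullet> x + \<beta> i" for m x
    proof -
      have n: "real (card D) > 0" using D by (simp add: card_gt_0_iff)
      have "S x \<le> (\<Sum>i\<in>D. exp (- N * m))"
        unfolding S_def using m N by (intro sum_mono) auto
      then have "S x \<le> real (card D) * exp (- N * m)" by simp
      then have "ln (S x) \<le> ln (real (card D) * exp (- N * m))" using Spos[of x] n by simp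
      also have "\<dots> = ln (card D) - N * m" using n by (simp add: ln_mult)
      finally have "ln (S x) / N \<le> (ln (card D) - N * m) / N" using N by (simp add: divide_right_mono)
      also have "\<dots> = ln (card D) / N - m" using N by (simp add: field_simps)
      finally show ?thesis by simp
    qed
  qed
qed

lemma segment_in_convex:
  assumes "convex S" "x \<in> S" "x + t *\<^sub>R e \<in> S" "0 \<le> s" "s \<le> t"
  shows "x + s *\<^sub>R e \<in> S"
proof (cases "t = 0")
  case False
  then have "t > 0" using assms by auto
  have "(1 - s / t) *\<^sub>R x + (s / t) *\<^sub>R (x + t *\<^sub>R e) \<in> S"
    using assms \<open>t > 0\<close> by (intro convexD) auto
  then show ?thesis using \<open>t > 0\<close> by (simp add: algebra_simps)
qed (use assms in auto)

text \<open>The hyperplane supports \<Omega> at the point \<open>z\<close> where the ray from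
  \<open>x0\<close> in direction \<open>e\<close> leaves it. As \<open>x0\<close> lies strictly
  below, the hyperplane is transversal to \<open>e\<close> and is the graph of an affine function
  constant along \<open>e\<close>. Stopping \<eta> short of it stays in \<Omega> on the line through
  \<open>x0\<close>, hence by openness on nearby lines.\<close>

lemma supporting_affine:
  fixes \<Omega> :: "(real^3) set"
  assumes \<Omega>: "open \<Omega>" "convex \<Omega>" "bounded \<Omega>" and e: "norm e = 1"
    and K: "K \<subseteq> \<Omega>" and \<eta>: "\<eta> > 0" "\<And>x. x \<in> K \<Longrightarrow> x + (4 * \<eta>) *\<^sub>R e \<in> \<Omega>" and x0: "x0 \<in> K"
  obtains \<alpha> \<beta> U where "\<alpha> \<bullet> e = 0" "open U" "x0 \<in> U"
    "\<And>x. x \<in> K \<Longrightarrow> x \<bullet> e + 4 * \<eta> \<le> \<alpha> \<bullet> x + \<beta>"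
    "\<And>x. x \<in> U \<Longrightarrow> x + (\<alpha> \<bullet> x + \<beta> - x \<bullet> e - \<eta>) *\<^sub>R e \<in> \<Omega>"
proof -
  define T where "T = {t. t \<ge> 0 \<and> x0 + t *\<^sub>R e \<in> \<Omega>}"
  have x0\<Omega>: "x0 \<in> \<Omega>" using K x0 by auto
  obtain B where B: "\<And>x. x \<in> \<Omega> \<Longrightarrow> norm x \<le> B" using \<Omega>(3) by (auto simp: bounded_iff)
  have Tb: "t \<le> 2 * B" if "t \<in> T" for t
  proof -
    have "norm (t *\<^sub>R e) \<le> norm (x0 + t *\<^sub>R e) + norm x0"
      by (metis add_diff_cancel_left' norm_triangle_ineq4)
    also have "\<dots> \<le> B + B" using that x0\<Omega> by (intro add_mono B) (auto simp: T_def)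
    finally show ?thesis using that e by (simp add: T_def)
  qed
  have bdd: "bdd_above T" using Tb by (auto simp: bdd_above_def)
  have ne: "4 * \<eta> \<in> T" using \<eta> x0 by (auto simp: T_def)
  define \<tau> where "\<tau> = Sup T"
  have \<tau>: "4 * \<eta> \<le> \<tau>" unfolding \<tau>_def by (rule cSup_upper[OF ne bdd])
  have below: "x0 + t *\<^sub>R e \<in> \<Omega>" if t: "0 \<le> t" "t < \<tau>" for t
  proof -
    obtain t' where "t' \<in> T" "t < t'"
      using t(2) less_cSup_iff[of T t] ne bdd unfolding \<tau>_def by auto
    then show ?thesis using segment_in_convex[OF \<Omega>(2) x0\<Omega>, of t' e t] t by (auto simp: T_def)
  qed
  define z where "z = x0 + \<tau> *\<^sub>R e"
  have "z \<notin> \<Omega>"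
  proof
    assume "z \<in> \<Omega>"
    then obtain r where r: "r > 0" "ball z r \<subseteq> \<Omega>" using \<Omega>(1) open_contains_ball by blast
    have "dist z (z + (r/2) *\<^sub>R e) = r / 2" using r e by (simp add: dist_norm)
    then have "z + (r/2) *\<^sub>R e \<in> \<Omega>" using r by auto
    then have "\<tau> + r/2 \<in> T" using r \<tau> \<eta> by (auto simp: T_def z_def algebra_simps)
    then have "\<tau> + r/2 \<le> \<tau>" unfolding \<tau>_def by (rule cSup_upper[OF _ bdd])
    then show False using r by simp
  qed
  then obtain \<nu> c where \<nu>: "\<nu> \<noteq> 0" "\<And>x. x \<in> \<Omega> \<Longrightarrow> \<nu> \<bullet> x \<le> c" "c \<le> \<nu> \<bullet> z"
  proof -
    have "\<exists>a b. a \<noteq> 0 \<and> (\<forall>x\<in>\<Omega>. a \<bullet> x \<le> b) \<and> (\<forall>x\<in>{z}. b \<le> a \<bullet> x)"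
      using \<Omega>(2) x0\<Omega> \<open>z \<notin> \<Omega>\<close> by (intro separating_hyperplane_sets) blast+
    then show thesis using that by blast
  qed
  \<comment> \<open>Moving slightly along \<open>\<nu>\<close> stays in the open set, so the bound
    is not attained inside.\<close>
  have strict: "\<nu> \<bullet> x < \<nu> \<bullet> z" if x: "x \<in> \<Omega>" for x
  proof -
    obtain r where r: "r > 0" "ball x r \<subseteq> \<Omega>" using openE[OF \<Omega>(1) x] by blast
    define y where "y = x + (r / (2 * norm \<nu>)) *\<^sub>R \<nu>"
    have "dist x y < r" using r \<nu>(1) by (simp add: y_def dist_norm)
    then have "y \<in> \<Omega>" using r by auto
    then have "\<nu> \<bullet> y \<le> \<nu> \<bullet> z" using \<nu>(2,3) by force
    moreover have "\<nu> \<bullet> y > \<nu> \<bullet> x" using r \<nu>(1) by (simp add: y_def inner_add_right)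
    ultimately show ?thesis by simp
  qed
  define k where "k = \<nu> \<bullet> e"
  have k: "k > 0"
  proof -
    have "\<tau> * k > 0" using strict[OF x0\<Omega>] by (simp add: z_def k_def inner_add_right)
    then show ?thesis using \<tau> \<eta> by (simp add: zero_less_mult_iff)
  qed
  \<comment> \<open>Solving \<open>\<nu> \<bullet> (x + (r - x \<bullet> e) *\<^sub>R e) = \<nu>
    \<bullet> z\<close> for the height \<open>r\<close> gives
    \<open>r = \<alpha> \<bullet> x + \<beta>\<close>.\<close>
  define \<alpha> where "\<alpha> = e - (1 / k) *\<^sub>R \<nu>"
  define \<beta> where "\<beta> = (\<nu> \<bullet> z) / k"
  have B: "\<alpha> \<bullet> x + \<beta> = x \<bullet> e + (\<nu> \<bullet> z - \<nu> \<bullet> x) / k" for x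
    by (simp add: \<alpha>_def \<beta>_def inner_diff_left inner_commute[of x e] diff_divide_distrib)
  define U where "U = (\<lambda>x. x + (\<alpha> \<bullet> x + \<beta> - x \<bullet> e - \<eta>) *\<^sub>R e) -` \<Omega>"
  show ?thesis
  proof
    show "\<alpha> \<bullet> e = 0"
      using e k by (simp add: \<alpha>_def inner_diff_left k_def[symmetric] dot_square_norm)
    show "open U" unfolding U_def
      by (intro open_vimage \<Omega> continuous_intros)
    have "\<alpha> \<bullet> x0 + \<beta> - x0 \<bullet> e = \<tau>"
      unfolding B using k by (simp add: z_def inner_add_right k_def[symmetric])
    then have eq: "\<alpha> \<bullet> x0 + \<beta> - x0 \<bullet> e - \<eta> = \<tau> - \<eta>" by simp
    show "x0 \<in> U" unfolding U_def vimage_def mem_Collect_eq eq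
      by (rule below) (use \<tau> \<eta> in auto)
    show "x \<bullet> e + 4 * \<eta> \<le> \<alpha> \<bullet> x + \<beta>" if "x \<in> K" for x
      using strict[OF \<eta>(2)[OF that]] k unfolding B by (simp add: inner_add_right k_def[symmetric] field_simps)
    show "x + (\<alpha> \<bullet> x + \<beta> - x \<bullet> e - \<eta>) *\<^sub>R e \<in> \<Omega>" if "x \<in> U" for x
      using that by (simp add: U_def)
  qed
qed

text \<open>A soft minimum (log-sum-exp) of finitely many supporting affine functions is smooth and still
  concave.\<close>

lemma upper_barrier:
  fixes \<Omega> :: "(real^3) set"
  assumes \<Omega>: "open \<Omega>" "convex \<Omega>" "bounded \<Omega>" and e: "norm e = 1"
    and K: "compact K" "K \<noteq> {}" "K \<subseteq> \<Omega>"
  obtains b Db where "\<And>n. C_k n b" "\<And>x. (b has_derivative Db x) (at x)"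
    "\<And>x y. b y \<le> b x + Db x (y - x)" "\<And>x s. b (x + s *\<^sub>R e) = b x"
    "\<And>x. x \<in> K \<Longrightarrow> x \<bullet> e < b x" "\<And>x. x \<in> K \<Longrightarrow> x + (b x - x \<bullet> e) *\<^sub>R e \<in> \<Omega>"
proof -
  obtain \<delta> where \<delta>: "\<delta> > 0" "\<And>x. x \<in> K \<Longrightarrow> ball x \<delta> \<subseteq> \<Omega>"
  proof -
    obtain \<delta> where "\<delta> > 0" "(\<Union>x\<in>K. ball x \<delta>) \<subseteq> \<Omega>"
      using compact_subset_open_imp_ball_epsilon_subset[OF K(1) \<Omega>(1) K(3)] by blast
    then show ?thesis using that[of \<delta>] by blast
  qed
  \<comment> \<open>This leaves \<open>4 * \<eta> < \<delta>\<close>. Of the margin, one \<eta> pays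
    for the error of the soft minimum, one for the downward shift, and the rest keeps
    \<open>b\<close> strictly above \<open>K\<close>.\<close>
  define \<eta> where "\<eta> = \<delta> / 5"
  have \<eta>: "\<eta> > 0" using \<delta> by (simp add: \<eta>_def)
  have \<eta>K: "x + (4 * \<eta>) *\<^sub>R e \<in> \<Omega>" if "x \<in> K" for x
  proof -
    have "dist x (x + (4 * \<eta>) *\<^sub>R e) < \<delta>" using \<delta>(1) e by (simp add: dist_norm \<eta>_def)
    then show ?thesis using \<delta>(2)[OF that] by auto
  qed
  have ex: "\<forall>x0\<in>K. \<exists>\<alpha> \<beta> U. \<alpha> \<bullet> e = 0 \<and> open U \<and> x0 \<in> U \<and>
    (\<forall>x\<in>K. x \<bullet> e + 4 * \<eta> \<le> \<alpha> \<bullet> x + \<beta>) \<and>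
    (\<forall>x\<in>U. x + (\<alpha> \<bullet> x + \<beta> - x \<bullet> e - \<eta>) *\<^sub>R e \<in> \<Omega>)"
    by (meson supporting_affine[OF \<Omega> e K(3) \<eta> \<eta>K])
  then obtain \<alpha> \<beta> U where A: "\<And>i. i \<in> K \<Longrightarrow> \<alpha> i \<bullet> e = 0" "\<And>i. i \<in> K \<Longrightarrow> open (U i)" "\<And>i. i \<in> K \<Longrightarrow> i \<in> U i"
    "\<And>i x. i \<in> K \<Longrightarrow> x \<in> K \<Longrightarrow> x \<bullet> e + 4 * \<eta> \<le> \<alpha> i \<bullet> x + \<beta> i"
    "\<And>i x. i \<in> K \<Longrightarrow> x \<in> U i \<Longrightarrow> x + (\<alpha> i \<bullet> x + \<beta> i - x \<bullet> e - \<eta>) *\<^sub>R e \<in> \<Omega>"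
  proof -
    from bchoice[OF ex] obtain \<alpha> where 1: "\<forall>x0\<in>K. \<exists>\<beta> U. \<alpha> x0 \<bullet> e = 0 \<and> open U \<and> x0 \<in> U \<and>
      (\<forall>x\<in>K. x \<bullet> e + 4 * \<eta> \<le> \<alpha> x0 \<bullet> x + \<beta>) \<and>
      (\<forall>x\<in>U. x + (\<alpha> x0 \<bullet> x + \<beta> - x \<bullet> e - \<eta>) *\<^sub>R e \<in> \<Omega>)" ..
    from bchoice[OF 1] obtain \<beta> where 2: "\<forall>x0\<in>K. \<exists>U. \<alpha> x0 \<bullet> e = 0 \<and> open U \<and> x0 \<in> U \<and>
      (\<forall>x\<in>K. x \<bullet> e + 4 * \<eta> \<le> \<alpha> x0 \<bullet> x + \<beta> x0) \<and>
      (\<forall>x\<in>U. x + (\<alpha> x0 \<bullet> x + \<beta> x0 - x \<bullet> e - \<eta>) *\<^sub>R e \<in> \<Omega>)" ..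
    from bchoice[OF 2] obtain U where "\<forall>x0\<in>K. \<alpha> x0 \<bullet> e = 0 \<and> open (U x0) \<and> x0 \<in> U x0 \<and>
      (\<forall>x\<in>K. x \<bullet> e + 4 * \<eta> \<le> \<alpha> x0 \<bullet> x + \<beta> x0) \<and>
      (\<forall>x\<in>U x0. x + (\<alpha> x0 \<bullet> x + \<beta> x0 - x \<bullet> e - \<eta>) *\<^sub>R e \<in> \<Omega>)" ..
    then show thesis by (intro that[where \<alpha>=\<alpha> and \<beta>=\<beta> and U=U]) auto
  qed
  obtain D where D: "D \<subseteq> K" "finite D" "K \<subseteq> (\<Union>i\<in>D. U i)"
  proof (rule compactE_image[OF K(1), of K U])
    show "K \<subseteq> (\<Union>i\<in>K. U i)" using A(3) by blast
  qed (use A(2) that in auto)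
  have Dne: "D \<noteq> {}" using D K by auto
  define n where "n = real (card D)"
  have n: "n \<ge> 1" using D Dne by (simp add: n_def Suc_le_eq card_gt_0_iff)
  \<comment> \<open>\<open>ln n / \<eta>\<close> brings the soft minimum within \<eta> of the
    minimum; the summand 1 keeps \<open>N\<close> positive when \<open>n = 1\<close>.\<close>
  define N where "N = ln n / \<eta> + 1"
  have N: "N > 0" using n \<eta> by (simp add: N_def add_nonneg_pos)
  have lnn: "ln n / N \<le> \<eta>"
  proof -
    have "ln n \<le> \<eta> * N" using \<eta> by (simp add: N_def algebra_simps)
    then show ?thesis using N by (simp add: field_simps)
  qed
  obtain c Dc where c: "\<And>n. C_k n c" "\<And>x. (c has_derivative Dc x) (at x)"
    "\<And>x y. c y \<le> c x + Dc x (y - x)"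
    "\<And>x y. \<forall>i\<in>D. \<alpha> i \<bullet> x = \<alpha> i \<bullet> y \<Longrightarrow> c x = c y"
    "\<And>i x. i \<in> D \<Longrightarrow> c x \<le> \<alpha> i \<bullet> x + \<beta> i"
    "\<And>m x. \<forall>i\<in>D. m \<le> \<alpha> i \<bullet> x + \<beta> i \<Longrightarrow> m - ln (card D) / N \<le> c x"
    by (rule softmin_exists[OF D(2) Dne N, of \<alpha> \<beta>], rule that)
  \<comment> \<open>After the shift, \<open>b\<close> lies below the height that \<open>A(5)\<close>
    places inside \<Omega>, for whichever \<open>i\<close> in \<open>D\<close> has \<open>x\<close>
    in \<open>U i\<close>.\<close>
  define b where "b x = c x - \<eta>" for x
  have ub: "b x \<le> \<alpha> i \<bullet> x + \<beta> i - \<eta>" if "i \<in> D" for i x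
    using c(5)[OF that] by (simp add: b_def)
  have lb: "x \<bullet> e < b x" if "x \<in> K" for x
    using c(6)[of "x \<bullet> e + 4 * \<eta>" x] A(4) that D(1) lnn \<eta> by (fastforce simp: b_def n_def)
  show ?thesis
  proof
    show "C_k n b" for n
      unfolding b_def[abs_def] by (intro C_k_diff c(1) C_k_const)
    show "(b has_derivative Dc x) (at x)" for x
      unfolding b_def[abs_def] using has_derivative_diff[OF c(2) has_derivative_const] by simp
    show "b y \<le> b x + Dc x (y - x)" for x y
      unfolding b_def using c(3)[of y x] by simp
    have "\<alpha> i \<bullet> (x + s *\<^sub>R e) = \<alpha> i \<bullet> x" if "i \<in> D" for i x s
      using A(1) D that by (auto simp: inner_add_right)
    then show "b (x + s *\<^sub>R e) = b x" for x s
      using c(4) by (simp add: b_def)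
    show "x \<bullet> e < b x" if "x \<in> K" for x by (rule lb[OF that])
    show "x + (b x - x \<bullet> e) *\<^sub>R e \<in> \<Omega>" if x: "x \<in> K" for x
    proof -
      obtain i where i: "i \<in> D" "x \<in> U i" using D x by auto
      show ?thesis
        by (rule segment_in_convex[OF \<Omega>(2) _ A(5)[of i x]])
          (use i D x K(3) lb[OF x] ub[OF i(1), of x] in auto)
    qed
  qed
qed

text \<open>The upper barrier for the direction \<open>- e\<close>, with the sign of the function
  reversed.\<close>

lemma lower_barrier:
  fixes \<Omega> :: "(real^3) set"
  assumes \<Omega>: "open \<Omega>" "convex \<Omega>" "bounded \<Omega>" and e: "norm e = 1"
    and K: "compact K" "K \<noteq> {}" "K \<subseteq> \<Omega>"
  obtains a Da where "\<And>n. C_k n a" "\<And>x. (a has_derivative Da x) (at x)"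
    "\<And>x y. a x + Da x (y - x) \<le> a y" "\<And>x s. a (x + s *\<^sub>R e) = a x"
    "\<And>x. x \<in> K \<Longrightarrow> a x < x \<bullet> e" "\<And>x. x \<in> K \<Longrightarrow> x + (a x - x \<bullet> e) *\<^sub>R e \<in> \<Omega>"
proof -
  obtain b Db where b: "\<And>n. C_k n b" "\<And>x. (b has_derivative Db x) (at x)"
    "\<And>x y. b y \<le> b x + Db x (y - x)" "\<And>x s. b (x + s *\<^sub>R (- e)) = b x"
    "\<And>x. x \<in> K \<Longrightarrow> x \<bullet> (- e) < b x" "\<And>x. x \<in> K \<Longrightarrow> x + (b x - x \<bullet> (- e)) *\<^sub>R (- e) \<in> \<Omega>"
    using upper_barrier[OF \<Omega>, of "- e" K] e K by auto
  show ?thesis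
  proof (rule that[of "\<lambda>x. - b x" "\<lambda>x h. - Db x h"])
    show "C_k n (\<lambda>x. - b x)" for n using C_k_cmult[OF b(1), of n "-1"] by simp
    show "((\<lambda>x. - b x) has_derivative (\<lambda>h. - Db x h)) (at x)" for x by (rule has_derivative_minus[OF b(2)])
    show "- b x + - Db x (y - x) \<le> - b y" for x y using b(3)[of y x] by simp
    show "- b (x + s *\<^sub>R e) = - b x" for x s using b(4)[of x "- s"] by simp
    show "- b x < x \<bullet> e" if "x \<in> K" for x using b(5)[OF that] by simp
    show "x + (- b x - x \<bullet> e) *\<^sub>R e \<in> \<Omega>" if "x \<in> K" for x
    proof -
      have "(- b x - x \<bullet> e) *\<^sub>R e = (b x - x \<bullet> (- e)) *\<^sub>R (- e)"
        by (simp flip: scaleR_minus_left)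
      then show ?thesis using b(6)[OF that] by simp
    qed
  qed
qed

section \<open>Integrals along rays and lines\<close>

text \<open>The ray runs backwards from \<open>x\<close>, so that differentiating along
  \<open>e\<close> returns \<open>f\<close> (see \<open>ray_integral_along\<close>); replacing
  \<open>e\<close> by \<open>- e\<close> gives the ray running forwards.\<close>

definition ray_integral :: "real^3 \<Rightarrow> (real^3 \<Rightarrow> real) \<Rightarrow> real^3 \<Rightarrow> real"
  where "ray_integral e f x = integral {0..} (\<lambda>t. f (x - t *\<^sub>R e))"

text \<open>Only a bounded part of the ray can meet the support. Any \<open>M\<close> above
  \<open>norm x + R\<close> is allowed, so one interval serves for all \<open>x\<close> in a ball,
  as differentiation under the integral requires.\<close>

lemma ray_integral_eq:
  assumes "\<And>x. R < norm x \<Longrightarrow> f x = 0" "norm e = 1" "norm x + R \<le> M"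
  shows "ray_integral e f x = integral {0..M} (\<lambda>t. f (x - t *\<^sub>R e))"
proof -
  have "f (x - t *\<^sub>R e) = 0" if "t \<notin> {0..M}" "t \<in> {0..}" for t
  proof (rule assms(1))
    have "R < norm (t *\<^sub>R e) - norm x" using that assms by auto
    also have "\<dots> \<le> norm (x - t *\<^sub>R e)" by (metis norm_minus_commute norm_triangle_ineq2)
    finally show "R < norm (x - t *\<^sub>R e)" .
  qed
  then have "(\<lambda>t. if t \<in> {0..} then f (x - t *\<^sub>R e) else 0) = (\<lambda>t. if t \<in> {0..M} then f (x - t *\<^sub>R e) else 0)"
    by fastforce
  then have "integral UNIV (\<lambda>t. if t \<in> {0..} then f (x - t *\<^sub>R e) else 0)
      = integral UNIV (\<lambda>t. if t \<in> {0..M} then f (x - t *\<^sub>R e) else 0)"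
    by (rule arg_cong)
  then show ?thesis
    unfolding ray_integral_def integral_restrict_UNIV .
qed

lemma frechet_derivative_eq_sum_partial:
  fixes f :: "real^3 \<Rightarrow> real"
  assumes "f differentiable (at x)"
  shows "frechet_derivative f (at x) h = (\<Sum>i\<in>UNIV. h $ i * partial i f x)"
proof -
  have lin: "linear (frechet_derivative f (at x))"
    using assms by (rule linear_frechet_derivative)
  have "frechet_derivative f (at x) h = frechet_derivative f (at x) (\<Sum>i\<in>UNIV. h $ i *\<^sub>R axis i 1)"
    by (simp add: basis_expansion flip: scalar_mult_eq_scaleR)
  also have "\<dots> = (\<Sum>i\<in>UNIV. h $ i * partial i f x)"
    by (simp add: linear_sum[OF lin] linear_cmul[OF lin] partial_def)
  finally show ?thesis .
qed

lemma partial_vanishes: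
  fixes f :: "real^3 \<Rightarrow> 'b::real_normed_vector"
  assumes "open U" "x \<in> U" "\<And>y. y \<in> U \<Longrightarrow> f y = 0"
  shows "frechet_derivative f (at x) h = 0" "partial i f x = 0"
proof -
  have "((\<lambda>y. 0) has_derivative (\<lambda>h. 0)) (at x)" by simp
  then have "(f has_derivative (\<lambda>h. 0)) (at x)"
    by (rule has_derivative_transform_within_open[OF _ assms(1,2)]) (simp add: assms(3))
  from frechet_derivative_at[OF this] show "frechet_derivative f (at x) h = 0"  "partial i f x = 0"
    unfolding partial_def by metis+
qed

lemma frechet_derivative_vanishes_off_ball:
  fixes f :: "real^3 \<Rightarrow> 'b::real_normed_vector"
  assumes "\<And>x. R < norm x \<Longrightarrow> f x = 0" "R < norm x"
  shows "frechet_derivative f (at x) h = 0"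
proof (rule partial_vanishes)
  show "open {x::real^3. R < norm x}" by (intro open_Collect_less continuous_intros)
qed (use assms in auto)

lemma C_k_directional_derivative:
  fixes f :: "real^3 \<Rightarrow> real"
  assumes "C_k (Suc n) f"
  shows "C_k n (\<lambda>x. frechet_derivative f (at x) h)"
proof -
  have "C_k n (\<lambda>x. \<Sum>i\<in>UNIV. h $ i * partial i f x)"
    using assms by (intro C_k_sum C_k_cmult) auto
  then show ?thesis
    using assms by (simp add: frechet_derivative_eq_sum_partial)
qed

lemma continuous_on_ray_integral:
  fixes f :: "real^3 \<Rightarrow> real"
  assumes "continuous_on UNIV f" "\<And>x. R < norm x \<Longrightarrow> f x = 0" "norm e = 1"
  shows "continuous_on UNIV (ray_integral e f)"
proof -
  have "isCont (ray_integral e f) x0" for x0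
  proof -
    define M where "M = norm x0 + 1 + R"
    have eq: "ray_integral e f x = integral (cbox 0 M) (\<lambda>t. f (x - t *\<^sub>R e))" if "x \<in> ball x0 1" for x
    proof -
      have "norm x + R \<le> M" using that norm_triangle_ineq2[of x x0]
        by (auto simp: M_def dist_norm norm_minus_commute)
      from ray_integral_eq[OF assms(2,3) this] show ?thesis by simp
    qed
    have "continuous_on (ball x0 1) (\<lambda>x. integral (cbox 0 M) (\<lambda>t. f (x - t *\<^sub>R e)))"
      by (rule integral_continuous_on_param)
        (auto intro!: continuous_on_compose2[OF assms(1)] continuous_intros simp: case_prod_unfold)
    then have "continuous_on (ball x0 1) (ray_integral e f)"
      by (rule continuous_on_eq) (simp add: eq)
    then show ?thesis by (simp add: continuous_on_eq_continuous_at)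
  qed
  then show ?thesis by (simp add: continuous_on_eq_continuous_at)
qed

lemma ray_integral_has_derivative:
  fixes f :: "real^3 \<Rightarrow> real"
  assumes f: "C_k (Suc n) f" and R: "\<And>x. R < norm x \<Longrightarrow> f x = 0" and e: "norm e = 1"
  shows "(ray_integral e f has_derivative
    (\<lambda>h. ray_integral e (\<lambda>y. frechet_derivative f (at y) h) x0)) (at x0)"
proof -
  define M where "M = norm x0 + 1 + R"
  \<comment> \<open>Differentiation under the integral takes the derivative as a continuous map into
    bounded linear functions; it is assembled from the continuous partial derivatives.\<close>
  define B where "B y = (\<Sum>i\<in>UNIV. partial i f y *\<^sub>R Blinfun (\<lambda>h::real^3. h $ i))" for y
  have diff: "f differentiable (at y)" for y using f by simp
  have B: "blinfun_apply (B y) h = frechet_derivative f (at y) h" for y h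
    by (simp add: B_def frechet_derivative_eq_sum_partial[OF diff] blinfun.sum_left
        blinfun.scaleR_left bounded_linear_Blinfun_apply bounded_linear_vec_nth mult.commute)
  have B': "blinfun_apply (B y) = frechet_derivative f (at y)" for y
    using B by blast
  have cB: "continuous_on A B" for A
    unfolding B_def[abs_def]
    using f by (intro continuous_intros continuous_on_subset[OF C_k_continuous[of n]]) auto
  have eq: "ray_integral e g x = integral (cbox 0 M) (\<lambda>t. g (x - t *\<^sub>R e))"
    if "x \<in> ball x0 1" "\<And>x. R < norm x \<Longrightarrow> g x = 0" for x and g
  proof -
    have "norm x + R \<le> M" using that norm_triangle_ineq2[of x x0]
      by (auto simp: M_def dist_norm norm_minus_commute)
    from ray_integral_eq[OF that(2) e this] show ?thesis by simp
  qed
  have "((\<lambda>x. integral (cbox 0 M) (\<lambda>t. f (x - t *\<^sub>R e))) has_derivative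
      blinfun_apply (integral (cbox 0 M) (\<lambda>t. B (x0 - t *\<^sub>R e)))) (at x0 within ball x0 1)"
  proof (rule leibniz_rule)
    fix x and t :: real
    have "(f has_derivative blinfun_apply (B (x - t *\<^sub>R e))) (at (x - t *\<^sub>R e))"
      using C_k_has_derivative[OF f, of "x - t *\<^sub>R e"] unfolding B' .
    moreover have "((\<lambda>x. x - t *\<^sub>R e) has_derivative (\<lambda>h. h)) (at x)"
      by (auto intro!: derivative_eq_intros)
    ultimately have *: "((\<lambda>x. f (x - t *\<^sub>R e)) has_derivative blinfun_apply (B (x - t *\<^sub>R e))) (at x)"
      using has_derivative_compose by blast
    show "((\<lambda>x. f (x - t *\<^sub>R e)) has_derivative blinfun_apply (B (x - t *\<^sub>R e))) (at x within ball x0 1)"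
      by (rule has_derivative_at_withinI[OF *])
  next
    show "(\<lambda>t. f (x - t *\<^sub>R e)) integrable_on cbox 0 M" for x
      by (intro integrable_continuous continuous_on_compose2[OF C_k_continuous[OF f]] continuous_intros) auto
    show "continuous_on (ball x0 1 \<times> cbox 0 M) (\<lambda>(x, t). B (x - t *\<^sub>R e))"
      by (auto intro!: continuous_on_compose2[OF cB[of UNIV]] continuous_intros simp: case_prod_unfold)
  qed auto
  then have D: "((\<lambda>x. integral (cbox 0 M) (\<lambda>t. f (x - t *\<^sub>R e))) has_derivative
      blinfun_apply (integral (cbox 0 M) (\<lambda>t. B (x0 - t *\<^sub>R e)))) (at x0)"
    by (simp add: at_within_open[of x0 "ball x0 1"])
  have "blinfun_apply (integral (cbox 0 M) (\<lambda>t. B (x0 - t *\<^sub>R e)))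
      = (\<lambda>h. ray_integral e (\<lambda>y. frechet_derivative f (at y) h) x0)"
  proof
    fix h
    have "blinfun_apply (integral (cbox 0 M) (\<lambda>t. B (x0 - t *\<^sub>R e))) h
        = integral (cbox 0 M) (\<lambda>t. B (x0 - t *\<^sub>R e) h)"
      by (intro blinfun_apply_integral integrable_continuous continuous_on_compose2[OF cB[of UNIV]]
          continuous_intros) auto
    then show "blinfun_apply (integral (cbox 0 M) (\<lambda>t. B (x0 - t *\<^sub>R e))) h
        = ray_integral e (\<lambda>y. frechet_derivative f (at y) h) x0"
      using eq[of x0 "\<lambda>y. frechet_derivative f (at y) h"]
      by (simp add: B frechet_derivative_vanishes_off_ball[OF R])
  qed
  with D have "((\<lambda>x. integral (cbox 0 M) (\<lambda>t. f (x - t *\<^sub>R e))) has_derivative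
      (\<lambda>h. ray_integral e (\<lambda>y. frechet_derivative f (at y) h) x0)) (at x0)" by simp
  then show ?thesis
    by (rule has_derivative_transform_within_open[of _ _ _ _ "ball x0 1"]) (auto simp: eq R)
qed

lemma C_k_ray_integral:
  fixes f :: "real^3 \<Rightarrow> real"
  assumes "C_k n f" "\<And>x. R < norm x \<Longrightarrow> f x = 0" "norm e = 1"
  shows "C_k n (ray_integral e f)"
  using assms(1,2)
proof (induction n arbitrary: f)
  case 0
  then show ?case using continuous_on_ray_integral assms(3) by auto
next
  case (Suc n)
  show ?case
  proof (rule C_k_SucI)
    show "(ray_integral e f has_derivative
      (\<lambda>h. ray_integral e (\<lambda>y. frechet_derivative f (at y) h) x)) (at x)" for x
      by (rule ray_integral_has_derivative[OF Suc.prems assms(3)])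
    show "C_k n (ray_integral e (\<lambda>y. frechet_derivative f (at y) (axis i 1)))" for i
      by (intro Suc.IH C_k_frechet_derivative Suc.prems frechet_derivative_vanishes_off_ball[OF Suc.prems(2)])
  qed
qed

text \<open>Fundamental theorem of calculus along the ray, whose far end
  \<open>x - M *\<^sub>R e\<close> lies outside the support.\<close>

lemma ray_integral_along:
  fixes f :: "real^3 \<Rightarrow> real"
  assumes f: "C_k (Suc n) f" and R: "\<And>x. R < norm x \<Longrightarrow> f x = 0" and e: "norm e = 1"
  shows "ray_integral e (\<lambda>y. frechet_derivative f (at y) e) x = f x"
proof -
  define M where "M = \<bar>R\<bar> + norm x + 1"
  have M: "M \<ge> 0" "norm x + R \<le> M" by (auto simp: M_def)
  have lin: "linear (frechet_derivative f (at y))" for y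
    using f by (intro linear_frechet_derivative) auto
  have "((\<lambda>t. f (x - t *\<^sub>R e)) has_vector_derivative - frechet_derivative f (at (x - t *\<^sub>R e)) e) (at t)" for t
  proof -
    have "((\<lambda>t. x - t *\<^sub>R e) has_derivative (\<lambda>s. - s *\<^sub>R e)) (at t)"
      by (auto intro!: derivative_eq_intros)
    from has_derivative_compose[OF this C_k_has_derivative[OF f]]
    have "((\<lambda>t. f (x - t *\<^sub>R e)) has_derivative
        (\<lambda>s. frechet_derivative f (at (x - t *\<^sub>R e)) (- s *\<^sub>R e))) (at t)" .
    moreover have "frechet_derivative f (at (x - t *\<^sub>R e)) (- s *\<^sub>R e)
        = s *\<^sub>R (- frechet_derivative f (at (x - t *\<^sub>R e)) e)" for s
      by (subst linear_cmul[OF lin]) simp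
    ultimately show ?thesis by (simp add: has_vector_derivative_def)
  qed
  then have int: "((\<lambda>t. - frechet_derivative f (at (x - t *\<^sub>R e)) e) has_integral
      f (x - M *\<^sub>R e) - f (x - 0 *\<^sub>R e)) {0..M}"
    using M by (intro fundamental_theorem_of_calculus) (auto intro: has_vector_derivative_at_within)
  have 0: "f (x - M *\<^sub>R e) = 0"
  proof (rule R)
    have "R < norm (M *\<^sub>R e) - norm x" using e by (simp add: M_def)
    also have "\<dots> \<le> norm (x - M *\<^sub>R e)" by (metis norm_minus_commute norm_triangle_ineq2)
    finally show "R < norm (x - M *\<^sub>R e)" .
  qed
  have "((\<lambda>t. frechet_derivative f (at (x - t *\<^sub>R e)) e) has_integral f x) {0..M}"
    using has_integral_neg[OF int] by (simp add: 0)
  then show ?thesis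
    using ray_integral_eq[where f="\<lambda>y. frechet_derivative f (at y) e",
        OF frechet_derivative_vanishes_off_ball[OF R] e M(2)]
    by (simp add: integral_unique)
qed

section \<open>Integration in an orthonormal frame\<close>

lemma prod_Basis_vec3:
  fixes h :: "real^3 \<Rightarrow> real"
  shows "(\<Prod>b\<in>Basis. h b) = h (axis 1 1) * h (axis 2 1) * h (axis 3 1)"
proof -
  have "Basis = (\<lambda>i. axis i 1 :: real^3) ` UNIV" by (auto simp: Basis_vec_def)
  moreover have "inj (\<lambda>i. axis i 1 :: real^3)" by (auto simp: inj_def axis_eq_axis)
  ultimately have "(\<Prod>b\<in>Basis. h b) = (\<Prod>i\<in>UNIV. h (axis i 1))" using prod.reindex[of "\<lambda>i. axis i 1 :: real^3" UNIV h] by simp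
  then show ?thesis unfolding UNIV_3 by (simp add: mult.assoc)
qed

text \<open>Lebesgue measure is determined by the volumes of boxes, and the preimage of a box is a
  product of three intervals. This carries integrals over \<open>real^3\<close> to products of
  \<open>lborel\<close>, where Fubini is available.\<close>

lemma distr_lborel_vec3:
  "distr (lborel :: (real \<times> real \<times> real) measure) borel
    (\<lambda>p. fst p *\<^sub>R axis 1 1 + fst (snd p) *\<^sub>R axis 2 1 + snd (snd p) *\<^sub>R axis 3 1) = (lborel :: (real^3) measure)"
proof (rule lborel_eqI[symmetric])
  let ?\<Psi> = "\<lambda>p :: real \<times> real \<times> real. fst p *\<^sub>R axis 1 1 + fst (snd p) *\<^sub>R axis 2 1 + snd (snd p) *\<^sub>R axis 3 1 :: real^3"
  have meas: "?\<Psi> \<in> borel_measurable borel"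
    by (intro borel_measurable_continuous_onI continuous_intros)
  fix l u :: "real^3" assume lu: "\<And>b. b \<in> Basis \<Longrightarrow> l \<bullet> b \<le> u \<bullet> b"
  have le: "l $ i \<le> u $ i" for i using lu[of "axis i 1"] by (simp add: inner_axis)
  have "?\<Psi> -` box l u = box (l $ 1) (u $ 1) \<times> (box (l $ 2) (u $ 2) \<times> box (l $ 3) (u $ 3))"
    by (auto simp: mem_box_cart forall_3 axis_def)
  then have "emeasure (distr lborel borel ?\<Psi>) (box l u)
      = emeasure (lborel \<Otimes>\<^sub>M (lborel \<Otimes>\<^sub>M lborel)) (box (l $ 1) (u $ 1) \<times> (box (l $ 2) (u $ 2) \<times> box (l $ 3) (u $ 3)))"
    using meas by (simp add: emeasure_distr lborel_prod)
  also have "\<dots> = ennreal ((u - l) $ 1 * (u - l) $ 2 * (u - l) $ 3)"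
    using le by (simp add: lborel.emeasure_pair_measure_Times lborel_pair.emeasure_pair_measure_Times
        ennreal_mult[symmetric] mult.assoc)
  finally show "emeasure (distr lborel borel ?\<Psi>) (box l u) = ennreal (\<Prod>b\<in>Basis. (u - l) \<bullet> b)"
    by (simp add: prod_Basis_vec3 inner_axis)
qed simp

text \<open>Tested on boxes again: the preimage of a box is its image under the inverse orthogonal
  map, which preserves measure.\<close>

lemma distr_lborel_orthogonal:
  fixes A :: "real^3 \<Rightarrow> real^3"
  assumes A: "orthogonal_transformation A"
  shows "distr lborel borel A = lborel"
proof (rule lborel_eqI[symmetric])
  have lin: "linear A" using A by (rule orthogonal_transformation_linear)
  then have meas: "A \<in> borel_measurable borel"
    by (intro borel_measurable_continuous_onI linear_continuous_on) (simp add: linear_conv_bounded_linear)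
  have bij: "bij A" using A by (rule orthogonal_transformation_bij)
  have inv: "orthogonal_transformation (inv A)" using A by (rule orthogonal_transformation_inv)
  fix l u :: "real^3" assume lu: "\<And>b. b \<in> Basis \<Longrightarrow> l \<bullet> b \<le> u \<bullet> b"
  have v: "A -` box l u = inv A ` box l u"
    using bij by (rule bij_vimage_eq_inv_image)
  have b: "A -` box l u \<in> sets borel" using meas by (rule measurable_sets_borel) simp
  have "emeasure (distr lborel borel A) (box l u) = emeasure lborel (A -` box l u)"
    using meas by (simp add: emeasure_distr)
  also have "\<dots> = emeasure lebesgue (inv A ` box l u)"
    using b unfolding v by simp
  also have "\<dots> = ennreal (measure lebesgue (inv A ` box l u))"
    using measurable_orthogonal_image[OF inv, of "box l u"]
    by (intro emeasure_eq_measure2) auto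
  also have "\<dots> = ennreal (measure lebesgue (box l u))"
    by (subst measure_orthogonal_image[OF inv]) auto
  also have "\<dots> = ennreal (\<Prod>b\<in>Basis. (u - l) \<bullet> b)"
    using lu by simp
  finally show "emeasure (distr lborel borel A) (box l u) = ennreal (\<Prod>b\<in>Basis. (u - l) \<bullet> b)" .
qed simp

text \<open>In the application \<open>d\<close> is the direction of the diameter, \<open>f\<close>
  points from it towards the farthest point of the set, and \<open>e\<close> is normal to both.
  Fields are integrated along \<open>e\<close>.\<close>

locale frame =
  fixes e f d :: "real^3"
  assumes norm_e: "norm e = 1" and norm_f: "norm f = 1" and norm_d: "norm d = 1"
    and ef: "e \<bullet> f = 0" and ed: "e \<bullet> d = 0" and fd: "f \<bullet> d = 0"
begin

definition pt :: "real \<Rightarrow> real \<Rightarrow> real \<Rightarrow> real^3"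
  where "pt s t r = s *\<^sub>R e + t *\<^sub>R f + r *\<^sub>R d"

lemma inner_frame [simp]:
  "e \<bullet> e = 1" "f \<bullet> f = 1" "d \<bullet> d = 1" "e \<bullet> f = 0" "e \<bullet> d = 0" "f \<bullet> d = 0"
  "f \<bullet> e = 0" "d \<bullet> e = 0" "d \<bullet> f = 0"
  using norm_e norm_f norm_d ef ed fd by (simp_all add: norm_eq_1 inner_commute)

lemma pt_inner [simp]: "pt s t r \<bullet> e = s" "pt s t r \<bullet> f = t" "pt s t r \<bullet> d = r"
  by (simp_all add: pt_def inner_add_left)

lemma orthogonal_frame_map: "orthogonal_transformation (\<lambda>x::real^3. pt (x $ 1) (x $ 2) (x $ 3))"
  unfolding orthogonal_transformation_def
proof
  show "linear (\<lambda>x::real^3. pt (x $ 1) (x $ 2) (x $ 3))"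
    by (intro linearI) (auto simp: pt_def algebra_simps)
  show "\<forall>v w::real^3. pt (v $ 1) (v $ 2) (v $ 3) \<bullet> pt (w $ 1) (w $ 2) (w $ 3) = v \<bullet> w"
  proof (intro allI)
    fix v w :: "real^3"
    have "v \<bullet> w = v $ 1 * w $ 1 + v $ 2 * w $ 2 + v $ 3 * w $ 3"
      by (simp add: inner_vec_def sum_3)
    then show "pt (v $ 1) (v $ 2) (v $ 3) \<bullet> pt (w $ 1) (w $ 2) (w $ 3) = v \<bullet> w"
      by (simp add: pt_def inner_add_left inner_add_right)
  qed
qed

lemma pt_coords: "pt (x \<bullet> e) (x \<bullet> f) (x \<bullet> d) = x"
proof -
  obtain v :: "real^3" where v: "x = pt (v $ 1) (v $ 2) (v $ 3)"
    using orthogonal_transformation_surj[OF orthogonal_frame_map] by (auto simp: surj_def)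
  show ?thesis unfolding v by simp
qed

lemma norm_eq_frame: "(norm x)\<^sup>2 = (x \<bullet> e)\<^sup>2 + (x \<bullet> f)\<^sup>2 + (x \<bullet> d)\<^sup>2"
proof -
  have "(norm x)\<^sup>2 = pt (x \<bullet> e) (x \<bullet> f) (x \<bullet> d) \<bullet> pt (x \<bullet> e) (x \<bullet> f) (x \<bullet> d)"
    by (simp add: pt_coords power2_norm_eq_inner)
  also have "\<dots> = (x \<bullet> e)\<^sup>2 + (x \<bullet> f)\<^sup>2 + (x \<bullet> d)\<^sup>2"
    by (simp add: pt_def inner_add_left inner_add_right power2_eq_square)
  finally show ?thesis .
qed

lemma continuous_on_pt [continuous_intros]:
  assumes "continuous_on A p" "continuous_on A q" "continuous_on A h"
  shows "continuous_on A (\<lambda>x. pt (p x) (q x) (h x))"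
  unfolding pt_def using assms by (intro continuous_intros)

lemma measurable_pt [measurable (raw)]:
  assumes "p \<in> borel_measurable M" "q \<in> borel_measurable M" "h \<in> borel_measurable M"
  shows "(\<lambda>x. pt (p x) (q x) (h x)) \<in> borel_measurable M"
  unfolding pt_def using assms by measurable

text \<open>Rotation to the frame, then Fubini with the coordinate along \<open>e\<close> innermost.
  Nonnegative integrals spare all integrability conditions.\<close>

lemma nn_integral_frame:
  assumes F [measurable]: "F \<in> borel_measurable borel"
  shows "(\<integral>\<^sup>+x. F x \<partial>lborel)
    = (\<integral>\<^sup>+q. (\<integral>\<^sup>+s. F (pt s (fst q) (snd q)) \<partial>lborel) \<partial>(lborel :: (real \<times> real) measure))"
proof -
  let ?A = "\<lambda>x::real^3. pt (x $ 1) (x $ 2) (x $ 3)"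
  let ?\<Psi> = "\<lambda>p :: real \<times> real \<times> real. fst p *\<^sub>R axis 1 1 + fst (snd p) *\<^sub>R axis 2 1 + snd (snd p) *\<^sub>R axis 3 1 :: real^3"
  have A [measurable]: "?A \<in> borel_measurable borel"
    by (intro borel_measurable_continuous_onI continuous_intros)
  have \<Psi> [measurable]: "?\<Psi> \<in> borel_measurable borel"
    by (intro borel_measurable_continuous_onI continuous_intros)
  have "(\<integral>\<^sup>+x. F x \<partial>lborel) = (\<integral>\<^sup>+x. F x \<partial>distr lborel borel ?A)"
    by (simp add: distr_lborel_orthogonal[OF orthogonal_frame_map])
  also have "\<dots> = (\<integral>\<^sup>+x. F (?A x) \<partial>(distr lborel borel ?\<Psi>))"
    by (simp add: nn_integral_distr distr_lborel_vec3)
  also have "\<dots> = (\<integral>\<^sup>+p. F (?A (?\<Psi> p)) \<partial>lborel)"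
    by (rule nn_integral_distr) measurable
  also have "\<dots> = (\<integral>\<^sup>+p. F (pt (fst p) (fst (snd p)) (snd (snd p))) \<partial>(lborel \<Otimes>\<^sub>M (lborel :: (real \<times> real) measure)))"
    by (simp add: lborel_prod axis_def)
  also have "\<dots> = (\<integral>\<^sup>+q. (\<integral>\<^sup>+s. F (pt s (fst q) (snd q)) \<partial>lborel) \<partial>lborel)"
  proof -
    have "(\<lambda>p::real \<times> real \<times> real. pt (fst p) (fst (snd p)) (snd (snd p))) \<in> borel_measurable borel"
      by (intro borel_measurable_continuous_onI continuous_intros)
    then have "(\<lambda>p. F (pt (fst p) (fst (snd p)) (snd (snd p))))
        \<in> borel_measurable (lborel \<Otimes>\<^sub>M (lborel :: (real \<times> real) measure))"
      unfolding lborel_prod by simp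
    from lborel_pair.nn_integral_snd[OF this] show ?thesis by simp
  qed
  finally show ?thesis .
qed

lemma nn_integral_plane:
  assumes F [measurable]: "F \<in> borel_measurable borel"
  shows "(\<integral>\<^sup>+q. F (pt 0 (fst q) (snd q)) \<partial>lborel) = (\<integral>\<^sup>+r. (\<integral>\<^sup>+t. F (pt 0 t r) \<partial>lborel) \<partial>lborel)"
    and "(\<integral>\<^sup>+q. F (pt 0 (fst q) (snd q)) \<partial>lborel) = (\<integral>\<^sup>+t. (\<integral>\<^sup>+r. F (pt 0 t r) \<partial>lborel) \<partial>lborel)"
proof -
  have "(\<lambda>q::real \<times> real. pt 0 (fst q) (snd q)) \<in> borel_measurable borel"
    by (intro borel_measurable_continuous_onI continuous_intros)
  then have m: "(\<lambda>q::real \<times> real. F (pt 0 (fst q) (snd q))) \<in> borel_measurable (lborel \<Otimes>\<^sub>M lborel)"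
    unfolding lborel_prod by simp
  show "(\<integral>\<^sup>+q. F (pt 0 (fst q) (snd q)) \<partial>lborel) = (\<integral>\<^sup>+r. (\<integral>\<^sup>+t. F (pt 0 t r) \<partial>lborel) \<partial>lborel)"
    using lborel_pair.nn_integral_snd[OF m] by (simp add: lborel_prod)
  show "(\<integral>\<^sup>+q. F (pt 0 (fst q) (snd q)) \<partial>lborel) = (\<integral>\<^sup>+t. (\<integral>\<^sup>+r. F (pt 0 t r) \<partial>lborel) \<partial>lborel)"
    using lborel.nn_integral_fst[OF m] by (simp add: lborel_prod)
qed

text \<open>Lifts an inequality known on every line in direction \<open>f\<close> or
  \<open>d\<close>, such as the Hardy inequality, to the plane orthogonal to \<open>e\<close>, which
  those lines slice.\<close>

lemma nn_integral_plane_mono_lines: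
  assumes "F \<in> borel_measurable borel" "G \<in> borel_measurable borel" and h: "h = f \<or> h = d"
    and le: "\<And>y. (\<integral>\<^sup>+t. F (y + t *\<^sub>R h) \<partial>lborel) \<le> (\<integral>\<^sup>+t. G (y + t *\<^sub>R h) \<partial>lborel)"
  shows "(\<integral>\<^sup>+q. F (pt 0 (fst q) (snd q)) \<partial>lborel) \<le> (\<integral>\<^sup>+q. G (pt 0 (fst q) (snd q)) \<partial>lborel)"
  using h
proof
  assume "h = f"
  then have "(\<integral>\<^sup>+t. F (pt 0 t r) \<partial>lborel) \<le> (\<integral>\<^sup>+t. G (pt 0 t r) \<partial>lborel)" for r
    using le[of "r *\<^sub>R d"] by (simp add: pt_def add.commute)
  then show ?thesis unfolding nn_integral_plane(1)[OF assms(1)] nn_integral_plane(1)[OF assms(2)]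
    by (rule nn_integral_mono)
next
  assume "h = d"
  then have "(\<integral>\<^sup>+r. F (pt 0 t r) \<partial>lborel) \<le> (\<integral>\<^sup>+r. G (pt 0 t r) \<partial>lborel)" for t
    using le[of "t *\<^sub>R f"] by (simp add: pt_def)
  then show ?thesis unfolding nn_integral_plane(2)[OF assms(1)] nn_integral_plane(2)[OF assms(2)]
    by (rule nn_integral_mono)
qed

end

section \<open>One-dimensional integrals along lines\<close>

lemma integral_UNIV_eq:
  fixes F :: "real \<Rightarrow> real"
  assumes "\<And>t. t \<notin> S \<Longrightarrow> F t = 0"
  shows "integral UNIV F = integral S F"
proof -
  have "(\<lambda>t. if t \<in> S then F t else 0) = F" using assms by auto
  then show ?thesis using integral_restrict_UNIV[of S F] by simp
qed

lemma nn_integral_eq_integral_interval: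
  fixes F :: "real \<Rightarrow> real"
  assumes "continuous_on UNIV F" "\<And>t. F t \<ge> 0" "\<And>t. t \<notin> {u..v} \<Longrightarrow> F t = 0"
  shows "(\<integral>\<^sup>+t. ennreal (F t) \<partial>lborel) = ennreal (integral {u..v} F)"
proof -
  have "(F has_integral integral {u..v} F) {u..v}"
    by (intro integrable_integral integrable_continuous_interval continuous_on_subset[OF assms(1)]) auto
  then have "((\<lambda>t. if t \<in> {u..v} then F t else 0) has_integral integral {u..v} F) UNIV"
    by (simp only: has_integral_restrict_UNIV)
  moreover have "(\<lambda>t. if t \<in> {u..v} then F t else 0) = F" using assms(3) by auto
  ultimately have "(F has_integral integral {u..v} F) UNIV" by simp
  then show ?thesis
    using assms(1,2) by (intro nn_integral_has_integral_lborel borel_measurable_continuous_onI)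
qed

lemma integral_UNIV_translate:
  fixes F :: "real \<Rightarrow> real"
  assumes "continuous_on UNIV F" "\<And>t. t \<notin> {u..v} \<Longrightarrow> F t = 0"
  shows "integral UNIV (\<lambda>t. F (s + t)) = integral UNIV F"
proof -
  have "(F has_integral integral {u..v} F) (cbox u v)"
    unfolding cbox_interval
    by (intro integrable_integral integrable_continuous_interval continuous_on_subset[OF assms(1)]) auto
  from has_integral_affinity'[OF this, of 1 s]
  have "((\<lambda>t. F (s + t)) has_integral integral {u..v} F) {u - s..v - s}"
    by (simp add: add.commute)
  moreover have "integral UNIV (\<lambda>t. F (s + t)) = integral {u - s..v - s} (\<lambda>t. F (s + t))"
    using assms(2) by (intro integral_UNIV_eq) auto
  ultimately show ?thesis
    using integral_UNIV_eq[of "{u..v}" F] assms(2) by (simp add: integral_unique)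
qed

definition line_integral :: "real^3 \<Rightarrow> (real^3 \<Rightarrow> real) \<Rightarrow> real^3 \<Rightarrow> real"
  where "line_integral e f x = integral UNIV (\<lambda>t. f (x + t *\<^sub>R e))"

lemma off_line:
  fixes f :: "real^3 \<Rightarrow> 'a::zero"
  assumes "\<And>x. R < norm x \<Longrightarrow> f x = 0" "norm e = 1" "norm x + R \<le> M" "t \<notin> {- M..M}"
  shows "f (x + t *\<^sub>R e) = 0"
proof (rule assms(1))
  have "R < norm (t *\<^sub>R e) - norm x" using assms(2-4) by auto
  also have "\<dots> \<le> norm (x + t *\<^sub>R e)" by (metis add.commute norm_diff_ineq)
  finally show "R < norm (x + t *\<^sub>R e)" .
qed

lemma continuous_on_line:
  fixes f :: "real^3 \<Rightarrow> real"
  assumes "continuous_on UNIV f"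
  shows "continuous_on A (\<lambda>t. f (x + t *\<^sub>R e))"
  by (rule continuous_on_compose2[OF assms]) (auto intro!: continuous_intros)

lemma line_integral_translate:
  fixes f :: "real^3 \<Rightarrow> real"
  assumes "continuous_on UNIV f" "\<And>x. R < norm x \<Longrightarrow> f x = 0" "norm e = 1"
  shows "line_integral e f (x + s *\<^sub>R e) = line_integral e f x"
proof -
  have "integral UNIV (\<lambda>t. f (x + (s + t) *\<^sub>R e)) = integral UNIV (\<lambda>t. f (x + t *\<^sub>R e))"
    by (rule integral_UNIV_translate[of "\<lambda>t. f (x + t *\<^sub>R e)",
          OF continuous_on_line[OF assms(1)]])
      (rule off_line[of R f, OF assms(2,3) order_refl])
  then show ?thesis by (simp add: line_integral_def algebra_simps)
qed

lemma ray_integral_sum: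
  fixes f :: "real^3 \<Rightarrow> real"
  assumes "continuous_on UNIV f" "\<And>x. R < norm x \<Longrightarrow> f x = 0" "norm e = 1"
  shows "ray_integral e f x + ray_integral (- e) f x = line_integral e f x"
proof -
  define M where "M = \<bar>norm x + R\<bar>"
  have M: "norm x + R \<le> M" "M \<ge> 0" by (auto simp: M_def)
  have "ray_integral e f x = integral {0..M} (\<lambda>t. f (x + (- t) *\<^sub>R e))"
    using ray_integral_eq[OF assms(2,3) M(1)] by simp
  also have "\<dots> = integral {- M..0} (\<lambda>t. f (x + t *\<^sub>R e))"
    using Henstock_Kurzweil_Integration.integral_reflect_real[of 0 "- M" "\<lambda>t. f (x + t *\<^sub>R e)"] by simp
  moreover have "ray_integral (- e) f x = integral {0..M} (\<lambda>t. f (x + t *\<^sub>R e))"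
    using ray_integral_eq[of R f "- e" x M] assms M(1) by simp
  moreover have "line_integral e f x = integral {- M..M} (\<lambda>t. f (x + t *\<^sub>R e))"
    unfolding line_integral_def by (intro integral_UNIV_eq off_line[OF assms(2,3) M(1)])
  moreover have "integral {- M..0} (\<lambda>t. f (x + t *\<^sub>R e)) + integral {0..M} (\<lambda>t. f (x + t *\<^sub>R e))
      = integral {- M..M} (\<lambda>t. f (x + t *\<^sub>R e))"
    using M(2) by (intro Henstock_Kurzweil_Integration.integral_combine
        integrable_continuous_interval continuous_on_line[OF assms(1)]) auto
  ultimately show ?thesis by simp
qed

lemma ray_integral_diff:
  fixes f g :: "real^3 \<Rightarrow> real"
  assumes f: "continuous_on UNIV f" "\<And>x. R < norm x \<Longrightarrow> f x = 0"
    and g: "continuous_on UNIV g" "\<And>x. R < norm x \<Longrightarrow> g x = 0" and e: "norm e = 1"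
  shows "ray_integral e (\<lambda>y. f y - g y) x = ray_integral e f x - ray_integral e g x"
proof -
  define M where "M = norm x + R"
  have M: "norm x + R \<le> M" by (simp add: M_def)
  have "(\<lambda>t. h (x - t *\<^sub>R e)) integrable_on {0..M}" if "continuous_on UNIV h" for h :: "real^3 \<Rightarrow> real"
    by (intro integrable_continuous_interval continuous_on_compose2[OF that]) (auto intro!: continuous_intros)
  then show ?thesis
    using ray_integral_eq[OF f(2) e M] ray_integral_eq[OF g(2) e M]
      ray_integral_eq[of R "\<lambda>y. f y - g y", OF _ e M] f g by (simp add: integral_diff)
qed

lemma ray_integral_uminus: "ray_integral e (\<lambda>y. - f y) x = - ray_integral e f x"
  by (simp add: ray_integral_def)

lemma ray_integral_abs_le:
  fixes f :: "real^3 \<Rightarrow> real"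
  assumes f: "continuous_on UNIV f" "\<And>x. R < norm x \<Longrightarrow> f x = 0" and e: "norm e = 1"
  shows "\<bar>ray_integral e f x\<bar> \<le> ray_integral e (\<lambda>y. \<bar>f y\<bar>) x"
proof -
  define M where "M = norm x + R"
  have M: "norm x + R \<le> M" by (simp add: M_def)
  have I: "(\<lambda>t. h (x - t *\<^sub>R e)) integrable_on {0..M}" if "continuous_on UNIV h" for h :: "real^3 \<Rightarrow> real"
    by (intro integrable_continuous_interval continuous_on_compose2[OF that]) (auto intro!: continuous_intros)
  have "norm (integral {0..M} (\<lambda>t. f (x - t *\<^sub>R e))) \<le> integral {0..M} (\<lambda>t. \<bar>f (x - t *\<^sub>R e)\<bar>)"
    by (intro Henstock_Kurzweil_Integration.integral_norm_bound_integral I[OF f(1)] I[of "\<lambda>y. \<bar>f y\<bar>"])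
      (auto intro!: continuous_intros f)
  then show ?thesis
    using ray_integral_eq[OF f(2) e M] ray_integral_eq[of R "\<lambda>y. \<bar>f y\<bar>", OF _ e M] f by simp
qed

text \<open>The two rays from \<open>x\<close> together cover the line, so weights in [0, 1] cost
  nothing. Applied with \<open>\<theta>\<close> the value of the cutoff.\<close>

lemma ray_integral_convex_combination_bound:
  fixes f :: "real^3 \<Rightarrow> real"
  assumes f: "continuous_on UNIV f" "\<And>x. R < norm x \<Longrightarrow> f x = 0" and e: "norm e = 1"
    and \<theta>: "0 \<le> \<theta>" "\<theta> \<le> 1"
  shows "\<bar>\<theta> * ray_integral e f x - (1 - \<theta>) * ray_integral (- e) f x\<bar> \<le> line_integral e (\<lambda>y. \<bar>f y\<bar>) x"
proof -
  have ca: "continuous_on UNIV (\<lambda>y. \<bar>f y\<bar>)" by (intro continuous_intros f)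
  have za: "\<And>x. R < norm x \<Longrightarrow> \<bar>f x\<bar> = 0" using f by simp
  have e': "norm (- e) = 1" using e by simp
  have "\<bar>\<theta> * ray_integral e f x - (1 - \<theta>) * ray_integral (- e) f x\<bar>
      \<le> \<bar>\<theta> * ray_integral e f x\<bar> + \<bar>(1 - \<theta>) * ray_integral (- e) f x\<bar>" by (rule abs_triangle_ineq4)
  also have "\<dots> \<le> 1 * ray_integral e (\<lambda>y. \<bar>f y\<bar>) x + 1 * ray_integral (- e) (\<lambda>y. \<bar>f y\<bar>) x"
    unfolding abs_mult using \<theta> ray_integral_abs_le[OF f e] ray_integral_abs_le[OF f e']
    by (intro add_mono mult_mono) auto
  also have "\<dots> = line_integral e (\<lambda>y. \<bar>f y\<bar>) x"
    using ray_integral_sum[OF ca za e] by simp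
  finally show ?thesis .
qed

lemma line_integral_power2_le:
  fixes f :: "real^3 \<Rightarrow> real"
  assumes f: "continuous_on UNIV f" and supp: "\<And>t. t \<notin> {u..v} \<Longrightarrow> f (x + t *\<^sub>R e) = 0" and "u \<le> v"
  shows "(line_integral e f x)\<^sup>2 \<le> (v - u) * line_integral e (\<lambda>y. (f y)\<^sup>2) x"
proof -
  have "line_integral e f x = integral {u..v} (\<lambda>t. f (x + t *\<^sub>R e))"
    unfolding line_integral_def by (intro integral_UNIV_eq supp)
  moreover have "line_integral e (\<lambda>y. (f y)\<^sup>2) x = integral {u..v} (\<lambda>t. (f (x + t *\<^sub>R e))\<^sup>2)"
    unfolding line_integral_def using supp by (intro integral_UNIV_eq) auto
  ultimately show ?thesis
    using integral_power2_le[OF continuous_on_line[OF f] assms(3)] by simp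
qed

section \<open>The potential of a test field\<close>

text \<open>\<open>K\<close> is to be a compact convex set carrying the field, \<open>a\<close> and
  \<open>b\<close> barriers strictly between \<open>K\<close> and the boundary of \<Omega>. They are
  functions on the whole space, constant along \<open>e\<close>, so that the \<open>C_k\<close>
  calculus applies to them. \<open>w\<close> bounds the width along \<open>e\<close> and
  \<open>f\<close> only, since \<open>d\<close> is to be the long direction.\<close>

locale cylinder = frame +
  fixes \<Omega> K :: "(real^3) set" and \<phi> :: "real^3 \<Rightarrow> real^3" and a b :: "real^3 \<Rightarrow> real"
    and Da Db :: "real^3 \<Rightarrow> real^3 \<Rightarrow> real" and w :: real
  assumes convex_\<Omega>: "convex \<Omega>"
    and K: "compact K" "convex K" "K \<noteq> {}" "K \<subseteq> \<Omega>"
    and width: "\<And>x y. x \<in> \<Omega> \<Longrightarrow> y \<in> \<Omega> \<Longrightarrow> \<bar>(x - y) \<bullet> e\<bar> \<le> w"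
      "\<And>x y. x \<in> \<Omega> \<Longrightarrow> y \<in> \<Omega> \<Longrightarrow> \<bar>(x - y) \<bullet> f\<bar> \<le> w"
    and C_\<phi>: "\<And>n. C_k n \<phi>" and \<phi>_off: "\<And>x. x \<notin> K \<Longrightarrow> \<phi> x = 0"
    and C_b: "\<And>n. C_k n b" and D_b: "\<And>x. (b has_derivative Db x) (at x)"
    and tan_b: "\<And>x y. b y \<le> b x + Db x (y - x)" and inv_b: "\<And>x s. b (x + s *\<^sub>R e) = b x"
    and above: "\<And>x. x \<in> K \<Longrightarrow> x \<bullet> e < b x" and in_b: "\<And>x. x \<in> K \<Longrightarrow> x + (b x - x \<bullet> e) *\<^sub>R e \<in> \<Omega>"
    and C_a: "\<And>n. C_k n a" and D_a: "\<And>x. (a has_derivative Da x) (at x)"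
    and tan_a: "\<And>x y. a x + Da x (y - x) \<le> a y" and inv_a: "\<And>x s. a (x + s *\<^sub>R e) = a x"
    and below: "\<And>x. x \<in> K \<Longrightarrow> a x < x \<bullet> e" and in_a: "\<And>x. x \<in> K \<Longrightarrow> x + (a x - x \<bullet> e) *\<^sub>R e \<in> \<Omega>"
begin

definition R where "R = (SOME R. \<forall>x\<in>K. norm x \<le> R)"

lemma K_R: "x \<in> K \<Longrightarrow> norm x \<le> R"
proof -
  have "\<exists>R. \<forall>x\<in>K. norm x \<le> R"
    using compact_imp_bounded[OF K(1)] by (auto simp: bounded_iff)
  then have "\<forall>x\<in>K. norm x \<le> R" unfolding R_def by (rule someI_ex)
  then show "x \<in> K \<Longrightarrow> norm x \<le> R" by blast
qed

lemma off_K: "R < norm x \<Longrightarrow> x \<notin> K"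
  using K_R by force

text \<open>Membership in a column, a line parallel to \<open>e\<close> that meets \<open>K\<close>.
  Only on columns is \<open>a < b\<close> known; off them every line integral along \<open>e\<close>
  of a function supported in \<open>K\<close> vanishes.\<close>

definition col where "col x \<longleftrightarrow> (\<exists>t. x + t *\<^sub>R e \<in> K)"

definition l where "l x = b x - a x"

lemma col_bounds:
  assumes "col x"
  shows "a x < b x" "x + (b x - x \<bullet> e) *\<^sub>R e \<in> \<Omega>" "x + (a x - x \<bullet> e) *\<^sub>R e \<in> \<Omega>"
proof -
  obtain t where t: "x + t *\<^sub>R e \<in> K" using assms by (auto simp: col_def)
  show "a x < b x" using above[OF t] below[OF t] by (simp add: inv_a inv_b)
  show "x + (b x - x \<bullet> e) *\<^sub>R e \<in> \<Omega>"
    using in_b[OF t] by (simp add: inv_b inner_add_left algebra_simps)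
  show "x + (a x - x \<bullet> e) *\<^sub>R e \<in> \<Omega>"
    using in_a[OF t] by (simp add: inv_a inner_add_left algebra_simps)
qed

lemma continuous_ab [continuous_intros]: "continuous_on A a" "continuous_on A b" "continuous_on A l"
proof -
  show "continuous_on A a" "continuous_on A b"
    using C_k_continuous[OF C_a] C_k_continuous[OF C_b] continuous_on_subset by blast+
  then show "continuous_on A l" unfolding l_def by (intro continuous_intros)
qed

lemma l_lower_bound: "\<exists>l0>0. \<forall>x\<in>K. l0 \<le> l x"
proof -
  obtain x where x: "x \<in> K" "\<forall>y\<in>K. l x \<le> l y"
    using continuous_attains_inf[OF K(1,3) continuous_ab(3)] by blast
  have "l x > 0" using above[OF x(1)] below[OF x(1)] by (simp add: l_def)
  then show ?thesis using x by blast
qed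

text \<open>Serves to continue the chord length beyond the columns; the final constants do not
  depend on it, however small it is.\<close>

definition l0 where "l0 = (SOME l0. l0 > 0 \<and> (\<forall>x\<in>K. l0 \<le> l x))"

lemma l0: "l0 > 0" "\<And>x. x \<in> K \<Longrightarrow> l0 \<le> l x"
proof -
  have "\<exists>l0. l0 > 0 \<and> (\<forall>x\<in>K. l0 \<le> l x)" using l_lower_bound by blast
  then have "l0 > 0 \<and> (\<forall>x\<in>K. l0 \<le> l x)" unfolding l0_def by (rule someI_ex)
  then show "l0 > 0" "\<And>x. x \<in> K \<Longrightarrow> l0 \<le> l x" by auto
qed

lemma l0_col: "col x \<Longrightarrow> l0 \<le> l x"
  unfolding col_def using l0(2) by (fastforce simp: l_def inv_a inv_b)

text \<open>The denominator \<open>b - a\<close>, modified outside the columns over \<open>K\<close> so as to stay positive.\<close>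

definition Lam where "Lam x = step (2 / l0 * l x - 1) * (l x - l0) + l0"

text \<open>\<open>Lam\<close> is a convex combination of \<open>l\<close> and \<open>l0\<close> in
  which the weight of \<open>l\<close> vanishes as soon as \<open>l \<le> l0 / 2\<close>.\<close>

lemma Lam_pos: "Lam x > 0"
proof -
  define \<theta> where "\<theta> = step (2 / l0 * l x - 1)"
  have \<theta>: "0 \<le> \<theta>" "\<theta> \<le> 1" by (simp_all add: \<theta>_def step_bounds)
  show ?thesis
  proof (cases "l x \<le> l0 / 2")
    case True
    then have "2 / l0 * l x - 1 \<le> 0" using l0(1) by (simp add: field_simps)
    then show ?thesis using l0(1) by (simp add: Lam_def step_eq_0)
  next
    case False
    have "\<theta> * (l x - l0) \<ge> - (l0 / 2)"
    proof (cases "l x \<ge> l0")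
      case True
      then have "\<theta> * (l x - l0) \<ge> 0" using \<theta> by simp
      then show ?thesis using l0(1) by simp
    next
      case 2: False
      have "\<theta> * (l0 - l x) \<le> 1 * (l0 / 2)" using \<theta> False 2 by (intro mult_mono) auto
      then show ?thesis by (simp add: algebra_simps)
    qed
    then show ?thesis using l0(1) unfolding Lam_def \<theta>_def[symmetric] by simp
  qed
qed

lemma step_at_col:
  assumes "col x" shows "2 / l0 * l x - 1 \<ge> 1"
  using l0_col[OF assms] l0(1) by (simp add: field_simps)

lemma Lam_col: "col x \<Longrightarrow> Lam x = l x"
  using step_at_col by (simp add: Lam_def step_eq_1)

lemma C_k_l: "C_k n l"
  unfolding l_def by (intro C_k_diff C_a C_b)

lemma C_k_Lam: "C_k n Lam"
  unfolding Lam_def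
  by (intro C_k_add C_k_mult C_k_step C_k_diff C_k_cmult C_k_l C_k_const)

lemma Lam_derivative:
  assumes "col x" shows "(Lam has_derivative (\<lambda>h. Db x h - Da x h)) (at x)"
proof -
  have l: "(l has_derivative (\<lambda>h. Db x h - Da x h)) (at x)"
    unfolding l_def[abs_def] by (intro has_derivative_diff D_a D_b)
  have 1: "((\<lambda>x. 2 / l0 * l x - 1) has_derivative (\<lambda>h. 2 / l0 * (Db x h - Da x h))) (at x)"
    using has_derivative_diff[OF has_derivative_mult_right[OF l, of "2 / l0"] has_derivative_const[of 1]] by simp
  have "((\<lambda>x. step (2 / l0 * l x - 1)) has_derivative
      (\<lambda>h. step' (2 / l0 * l x - 1) * (2 / l0 * (Db x h - Da x h)))) (at x)"
    using has_derivative_compose[OF 1 step_DERIV[unfolded has_field_derivative_def]] .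
  \<comment> \<open>On a column the argument of \<open>step\<close> is at least 1, and
    \<open>step'\<close> vanishes from 1 on, the point 1 included; this covers columns at the edge
    of \<open>K\<close> as well.\<close>
  then have "((\<lambda>x. step (2 / l0 * l x - 1)) has_derivative (\<lambda>h. 0)) (at x)"
    using step_at_col[OF assms] by (simp add: step'_outside)
  note S = this
  have "((\<lambda>x. step (2 / l0 * l x - 1) * (l x - l0)) has_derivative (\<lambda>h. Db x h - Da x h)) (at x)"
    using has_derivative_mult[OF S has_derivative_diff[OF l has_derivative_const[of l0]]] step_at_col[OF assms]
    by (simp add: step_eq_1)
  then show ?thesis
    unfolding Lam_def[abs_def] by (rule has_derivative_add_const)
qed

text \<open>On a column it is 0 at the upper barrier and 1 at the lower one, so \<open>chi\<close>
  falls from 1 to 0 along \<open>e\<close>.\<close>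

definition X where "X x = (b x - e \<bullet> x) / Lam x"
definition chi where "chi x = step (X x)"

lemma C_k_chi: "C_k n chi"
  unfolding chi_def[abs_def] X_def
  using Lam_pos by (intro C_k_step C_k_divide C_k_diff C_b C_k_inner_right C_k_Lam) (metis less_irrefl)

lemma chi_bounds: "0 \<le> chi x" "chi x \<le> 1"
  by (simp_all add: chi_def step_bounds)

text \<open>The quotient rule after substituting \<open>b x - e \<bullet> x = X x * l x\<close>: the
  slopes enter with weights \<open>1 - X x\<close> and \<open>X x\<close>, and a single factor
  \<open>1 / l x\<close> remains. Used on columns, where \<open>Lam = l\<close>.\<close>

definition Dchi where
  "Dchi x h = step' (X x) * (((1 - X x) * Db x h + X x * Da x h - e \<bullet> h) / l x)"

lemma chi_derivative:
  assumes "col x" shows "(chi has_derivative Dchi x) (at x)"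
proof -
  have L: "Lam x = l x" "l x > 0" using Lam_col[OF assms] Lam_pos[of x] by auto
  have N: "((\<lambda>x. b x - e \<bullet> x) has_derivative (\<lambda>h. Db x h - e \<bullet> h)) (at x)"
    by (intro has_derivative_diff D_b has_derivative_inner_right has_derivative_ident)
  have X: "(X has_derivative (\<lambda>h. ((1 - X x) * Db x h + X x * Da x h - e \<bullet> h) / l x)) (at x)"
  proof -
    have "((\<lambda>x. (b x - e \<bullet> x) / Lam x) has_derivative
      (\<lambda>h. ((Db x h - e \<bullet> h) * Lam x - (b x - e \<bullet> x) * (Db x h - Da x h)) / (Lam x * Lam x))) (at x)"
      using L by (intro has_derivative_divide' N Lam_derivative assms) auto
    also have "(\<lambda>h. ((Db x h - e \<bullet> h) * Lam x - (b x - e \<bullet> x) * (Db x h - Da x h)) / (Lam x * Lam x))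
      = (\<lambda>h. ((1 - X x) * Db x h + X x * Da x h - e \<bullet> h) / l x)"
    proof
      fix h
      have "b x - e \<bullet> x = X x * l x" using L by (simp add: X_def)
      then show "((Db x h - e \<bullet> h) * Lam x - (b x - e \<bullet> x) * (Db x h - Da x h)) / (Lam x * Lam x)
        = ((1 - X x) * Db x h + X x * Da x h - e \<bullet> h) / l x"
        using L by (simp add: divide_simps) (simp add: algebra_simps)
    qed
    finally show ?thesis unfolding X_def[abs_def] .
  qed
  show ?thesis
    unfolding chi_def[abs_def] Dchi_def[abs_def]
    by (rule has_derivative_compose[OF X step_DERIV[unfolded has_field_derivative_def]])
qed

definition p where "p x = \<phi> x \<bullet> e"
definition Gp where "Gp = ray_integral e p"
definition Gm where "Gm = ray_integral (- e) p"
definition g where "g x = Gp x + Gm x"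
text \<open>\<open>Gp\<close> and \<open>- Gm\<close> both have derivative \<open>p\<close> along
  \<open>e\<close>. On a column \<open>Gp\<close> vanishes below the lower barrier, where
  \<open>chi = 1\<close>, and \<open>Gm\<close> above the upper one, where \<open>chi = 0\<close>;
  off the columns both vanish. The glued function thus lives between the barriers.\<close>

definition psi where "psi x = chi x * Gp x - (1 - chi x) * Gm x"

lemma norm_me: "norm (- e) = 1" by (simp add: norm_e)

lemma C_k_component: "C_k n (\<lambda>x. \<phi> x \<bullet> h)"
  by (rule C_k_compose_linear[OF bounded_linear_inner_left C_\<phi>])

lemma component_off: "R < norm x \<Longrightarrow> \<phi> x \<bullet> h = 0"
  using \<phi>_off[OF off_K] by simp

lemma C_k_p: "C_k n p" unfolding p_def[abs_def] by (rule C_k_component)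
lemma p_off: "R < norm x \<Longrightarrow> p x = 0" unfolding p_def by (rule component_off)

lemma C_k_G: "C_k n Gp" "C_k n Gm"
  unfolding Gp_def Gm_def by (intro C_k_ray_integral[OF C_k_p p_off] norm_e norm_me; assumption)+

lemma C_k_g: "C_k n g"
  unfolding g_def[abs_def] by (intro C_k_add C_k_G)

lemma C_k_psi: "C_k n psi"
  unfolding psi_def[abs_def] by (intro C_k_diff C_k_mult C_k_chi C_k_G C_k_const)

lemma ray_off_col:
  assumes "\<And>x. x \<notin> K \<Longrightarrow> u x = 0" "\<not> col x"
  shows "ray_integral e u x = 0" "ray_integral (- e) u x = 0"
proof -
  have "u (x + t *\<^sub>R e) = 0" for t using assms by (auto simp: col_def)
  from this[of "- t" for t] this have "u (x - t *\<^sub>R e) = 0" "u (x + t *\<^sub>R e) = 0" for t by simp_all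
  then show "ray_integral e u x = 0" "ray_integral (- e) u x = 0" by (simp_all add: ray_integral_def)
qed

lemma ray_beyond:
  assumes "\<And>x. x \<notin> K \<Longrightarrow> u x = 0"
  shows "b x \<le> x \<bullet> e \<Longrightarrow> ray_integral (- e) u x = 0" and "x \<bullet> e \<le> a x \<Longrightarrow> ray_integral e u x = 0"
proof -
  assume b: "b x \<le> x \<bullet> e"
  have "u (x + t *\<^sub>R e) = 0" if "t \<in> {0..}" for t
  proof (rule assms, rule notI)
    assume "x + t *\<^sub>R e \<in> K"
    from above[OF this] b that show False by (simp add: inv_b inner_add_left)
  qed
  then have "integral {0..} (\<lambda>t. u (x + t *\<^sub>R e)) = integral {0..} (\<lambda>t::real. 0)"
    by (intro Henstock_Kurzweil_Integration.integral_cong) auto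
  then show "ray_integral (- e) u x = 0" by (simp add: ray_integral_def)
next
  assume a: "x \<bullet> e \<le> a x"
  have "u (x - t *\<^sub>R e) = 0" if "t \<in> {0..}" for t
  proof (rule assms, rule notI)
    assume *: "x - t *\<^sub>R e \<in> K"
    from below[OF *] a that inv_a[of x "- t"] show False by (simp add: inner_diff_left)
  qed
  then have "integral {0..} (\<lambda>t. u (x - t *\<^sub>R e)) = integral {0..} (\<lambda>t::real. 0)"
    by (intro Henstock_Kurzweil_Integration.integral_cong) auto
  then show "ray_integral e u x = 0" by (simp add: ray_integral_def)
qed

lemma p_off_K: "x \<notin> K \<Longrightarrow> p x = 0" by (simp add: p_def \<phi>_off)

lemma G_beyond:
  "\<not> col x \<Longrightarrow> Gp x = 0" "\<not> col x \<Longrightarrow> Gm x = 0"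
  "b x \<le> x \<bullet> e \<Longrightarrow> Gm x = 0" "x \<bullet> e \<le> a x \<Longrightarrow> Gp x = 0"
  using ray_off_col[of p x, OF p_off_K] ray_beyond[of p x, OF p_off_K]
  unfolding Gp_def Gm_def by blast+

lemma chi_beyond:
  assumes "col x"
  shows "b x \<le> x \<bullet> e \<Longrightarrow> chi x = 0" "x \<bullet> e \<le> a x \<Longrightarrow> chi x = 1"
proof -
  have L: "Lam x = b x - a x" "b x - a x > 0" using Lam_col[OF assms] Lam_pos[of x] by (auto simp: l_def)
  show "b x \<le> x \<bullet> e \<Longrightarrow> chi x = 0" "x \<bullet> e \<le> a x \<Longrightarrow> chi x = 1"
    using L by (auto simp: chi_def X_def inner_commute field_simps intro!: step_eq_0 step_eq_1)
qed

lemma psi_support: "psi x \<noteq> 0 \<Longrightarrow> col x \<and> a x \<le> x \<bullet> e \<and> x \<bullet> e \<le> b x"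
proof (rule ccontr)
  assume *: "psi x \<noteq> 0" "\<not> (col x \<and> a x \<le> x \<bullet> e \<and> x \<bullet> e \<le> b x)"
  consider "\<not> col x" | "col x" "x \<bullet> e \<le> a x" | "col x" "b x \<le> x \<bullet> e" using *(2) by linarith
  then have "psi x = 0" by cases (simp_all add: psi_def G_beyond chi_beyond)
  with *(1) show False ..
qed

text \<open>The support lies in \<open>Q\<close>, the union of the chords between the barriers over
  \<open>K\<close>: a continuous image of a compact set, inside \<Omega> because both ends of each
  chord are and \<Omega> is convex.\<close>

lemma psi_test: "psi \<in> test_functions \<Omega>"
proof -
  define Q where "Q = (\<lambda>(x, \<theta>). x + ((1 - \<theta>) * a x + \<theta> * b x - x \<bullet> e) *\<^sub>R e) ` (K \<times> {0..1::real})"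
  have "compact Q" unfolding Q_def
    by (intro compact_continuous_image compact_Times K compact_Icc)
       (auto simp: case_prod_unfold intro!: continuous_intros continuous_on_compose2[OF continuous_ab(1)[of UNIV]]
        continuous_on_compose2[OF continuous_ab(2)[of UNIV]])
  have "Q \<subseteq> \<Omega>"
  proof
    fix z assume "z \<in> Q"
    then obtain x \<theta> where x: "x \<in> K" "0 \<le> \<theta>" "\<theta> \<le> 1" "z = x + ((1 - \<theta>) * a x + \<theta> * b x - x \<bullet> e) *\<^sub>R e"
      by (auto simp: Q_def)
    have "z = (1 - \<theta>) *\<^sub>R (x + (a x - x \<bullet> e) *\<^sub>R e) + \<theta> *\<^sub>R (x + (b x - x \<bullet> e) *\<^sub>R e)"
      unfolding x(4) by (simp add: algebra_simps)
    then show "z \<in> \<Omega>" using x in_a[OF x(1)] in_b[OF x(1)] convexD[OF convex_\<Omega>] by simp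
  qed
  have "{x. psi x \<noteq> 0} \<subseteq> Q"
  proof
    fix x assume "x \<in> {x. psi x \<noteq> 0}"
    then have x: "col x" "a x \<le> x \<bullet> e" "x \<bullet> e \<le> b x" using psi_support by auto
    obtain t where t: "x + t *\<^sub>R e \<in> K" using x by (auto simp: col_def)
    define \<theta> where "\<theta> = (x \<bullet> e - a x) / (b x - a x)"
    have ab: "a x < b x" by (rule col_bounds(1)[OF x(1)])
    have \<theta>: "0 \<le> \<theta>" "\<theta> \<le> 1" "(1 - \<theta>) * a x + \<theta> * b x = x \<bullet> e"
    proof -
      show "0 \<le> \<theta>" "\<theta> \<le> 1" using x ab by (auto simp: \<theta>_def)
      have "(1 - \<theta>) * a x + \<theta> * b x = a x + \<theta> * (b x - a x)" by (simp add: algebra_simps)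
      also have "\<dots> = x \<bullet> e" using ab by (simp add: \<theta>_def)
      finally show "(1 - \<theta>) * a x + \<theta> * b x = x \<bullet> e" .
    qed
    have "x = (x + t *\<^sub>R e) + ((1 - \<theta>) * a (x + t *\<^sub>R e) + \<theta> * b (x + t *\<^sub>R e) - (x + t *\<^sub>R e) \<bullet> e) *\<^sub>R e"
      unfolding inv_a inv_b \<theta>(3) by (simp add: inner_add_left)
    then show "x \<in> Q" unfolding Q_def using t \<theta> by (auto intro!: image_eqI[of _ _ "(x + t *\<^sub>R e, \<theta>)"])
  qed
  then have cl: "closure {x. psi x \<noteq> 0} \<subseteq> Q" using \<open>compact Q\<close> closure_minimal compact_imp_closed by blast
  have "bounded {x. psi x \<noteq> 0}"
    using \<open>{x. psi x \<noteq> 0} \<subseteq> Q\<close> compact_imp_bounded[OF \<open>compact Q\<close>] bounded_subset by blast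
  then have "compact (closure {x. psi x \<noteq> 0})" by simp
  with cl \<open>Q \<subseteq> \<Omega>\<close> show ?thesis
    by (auto simp: test_functions_def smooth_def compact_support_in_def C_k_psi)
qed

end

section \<open>The residual field and its representation by the curl\<close>

lemma grad_inner:
  assumes "u differentiable (at x)"
  shows "grad u x \<bullet> h = frechet_derivative u (at x) h"
  using frechet_derivative_eq_sum_partial[OF assms] by (simp add: grad_def inner_vec_def mult.commute)

context cylinder
begin

text \<open>This is the curl component \<open>curl \<phi> y \<bullet> cross3 e h\<close>, see
  \<open>c_inner_curl\<close>, in the form in which it arises from differentiating ray
  integrals.\<close>

definition c where
  "c h y = frechet_derivative (\<lambda>x. \<phi> x \<bullet> h) (at y) e - frechet_derivative p (at y) h"

lemma C_k_c: "C_k n (c h)"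
  unfolding c_def[abs_def]
  by (intro C_k_diff C_k_directional_derivative C_k_component C_k_p)

lemma open_off_K: "open (- K)"
  using K(1) compact_imp_closed by auto

lemma D_off_K:
  assumes "x \<notin> K"
  shows "frechet_derivative (\<lambda>x. \<phi> x \<bullet> h) (at x) k = 0" "frechet_derivative p (at x) k = 0"
  using assms open_off_K by (auto intro!: partial_vanishes(1)[of "- K"] simp: p_off_K \<phi>_off)

lemma c_off_K: "x \<notin> K \<Longrightarrow> c h x = 0"
  by (simp add: c_def D_off_K)

lemma c_off: "R < norm x \<Longrightarrow> c h x = 0"
  by (rule c_off_K[OF off_K])

abbreviation dp where "dp h y \<equiv> frechet_derivative p (at y) h"

lemma D_G:
  "(Gp has_derivative (\<lambda>h. ray_integral e (dp h) x)) (at x)"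
  "(Gm has_derivative (\<lambda>h. ray_integral (- e) (dp h) x)) (at x)"
  unfolding Gp_def Gm_def
  by (rule ray_integral_has_derivative[OF C_k_p[of "Suc 0"] p_off norm_e]
      ray_integral_has_derivative[OF C_k_p[of "Suc 0"] p_off norm_me]; assumption)+

text \<open>Off the columns the potentials and the ray integrals of \<open>dp h\<close> all vanish,
  so there any derivative of \<open>chi\<close> gives 0; on columns the explicit \<open>Dchi\<close>
  is available.\<close>

lemma D_psi:
  "frechet_derivative psi (at x) h = (if col x then Dchi x h * g x
      + chi x * ray_integral e (dp h) x
      - (1 - chi x) * ray_integral (- e) (dp h) x else 0)"
proof -
  have D: "frechet_derivative psi (at x) h = D h * g x
      + chi x * ray_integral e (dp h) x
      - (1 - chi x) * ray_integral (- e) (dp h) x"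
    if chi: "(chi has_derivative D) (at x)" for D
  proof -
    have 1: "((\<lambda>x. 1 - chi x) has_derivative (\<lambda>h. - D h)) (at x)"
      using has_derivative_diff[OF has_derivative_const[of 1] chi] by simp
    have "(psi has_derivative (\<lambda>h. (chi x * ray_integral e (dp h) x + D h * Gp x)
        - ((1 - chi x) * ray_integral (- e) (dp h) x + - D h * Gm x))) (at x)"
      unfolding psi_def[abs_def]
      by (intro has_derivative_diff has_derivative_mult chi 1 D_G)
    from frechet_derivative_at[OF this, symmetric] show ?thesis
      by (simp add: g_def algebra_simps)
  qed
  show ?thesis
  proof (cases "col x")
    case True
    then show ?thesis using D[OF chi_derivative] by simp
  next
    case False
    have "(chi has_derivative frechet_derivative chi (at x)) (at x)"
      by (rule C_k_has_derivative[OF C_k_chi[of "Suc 0"]])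
    from D[OF this] False show ?thesis
      using ray_off_col[of "dp h" x, OF D_off_K(2)]
      by (simp add: g_def G_beyond)
  qed
qed

definition u where "u x = \<phi> x - grad psi x"

lemma continuous_grad: "continuous_on UNIV (grad psi)"
  unfolding grad_def[abs_def]
  using C_k_psi[of "Suc 0"] by (intro continuous_on_vec_lambda) auto

lemma continuous_u: "continuous_on UNIV u"
  unfolding u_def[abs_def] by (intro continuous_intros C_k_continuous[OF C_\<phi>] continuous_grad)

lemma psi_differentiable: "psi differentiable (at x)"
  using C_k_psi[of "Suc 0"] by simp

text \<open>The part of \<open>c h\<close> differentiated along \<open>e\<close> integrates back to
  \<open>\<phi> \<bullet> h\<close>, with a sign given by the orientation of the ray; the other part
  is the derivative of the potential in direction \<open>h\<close>.\<close>

lemma ray_integral_c: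
  "ray_integral e (c h) x = \<phi> x \<bullet> h - ray_integral e (dp h) x"
  "ray_integral (- e) (c h) x = - (\<phi> x \<bullet> h) - ray_integral (- e) (dp h) x"
proof -
  let ?A = "\<lambda>y. frechet_derivative (\<lambda>x. \<phi> x \<bullet> h) (at y) e" and ?B = "dp h"
  have cont: "continuous_on UNIV ?A" "continuous_on UNIV ?B"
    using C_k_continuous[OF C_k_directional_derivative[OF C_k_component]]
      C_k_continuous[OF C_k_directional_derivative[OF C_k_p]] by auto
  have off: "\<And>x. R < norm x \<Longrightarrow> ?A x = 0" "\<And>x. R < norm x \<Longrightarrow> ?B x = 0"
    using D_off_K[OF off_K] by auto
  have lin: "linear (frechet_derivative (\<lambda>x. \<phi> x \<bullet> h) (at y))" for y
    using C_k_component[of "Suc 0" h] by (intro linear_frechet_derivative) auto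
  have 1: "ray_integral e ?A x = \<phi> x \<bullet> h"
    by (rule ray_integral_along[OF C_k_component[where n="Suc 0"] component_off norm_e])
  have "ray_integral (- e) (\<lambda>y. frechet_derivative (\<lambda>x. \<phi> x \<bullet> h) (at y) (- e)) x = \<phi> x \<bullet> h"
    by (rule ray_integral_along[OF C_k_component[where n="Suc 0"] component_off norm_me])
  then have 2: "ray_integral (- e) ?A x = - (\<phi> x \<bullet> h)"
    by (simp add: linear_neg[OF lin] ray_integral_uminus)
  have 3: "ray_integral e (c h) x = ray_integral e ?A x - ray_integral e ?B x"
    "ray_integral (- e) (c h) x = ray_integral (- e) ?A x - ray_integral (- e) ?B x"
    unfolding c_def[abs_def]
    by (rule ray_integral_diff[OF cont(1) off(1) cont(2) off(2) norm_e]
         ray_integral_diff[OF cont(1) off(1) cont(2) off(2) norm_me]; assumption)+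
  show "ray_integral e (c h) x = \<phi> x \<bullet> h - ray_integral e ?B x"
    "ray_integral (- e) (c h) x = - (\<phi> x \<bullet> h) - ray_integral (- e) ?B x"
    unfolding 3 1 2 by simp_all
qed

text \<open>Splitting \<open>\<phi> \<bullet> h\<close> into its shares \<open>chi\<close> and
  \<open>1 - chi\<close> pairs each share with the gradient of one potential. Only curl integrals
  remain, apart from the term in which \<open>chi\<close> is differentiated.\<close>

lemma u_col:
  assumes "col x"
  shows "u x \<bullet> h = chi x * ray_integral e (c h) x - (1 - chi x) * ray_integral (- e) (c h) x - Dchi x h * g x"
  unfolding ray_integral_c u_def inner_diff_left grad_inner[OF psi_differentiable] D_psi
  using assms by (simp add: algebra_simps)

text \<open>Strictly outside the barriers \<open>psi\<close> vanishes on an open set; off the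
  columns its derivative vanishes by \<open>D_psi\<close>.\<close>

lemma u_off:
  assumes "\<not> (col x \<and> a x \<le> x \<bullet> e \<and> x \<bullet> e \<le> b x)"
  shows "u x = 0"
proof -
  have "x \<notin> K"
  proof
    assume "x \<in> K"
    then have "col x" unfolding col_def by (auto intro: exI[of _ 0])
    then show False using assms above[OF \<open>x \<in> K\<close>] below[OF \<open>x \<in> K\<close>] by auto
  qed
  moreover have "frechet_derivative psi (at x) h = 0" for h
  proof (cases "col x")
    case True
    then consider "x \<bullet> e < a x" | "b x < x \<bullet> e" using assms by force
    then show ?thesis
    proof cases
      case 1
      show ?thesis
        by (rule partial_vanishes(1)[of "{x. x \<bullet> e < a x}"])
          (use 1 psi_support in \<open>force intro!: open_Collect_less continuous_intros\<close>)+
    next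
      case 2
      show ?thesis
        by (rule partial_vanishes(1)[of "{x. b x < x \<bullet> e}"])
          (use 2 psi_support in \<open>force intro!: open_Collect_less continuous_intros\<close>)+
    qed
  qed (simp add: D_psi)
  then have "grad psi x \<bullet> h = 0" for h by (simp add: grad_inner[OF psi_differentiable])
  then have "grad psi x = 0" by (metis inner_eq_zero_iff)
  ultimately show ?thesis by (simp add: u_def \<phi>_off)
qed

lemma linear_ab: "linear (Da x)" "linear (Db x)"
  using D_a D_b has_derivative_linear by blast+

text \<open>Along \<open>e\<close> the function is constant, while the tangent inequality holds in
  both directions.\<close>

lemma Dab_e: "Da x e = 0" "Db x e = 0"
proof -
  have "t * Da x e \<le> 0" for t
    using tan_a[of x "x + t *\<^sub>R e"] by (simp add: inv_a linear_cmul[OF linear_ab(1)])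
  from this[of 1] this[of "-1"] show "Da x e = 0" by simp
  have "0 \<le> t * Db x e" for t
    using tan_b[of "x + t *\<^sub>R e" x] by (simp add: inv_b linear_cmul[OF linear_ab(2)])
  from this[of 1] this[of "-1"] show "Db x e = 0" by simp
qed

lemma Dab_invariant: "Da (x + s *\<^sub>R e) h = Da x h" "Db (x + s *\<^sub>R e) h = Db x h"
proof -
  have T: "((\<lambda>x. x + s *\<^sub>R e) has_derivative (\<lambda>h. h)) (at x)"
    by (auto intro!: derivative_eq_intros)
  have "(a has_derivative Da (x + s *\<^sub>R e)) (at x)"
    using has_derivative_compose[OF T D_a] by (simp add: inv_a)
  then show "Da (x + s *\<^sub>R e) h = Da x h" using D_a has_derivative_unique by metis
  have "(b has_derivative Db (x + s *\<^sub>R e)) (at x)"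
    using has_derivative_compose[OF T D_b] by (simp add: inv_b)
  then show "Db (x + s *\<^sub>R e) h = Db x h" using D_b has_derivative_unique by metis
qed

text \<open>For \<open>h\<close> in the plane orthogonal to \<open>e\<close>, this dominates
  \<open>(frechet_derivative g (at x) h)^2 / l x\<close> on columns, by \<open>D_g\<close> and
  \<open>line_c_bound\<close>, and so takes the place of the right-hand side in the Hardy
  inequality.\<close>

definition A where "A h = line_integral e (\<lambda>y. (c h y)\<^sup>2)"
definition S where "S h x = (Da x h)\<^sup>2 + (Db x h)\<^sup>2"

lemma g_line: "g x = line_integral e p x"
  unfolding g_def Gp_def Gm_def
  by (rule ray_integral_sum[OF C_k_continuous[OF C_k_p] p_off norm_e])

lemma col_translate: "col (x + s *\<^sub>R e) = col x"
proof -
  have "col (x + s *\<^sub>R e)" if col: "col x" for x s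
  proof -
    obtain t where "x + t *\<^sub>R e \<in> K" using col by (auto simp: col_def)
    then have "(x + s *\<^sub>R e) + (t - s) *\<^sub>R e \<in> K" by (simp add: algebra_simps)
    then show ?thesis unfolding col_def by blast
  qed
  from this[of x s] this[of "x + s *\<^sub>R e" "- s"] show ?thesis by auto
qed

lemma invariant:
  "g (x + s *\<^sub>R e) = g x" "A h (x + s *\<^sub>R e) = A h x" "S h (x + s *\<^sub>R e) = S h x" "l (x + s *\<^sub>R e) = l x"
proof -
  show "g (x + s *\<^sub>R e) = g x"
    unfolding g_line by (rule line_integral_translate[OF C_k_continuous[OF C_k_p] p_off norm_e])
  have "continuous_on UNIV (\<lambda>y. (c h y)\<^sup>2)"
    by (intro continuous_intros C_k_continuous[OF C_k_c])
  then show "A h (x + s *\<^sub>R e) = A h x"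
    unfolding A_def by (rule line_integral_translate[OF _ _ norm_e]) (use c_off in simp)
  show "S h (x + s *\<^sub>R e) = S h x" by (simp add: S_def Dab_invariant)
  show "l (x + s *\<^sub>R e) = l x" by (simp add: l_def inv_a inv_b)
qed

lemma line_support:
  assumes "\<And>x. x \<notin> K \<Longrightarrow> v x = (0::real)" "t \<notin> {a x - x \<bullet> e..b x - x \<bullet> e}"
  shows "v (x + t *\<^sub>R e) = 0"
proof (rule assms(1), rule notI)
  assume *: "x + t *\<^sub>R e \<in> K"
  show False using assms(2) above[OF *] below[OF *] by (auto simp: inv_a inv_b inner_add_left)
qed

text \<open>Cauchy-Schwarz on the chord, outside which \<open>c h\<close> vanishes. The factor
  \<open>l x\<close> is what cancels the Hardy weight.\<close>

lemma line_c_bound: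
  assumes "col x"
  shows "(line_integral e (\<lambda>y. \<bar>c h y\<bar>) x)\<^sup>2 \<le> l x * A h x" "(line_integral e (c h) x)\<^sup>2 \<le> l x * A h x"
proof -
  have le: "a x - x \<bullet> e \<le> b x - x \<bullet> e" using col_bounds(1)[OF assms] by simp
  have 1: "continuous_on UNIV (\<lambda>y. \<bar>c h y\<bar>)" "continuous_on UNIV (c h)"
    by (intro continuous_intros C_k_continuous[OF C_k_c])+
  have "(line_integral e (\<lambda>y. \<bar>c h y\<bar>) x)\<^sup>2
      \<le> ((b x - x \<bullet> e) - (a x - x \<bullet> e)) * line_integral e (\<lambda>y. \<bar>c h y\<bar>\<^sup>2) x"
    by (rule line_integral_power2_le[OF 1(1) _ le], rule line_support[of "\<lambda>y. \<bar>c h y\<bar>"])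
       (simp_all add: c_off_K)
  then show "(line_integral e (\<lambda>y. \<bar>c h y\<bar>) x)\<^sup>2 \<le> l x * A h x" by (simp add: A_def l_def)
  have "(line_integral e (c h) x)\<^sup>2
      \<le> ((b x - x \<bullet> e) - (a x - x \<bullet> e)) * line_integral e (\<lambda>y. (c h y)\<^sup>2) x"
    by (rule line_integral_power2_le[OF 1(2) _ le], rule line_support[of "c h"])
       (simp_all add: c_off_K)
  then show "(line_integral e (c h) x)\<^sup>2 \<le> l x * A h x" by (simp add: A_def l_def)
qed

text \<open>The two occurrences of \<open>\<phi> \<bullet> h\<close> in
  \<open>ray_integral_c\<close> cancel.\<close>

lemma D_g: "frechet_derivative g (at x) h = - line_integral e (c h) x"
proof -
  have "(g has_derivative (\<lambda>h. ray_integral e (dp h) x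
      + ray_integral (- e) (dp h) x)) (at x)"
    unfolding g_def[abs_def] by (rule has_derivative_add[OF D_G])
  from frechet_derivative_at[OF this, symmetric]
  have "frechet_derivative g (at x) h = ray_integral e (dp h) x
      + ray_integral (- e) (dp h) x"
    by simp
  also have "\<dots> = - (ray_integral e (c h) x + ray_integral (- e) (c h) x)"
    by (simp add: ray_integral_c)
  also have "\<dots> = - line_integral e (c h) x"
    by (simp add: ray_integral_sum[OF C_k_continuous[OF C_k_c] c_off norm_e])
  finally show ?thesis .
qed

lemma l_bounds:
  assumes "col x" shows "0 < l x" "l x \<le> w"
proof -
  show "0 < l x" using col_bounds(1)[OF assms] by (simp add: l_def)
  have "\<bar>((x + (b x - x \<bullet> e) *\<^sub>R e) - (x + (a x - x \<bullet> e) *\<^sub>R e)) \<bullet> e\<bar> \<le> w"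
    by (intro width col_bounds assms)
  then show "l x \<le> w" by (simp add: l_def inner_diff_left inner_add_left)
qed

lemma X_bounds:
  assumes "col x" "a x \<le> x \<bullet> e" "x \<bullet> e \<le> b x"
  shows "0 \<le> X x" "X x \<le> 1"
  using assms l_bounds(1)[OF assms(1)] Lam_col[OF assms(1)]
  by (auto simp: X_def l_def inner_commute field_simps)

text \<open>Along \<open>e\<close> both the curl component \<open>c e\<close> and the slopes vanish,
  so only the change of the relative position, of size \<open>1 / l x\<close>, remains. Across
  \<open>e\<close>, separating the curl term from the cutoff term costs the factor 2.\<close>

lemma u_bounds:
  assumes M: "\<And>t. step' t \<le> M" and x: "col x" "a x \<le> x \<bullet> e" "x \<bullet> e \<le> b x"
  shows "(u x \<bullet> e)\<^sup>2 \<le> M\<^sup>2 * (g x)\<^sup>2 / (l x)\<^sup>2"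
    and "e \<bullet> h = 0 \<Longrightarrow> (u x \<bullet> h)\<^sup>2 \<le> 2 * (l x * A h x) + 2 * (M\<^sup>2 * (g x)\<^sup>2 * S h x / (l x)\<^sup>2)"
proof -
  have l: "l x > 0" by (rule l_bounds[OF x(1)])
  have sM: "(step' t)\<^sup>2 \<le> M\<^sup>2" for t using M[of t] step'_nonneg[of t] by (intro power_mono)
  have "c e = (\<lambda>y. 0)" unfolding c_def[abs_def] p_def[abs_def] by simp
  then have "u x \<bullet> e = step' (X x) * g x / l x"
    unfolding u_col[OF x(1)] by (simp add: ray_integral_def Dchi_def Dab_e)
  then have "(u x \<bullet> e)\<^sup>2 = (step' (X x))\<^sup>2 * ((g x)\<^sup>2 / (l x)\<^sup>2)"
    by (simp add: power_mult_distrib power_divide)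
  also have "\<dots> \<le> M\<^sup>2 * ((g x)\<^sup>2 / (l x)\<^sup>2)"
    by (intro mult_right_mono sM) simp
  finally show "(u x \<bullet> e)\<^sup>2 \<le> M\<^sup>2 * (g x)\<^sup>2 / (l x)\<^sup>2" by simp
  assume h: "e \<bullet> h = 0"
  define P where "P = chi x * ray_integral e (c h) x - (1 - chi x) * ray_integral (- e) (c h) x"
  define Q where "Q = Dchi x h * g x"
  have "\<bar>P\<bar> \<le> line_integral e (\<lambda>y. \<bar>c h y\<bar>) x"
    unfolding P_def
    by (rule ray_integral_convex_combination_bound[OF C_k_continuous[OF C_k_c] c_off norm_e chi_bounds])
  then have P: "P\<^sup>2 \<le> l x * A h x"
    using line_c_bound(1)[OF x(1), of h] by (meson abs_le_square_iff abs_of_nonneg order_trans abs_ge_zero abs_le_iff power2_abs power_mono)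
  define \<theta> where "\<theta> = X x"
  have \<theta>: "0 \<le> \<theta>" "\<theta> \<le> 1" using X_bounds[OF x] by (simp_all add: \<theta>_def)
  define V where "V = (1 - \<theta>) * Db x h + \<theta> * Da x h"
  \<comment> \<open>Convexity of the square: \<open>V\<close> is an average of the slopes at the two
    ends of the chord.\<close>
  have V: "V\<^sup>2 \<le> S h x"
  proof -
    have "(1 - \<theta>) * (Db x h)\<^sup>2 + \<theta> * (Da x h)\<^sup>2 - V\<^sup>2 = \<theta> * (1 - \<theta>) * (Db x h - Da x h)\<^sup>2"
      by (simp add: V_def power2_eq_square algebra_simps)
    moreover have "\<theta> * (1 - \<theta>) * (Db x h - Da x h)\<^sup>2 \<ge> 0" using \<theta> by simp
    moreover have "(1 - \<theta>) * (Db x h)\<^sup>2 \<le> 1 * (Db x h)\<^sup>2" "\<theta> * (Da x h)\<^sup>2 \<le> 1 * (Da x h)\<^sup>2"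
      using \<theta> by (intro mult_right_mono; simp)+
    ultimately show ?thesis unfolding S_def by linarith
  qed
  have "Q\<^sup>2 = (step' \<theta>)\<^sup>2 * V\<^sup>2 * ((g x)\<^sup>2 / (l x)\<^sup>2)"
    using h by (simp add: Q_def Dchi_def V_def \<theta>_def power_mult_distrib power_divide)
  also have "\<dots> \<le> M\<^sup>2 * S h x * ((g x)\<^sup>2 / (l x)\<^sup>2)"
    by (intro mult_right_mono mult_mono sM V) auto
  finally have Q: "Q\<^sup>2 \<le> M\<^sup>2 * (g x)\<^sup>2 * S h x / (l x)\<^sup>2" by (simp add: mult_ac)
  have "u x \<bullet> h = P - Q" unfolding u_col[OF x(1)] P_def Q_def ..
  moreover have "(P - Q)\<^sup>2 \<le> 2 * P\<^sup>2 + 2 * Q\<^sup>2"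
    using zero_le_power2[of "P + Q"] by (simp add: power2_eq_square algebra_simps)
  ultimately have "(u x \<bullet> h)\<^sup>2 \<le> 2 * P\<^sup>2 + 2 * Q\<^sup>2" by simp
  then show "(u x \<bullet> h)\<^sup>2 \<le> 2 * (l x * A h x) + 2 * (M\<^sup>2 * (g x)\<^sup>2 * S h x / (l x)\<^sup>2)"
    using P Q by linarith
qed

end

section \<open>The Hardy inequality on lines orthogonal to \<open>e\<close>\<close>

lemma line_has_real_derivative:
  fixes F :: "real^3 \<Rightarrow> real"
  assumes "(F has_derivative F') (at (y + t *\<^sub>R h))"
  shows "((\<lambda>t. F (y + t *\<^sub>R h)) has_real_derivative F' h) (at t)"
proof -
  have "((\<lambda>t. y + t *\<^sub>R h) has_derivative (\<lambda>s. s *\<^sub>R h)) (at t)"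
    by (auto intro!: derivative_eq_intros)
  from has_derivative_compose[OF this assms]
  have "((\<lambda>t. F (y + t *\<^sub>R h)) has_derivative (\<lambda>s. F' (s *\<^sub>R h))) (at t)" .
  moreover have "F' (s *\<^sub>R h) = F' h * s" for s
    using linear_cmul[OF has_derivative_linear[OF assms]] by (simp add: mult.commute)
  ultimately show ?thesis by (simp add: has_field_derivative_def)
qed

lemma continuous_zero_at_boundary:
  fixes F :: "real \<Rightarrow> real"
  assumes "continuous_on UNIV F" "\<And>t. t \<notin> {\<alpha>..\<beta>} \<Longrightarrow> F t = 0"
  shows "F \<alpha> = 0" "F \<beta> = 0"
proof -
  have "closed {t. F t = 0}"
    using continuous_closed_vimage[of "{0}" F] assms(1)
    by (simp add: vimage_def continuous_on_eq_continuous_at)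
  moreover have "{..<\<alpha>} \<subseteq> {t. F t = 0}" "{\<beta><..} \<subseteq> {t. F t = 0}" using assms(2) by auto
  ultimately have "closure {..<\<alpha>} \<subseteq> {t. F t = 0}" "closure {\<beta><..} \<subseteq> {t. F t = 0}"
    by (meson closure_minimal)+
  then show "F \<alpha> = 0" "F \<beta> = 0" by auto
qed

context cylinder
begin

lemma C_k_A: "C_k n (A h)"
proof -
  have c2: "C_k n (\<lambda>y. (c h y)\<^sup>2)" for n
    using C_k_mult[OF C_k_c C_k_c] by (simp add: power2_eq_square)
  have off: "\<And>x. R < norm x \<Longrightarrow> (c h x)\<^sup>2 = 0" by (simp add: c_off)
  have "A h = (\<lambda>x. ray_integral e (\<lambda>y. (c h y)\<^sup>2) x + ray_integral (- e) (\<lambda>y. (c h y)\<^sup>2) x)"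
    unfolding A_def using ray_integral_sum[OF C_k_continuous[OF c2] off norm_e] by auto
  then show ?thesis
    using C_k_add[OF C_k_ray_integral[OF c2 off norm_e] C_k_ray_integral[OF c2 off norm_me]] by simp
qed

lemma off_col:
  assumes "\<not> col x"
  shows "A h x = 0" "g x = 0"
proof -
  have "v (x + t *\<^sub>R e) = 0" if "\<And>x. x \<notin> K \<Longrightarrow> v x = (0::real)" for v t
    using that assms by (auto simp: col_def)
  from this[of "\<lambda>y. (c h y)\<^sup>2"] show "A h x = 0"
    by (simp add: A_def line_integral_def c_off_K)
  show "g x = 0" using assms by (simp add: g_def G_beyond)
qed

lemma A_nonneg: "A h x \<ge> 0"
proof (cases "col x")
  case True
  from line_c_bound(2)[OF True, of h] have "0 \<le> l x * A h x" by (meson order_trans zero_le_power2)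
  then show ?thesis using l_bounds(1)[OF True] by (simp add: zero_le_mult_iff)
qed (simp add: off_col)

lemma S_nonneg: "S h x \<ge> 0" by (simp add: S_def)

lemma D_eq: "Da x h = frechet_derivative a (at x) h" "Db x h = frechet_derivative b (at x) h"
  using frechet_derivative_at[OF D_a] frechet_derivative_at[OF D_b] by metis+

lemma C_k_Dab: "C_k n (\<lambda>x. Da x h)" "C_k n (\<lambda>x. Db x h)"
  unfolding D_eq by (intro C_k_directional_derivative C_a C_b)+

lemma continuous_S: "continuous_on UNIV (S h)"
  unfolding S_def[abs_def] by (intro continuous_intros C_k_continuous[OF C_k_Dab(1)] C_k_continuous[OF C_k_Dab(2)])

text \<open>The columns met by the line correspond to the projection onto \<open>h\<close> of
  \<open>K\<close> cut by the plane through \<open>y\<close> spanned by \<open>e\<close> and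
  \<open>h\<close>. This set is compact and convex; if it is empty, then \<beta> < \<alpha>.\<close>

lemma col_interval: "\<exists>\<alpha> \<beta>. {t. col (y + t *\<^sub>R h)} = {\<alpha>..\<beta>}" if h: "norm h = 1" "e \<bullet> h = 0"
proof -
  define L where "L = K \<inter> (\<lambda>x. x - y) -` span {e, h}"
  have L: "compact L" unfolding L_def
    by (intro compact_Int_closed K closed_vimage closed_span continuous_intros)
  have eq: "{t. col (y + t *\<^sub>R h)} = (\<lambda>x. (x - y) \<bullet> h) ` L"
  proof (intro set_eqI iffI)
    fix t assume "t \<in> {t. col (y + t *\<^sub>R h)}"
    then obtain s where s: "y + t *\<^sub>R h + s *\<^sub>R e \<in> K" by (auto simp: col_def)
    have mem: "y + t *\<^sub>R h + s *\<^sub>R e \<in> L"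
    proof -
      have "s *\<^sub>R e + t *\<^sub>R h \<in> span {e, h}" by (intro span_add span_mul span_base) auto
      moreover have "(y + t *\<^sub>R h + s *\<^sub>R e) - y = s *\<^sub>R e + t *\<^sub>R h" by simp
      ultimately show ?thesis using s unfolding L_def by (metis IntI vimageI2)
    qed
    have "t = ((y + t *\<^sub>R h + s *\<^sub>R e) - y) \<bullet> h"
      using h by (simp add: inner_add_left dot_square_norm)
    then show "t \<in> (\<lambda>x. (x - y) \<bullet> h) ` L" using mem by (rule image_eqI)
  next
    fix t assume "t \<in> (\<lambda>x. (x - y) \<bullet> h) ` L"
    then obtain x where x: "x \<in> K" "x - y \<in> span {e, h}" "t = (x - y) \<bullet> h" by (auto simp: L_def)
    then obtain s r where sr: "x - y = s *\<^sub>R e + r *\<^sub>R h"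
      by (auto simp: span_insert algebra_simps eq_diff_eq)
    then have "t = r" using x(3) h by (simp add: inner_add_left dot_square_norm)
    then have "y + t *\<^sub>R h + s *\<^sub>R e = x" using sr by (simp add: algebra_simps)
    then show "t \<in> {t. col (y + t *\<^sub>R h)}" using x(1) by (auto simp: col_def)
  qed
  have "convex {t. col (y + t *\<^sub>R h)}"
  proof (rule convexI)
    fix t1 t2 u v :: real
    assume "t1 \<in> {t. col (y + t *\<^sub>R h)}" "t2 \<in> {t. col (y + t *\<^sub>R h)}" and uv: "0 \<le> u" "0 \<le> v" "u + v = 1"
    then obtain s1 s2 where s: "y + t1 *\<^sub>R h + s1 *\<^sub>R e \<in> K" "y + t2 *\<^sub>R h + s2 *\<^sub>R e \<in> K"
      by (auto simp: col_def)
    have "u *\<^sub>R (y + t1 *\<^sub>R h + s1 *\<^sub>R e) + v *\<^sub>R (y + t2 *\<^sub>R h + s2 *\<^sub>R e) \<in> K"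
      by (rule convexD[OF K(2) s uv])
    also have "u *\<^sub>R (y + t1 *\<^sub>R h + s1 *\<^sub>R e) + v *\<^sub>R (y + t2 *\<^sub>R h + s2 *\<^sub>R e)
      = (u + v) *\<^sub>R y + (u *\<^sub>R t1 + v *\<^sub>R t2) *\<^sub>R h + (u * s1 + v * s2) *\<^sub>R e"
      by (simp add: algebra_simps)
    finally show "u *\<^sub>R t1 + v *\<^sub>R t2 \<in> {t. col (y + t *\<^sub>R h)}" using uv by (auto simp: col_def)
  qed
  moreover have "compact {t. col (y + t *\<^sub>R h)}"
    unfolding eq by (intro compact_continuous_image L continuous_intros)
  ultimately show ?thesis using connected_compact_interval_1 convex_connected by blast
qed

text \<open>With \<open>Lam\<close> in place of \<open>l\<close> the integrands are continuous on
  the whole line and vanish where no column is met. The slope bound uses the oscillation of the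
  chord ends, at most the width along \<open>e\<close>; the second bound uses the length of the
  interval of columns, hence the width along \<open>h\<close>.\<close>

lemma hardy_line:
  assumes h: "norm h = 1" "e \<bullet> h = 0"
  shows "(\<integral>\<^sup>+t. ennreal ((g (y + t *\<^sub>R h))\<^sup>2 * S h (y + t *\<^sub>R h) / Lam (y + t *\<^sub>R h)) \<partial>lborel)
      \<le> ennreal (4 * w\<^sup>2) * (\<integral>\<^sup>+t. ennreal (A h (y + t *\<^sub>R h)) \<partial>lborel)" (is ?P)
    and "(\<And>x y. x \<in> \<Omega> \<Longrightarrow> y \<in> \<Omega> \<Longrightarrow> \<bar>(x - y) \<bullet> h\<bar> \<le> w) \<Longrightarrow>
      (\<integral>\<^sup>+t. ennreal ((g (y + t *\<^sub>R h))\<^sup>2 / Lam (y + t *\<^sub>R h)) \<partial>lborel)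
      \<le> ennreal (w\<^sup>2) * (\<integral>\<^sup>+t. ennreal (A h (y + t *\<^sub>R h)) \<partial>lborel)"
proof -
  let ?x = "\<lambda>t. y + t *\<^sub>R h"
  obtain \<alpha> \<beta> where J: "{t. col (?x t)} = {\<alpha>..\<beta>}" using col_interval[OF h] by blast
  have col: "t \<in> {\<alpha>..\<beta>} \<longleftrightarrow> col (?x t)" for t using J by blast
  have cl: "continuous_on UNIV (\<lambda>t. F (?x t))" if "continuous_on UNIV F" for F :: "real^3 \<Rightarrow> real"
    by (rule continuous_on_line[OF that])
  have zero: "g (?x t) = 0" "A h (?x t) = 0" if "\<not> \<alpha> \<le> t \<or> \<not> t \<le> \<beta>" for t
    using off_col[of "?x t"] col[of t] that by auto
  note cont = C_k_continuous[OF C_k_g] C_k_continuous[OF C_k_Lam] continuous_S C_k_continuous[OF C_k_A]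
  have Lam0: "Lam x \<noteq> 0" for x using Lam_pos[of x] by simp
  have 1: "(\<integral>\<^sup>+t. ennreal ((g (?x t))\<^sup>2 * S h (?x t) / Lam (?x t)) \<partial>lborel)
      = ennreal (integral {\<alpha>..\<beta>} (\<lambda>t. (g (?x t))\<^sup>2 * S h (?x t) / Lam (?x t)))"
    using zero S_nonneg less_imp_le[OF Lam_pos]
    by (intro nn_integral_eq_integral_interval cl[of "\<lambda>x. (g x)\<^sup>2 * S h x / Lam x"] continuous_intros cont)
      (auto simp: Lam0)
  have 2: "(\<integral>\<^sup>+t. ennreal ((g (?x t))\<^sup>2 / Lam (?x t)) \<partial>lborel)
      = ennreal (integral {\<alpha>..\<beta>} (\<lambda>t. (g (?x t))\<^sup>2 / Lam (?x t)))"
    using zero less_imp_le[OF Lam_pos]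
    by (intro nn_integral_eq_integral_interval cl[of "\<lambda>x. (g x)\<^sup>2 / Lam x"] continuous_intros cont)
      (auto simp: Lam0)
  have 3: "(\<integral>\<^sup>+t. ennreal (A h (?x t)) \<partial>lborel) = ennreal (integral {\<alpha>..\<beta>} (\<lambda>t. A h (?x t)))"
    using zero A_nonneg
    by (intro nn_integral_eq_integral_interval cl cont) auto
  have LamJ: "Lam (?x t) = b (?x t) - a (?x t)" if "t \<in> {\<alpha>..\<beta>}" for t
    using that Lam_col unfolding col l_def by simp
  define I where "I = integral {\<alpha>..\<beta>} (\<lambda>t. A h (?x t))"
  have I0: "I \<ge> 0" unfolding I_def
    by (intro Henstock_Kurzweil_Integration.integral_nonneg integrable_continuous_interval
        continuous_on_subset[OF cl[OF cont(4)]]) (auto simp: A_nonneg)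
  have main: "integral {\<alpha>..\<beta>} (\<lambda>t. (g (?x t))\<^sup>2 * S h (?x t) / Lam (?x t)) \<le> 4 * w\<^sup>2 * I \<and>
    integral {\<alpha>..\<beta>} (\<lambda>t. (g (?x t))\<^sup>2 / Lam (?x t)) \<le> (\<beta> - \<alpha>)\<^sup>2 * I" if "\<alpha> \<le> \<beta>"
  proof -
    have g: "((\<lambda>t. g (?x t)) has_real_derivative frechet_derivative g (at (?x t)) h) (at t)" for t
      by (intro line_has_real_derivative C_k_has_derivative[OF C_k_g[of "Suc 0"]])
    have cg: "continuous_on UNIV (\<lambda>t. frechet_derivative g (at (?x t)) h)"
      by (intro cl[of "\<lambda>x. frechet_derivative g (at x) h"]
          C_k_continuous[OF C_k_directional_derivative[OF C_k_g[of "Suc 0"]]])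
    have da: "((\<lambda>t. a (?x t)) has_real_derivative Da (?x t) h) (at t)" for t
      by (intro line_has_real_derivative D_a)
    have db: "((\<lambda>t. b (?x t)) has_real_derivative Db (?x t) h) (at t)" for t
      by (intro line_has_real_derivative D_b)
    have ca: "continuous_on UNIV (\<lambda>t. Da (?x t) h)" "continuous_on UNIV (\<lambda>t. Db (?x t) h)"
      by (intro cl[of "\<lambda>x. Da x h"] cl[of "\<lambda>x. Db x h"] C_k_continuous[OF C_k_Dab(1)]
          C_k_continuous[OF C_k_Dab(2)])+
    have diff: "?x s - ?x t = (s - t) *\<^sub>R h" for s t by (simp add: algebra_simps)
    have ta: "a (?x t) + Da (?x t) h * (s - t) \<le> a (?x s)" for s t
      using tan_a[of "?x t" "?x s"] unfolding diff linear_cmul[OF linear_ab(1)] by (simp add: mult.commute)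
    have tb: "b (?x s) \<le> b (?x t) + Db (?x t) h * (s - t)" for s t
      using tan_b[of "?x s" "?x t"] unfolding diff linear_cmul[OF linear_ab(2)] by (simp add: mult.commute)
    have pos: "a (?x t) < b (?x t)" if "t \<in> {\<alpha>..\<beta>}" for t
      using that unfolding col by (rule col_bounds)
    \<comment> \<open>The ends of the chords are points of \<Omega>, and \<open>a\<close> and
      \<open>b\<close> are their coordinates along \<open>e\<close>.\<close>
    have oa: "\<bar>a (?x t) - a (?x s)\<bar> \<le> w" if "t \<in> {\<alpha>..\<beta>}" "s \<in> {\<alpha>..\<beta>}" for s t
      using width(1)[OF col_bounds(3) col_bounds(3)] that unfolding col
      by (force simp: inner_diff_left inner_add_left)
    have ob: "\<bar>b (?x t) - b (?x s)\<bar> \<le> w" if "t \<in> {\<alpha>..\<beta>}" "s \<in> {\<alpha>..\<beta>}" for s t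
      using width(1)[OF col_bounds(2) col_bounds(2)] that unfolding col
      by (force simp: inner_diff_left inner_add_left)
    \<comment> \<open>\<open>g\<close> is continuous and vanishes off the columns, so it also
      vanishes at the two end points, although columns pass through them.\<close>
    have g0: "g (?x \<alpha>) = 0" "g (?x \<beta>) = 0"
      using continuous_zero_at_boundary[OF cl[OF cont(1)], of \<alpha> \<beta>] col off_col(2) by blast+
    define G where "G = integral {\<alpha>..\<beta>} (\<lambda>t. (frechet_derivative g (at (?x t)) h)\<^sup>2 / (b (?x t) - a (?x t)))"
    have GI: "G \<le> I" unfolding G_def I_def
    proof (rule integral_le)
      show "(\<lambda>t. A h (?x t)) integrable_on {\<alpha>..\<beta>}"
        by (intro integrable_continuous_interval continuous_on_subset[OF cl[OF cont(4)]]) auto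
      show "(\<lambda>t. (frechet_derivative g (at (?x t)) h)\<^sup>2 / (b (?x t) - a (?x t))) integrable_on {\<alpha>..\<beta>}"
        using pos by (intro integrable_continuous_interval continuous_intros continuous_on_subset[OF cg]
            continuous_on_subset[OF cl[OF continuous_ab(1)]] continuous_on_subset[OF cl[OF continuous_ab(2)]])
          force+
      show "(frechet_derivative g (at (?x t)) h)\<^sup>2 / (b (?x t) - a (?x t)) \<le> A h (?x t)" if t: "t \<in> {\<alpha>..\<beta>}" for t
        using line_c_bound(2)[of "?x t" h] t pos[OF t] unfolding col D_g l_def
        by (simp add: divide_simps mult.commute)
    qed
    note H = hardy_concave_weight[OF \<open>\<alpha> \<le> \<beta>\<close> g cg da ca(1) db ca(2) ta tb pos oa ob g0, folded G_def]
    have "integral {\<alpha>..\<beta>} (\<lambda>t. (g (?x t))\<^sup>2 * S h (?x t) / Lam (?x t)) \<le> 4 * w\<^sup>2 * G"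
      using H(1) LamJ unfolding S_def
      by (subst Henstock_Kurzweil_Integration.integral_cong[where g="\<lambda>t. (g (?x t))\<^sup>2 *
            ((Da (?x t) h)\<^sup>2 + (Db (?x t) h)\<^sup>2) / (b (?x t) - a (?x t))"]) auto
    also have "\<dots> \<le> 4 * w\<^sup>2 * I" using GI by (intro mult_left_mono) auto
    finally have 4: "integral {\<alpha>..\<beta>} (\<lambda>t. (g (?x t))\<^sup>2 * S h (?x t) / Lam (?x t)) \<le> 4 * w\<^sup>2 * I" .
    have "integral {\<alpha>..\<beta>} (\<lambda>t. (g (?x t))\<^sup>2 / Lam (?x t)) \<le> (\<beta> - \<alpha>)\<^sup>2 * G"
      using H(2) LamJ
      by (subst Henstock_Kurzweil_Integration.integral_cong[where g="\<lambda>t. (g (?x t))\<^sup>2 / (b (?x t) - a (?x t))"]) auto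
    also have "\<dots> \<le> (\<beta> - \<alpha>)\<^sup>2 * I" using GI by (intro mult_left_mono) auto
    finally show ?thesis using 4 by blast
  qed
  show ?P
  proof (cases "\<alpha> \<le> \<beta>")
    case True
    show ?thesis unfolding 1 3 using main[OF True] I0 unfolding I_def
      by (simp add: ennreal_mult[symmetric] ennreal_leI)
  qed (simp add: 1)
  show "(\<integral>\<^sup>+t. ennreal ((g (y + t *\<^sub>R h))\<^sup>2 / Lam (y + t *\<^sub>R h)) \<partial>lborel)
      \<le> ennreal (w\<^sup>2) * (\<integral>\<^sup>+t. ennreal (A h (y + t *\<^sub>R h)) \<partial>lborel)"
    if wh: "\<And>x y. x \<in> \<Omega> \<Longrightarrow> y \<in> \<Omega> \<Longrightarrow> \<bar>(x - y) \<bullet> h\<bar> \<le> w"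
  proof (cases "\<alpha> \<le> \<beta>")
    case True
    then have "col (?x \<alpha>)" "col (?x \<beta>)" using col by auto
    then obtain s r where "?x \<alpha> + s *\<^sub>R e \<in> \<Omega>" "?x \<beta> + r *\<^sub>R e \<in> \<Omega>"
      using K(4) by (auto simp: col_def)
    from wh[OF this(2,1)] have "\<beta> - \<alpha> \<le> w"
      using h by (simp add: inner_diff_left inner_add_left dot_square_norm)
    then have "(\<beta> - \<alpha>)\<^sup>2 * I \<le> w\<^sup>2 * I" using True I0 by (intro mult_right_mono power_mono) auto
    then show ?thesis unfolding 2 3 using main[OF True] I0 unfolding I_def
      by (simp add: ennreal_mult[symmetric] ennreal_leI)
  qed (simp add: 2)
qed


section \<open>Integration over the columns\<close>

lemma c_inner_curl:
  "c h x = curl \<phi> x \<bullet> cross3 e h"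
proof -
  have D: "frechet_derivative (\<lambda>x. \<phi> x \<bullet> k) (at x) v = (\<Sum>i\<in>UNIV. v $ i * (partial i \<phi> x \<bullet> k))" for k v
  proof -
    have "(\<phi> has_derivative frechet_derivative \<phi> (at x)) (at x)"
      by (rule C_k_has_derivative[OF C_\<phi>[of "Suc 0"]])
    then have "((\<lambda>x. \<phi> x \<bullet> k) has_derivative (\<lambda>h. frechet_derivative \<phi> (at x) h \<bullet> k)) (at x)"
      by (rule has_derivative_inner_left)
    then have "partial i (\<lambda>x. \<phi> x \<bullet> k) x = partial i \<phi> x \<bullet> k" for i
      by (simp add: partial_eq) (simp add: partial_def)
    then show ?thesis
      using frechet_derivative_eq_sum_partial[of "\<lambda>x. \<phi> x \<bullet> k" x v] C_k_component[of "Suc 0" k] by simp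
  qed
  show ?thesis
    unfolding c_def p_def[abs_def] D
    by (simp add: curl_def cross3_def inner_vec_def sum_3 algebra_simps)
qed

lemma c_le_curl:
  assumes "norm h = 1" "e \<bullet> h = 0"
  shows "(c h x)\<^sup>2 \<le> (norm (curl \<phi> x))\<^sup>2"
proof -
  have "(norm (cross3 e h))\<^sup>2 = 1"
    using norm_cross[of e h] assms norm_e by simp
  then have "norm (cross3 e h) = 1" by (simp add: power2_eq_1_iff) (metis norm_ge_zero neg_0_le_iff_le not_one_le_zero)
  then have "\<bar>c h x\<bar> \<le> norm (curl \<phi> x)"
    using Cauchy_Schwarz_ineq2[of "curl \<phi> x" "cross3 e h"] unfolding c_inner_curl by simp
  then show ?thesis by (metis abs_ge_zero power2_abs power_mono)
qed

text \<open>Fubini along \<open>e\<close> turns the plane integral of \<open>A h\<close> into the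
  space integral of the square of \<open>c h\<close>, the component of the curl along a unit
  vector.\<close>

lemma nn_integral_A:
  assumes "norm h = 1" "e \<bullet> h = 0"
  shows "(\<integral>\<^sup>+q. ennreal (A h (pt 0 (fst q) (snd q))) \<partial>lborel) \<le> (\<integral>\<^sup>+x. ennreal ((norm (curl \<phi> x))\<^sup>2) \<partial>lborel)"
proof -
  have c2: "continuous_on UNIV (\<lambda>x. (c h x)\<^sup>2)"
    by (intro continuous_intros C_k_continuous[OF C_k_c])
  have line: "ennreal (A h y) = (\<integral>\<^sup>+s. ennreal ((c h (y + s *\<^sub>R e))\<^sup>2) \<partial>lborel)" for y
  proof -
    have z: "(c h (y + t *\<^sub>R e))\<^sup>2 = 0" if "t \<notin> {a y - y \<bullet> e..b y - y \<bullet> e}" for t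
      using line_support[of "c h", OF c_off_K that] by simp
    have "A h y = integral {a y - y \<bullet> e..b y - y \<bullet> e} (\<lambda>t. (c h (y + t *\<^sub>R e))\<^sup>2)"
      unfolding A_def line_integral_def by (rule integral_UNIV_eq[OF z])
    moreover have "(\<integral>\<^sup>+s. ennreal ((c h (y + s *\<^sub>R e))\<^sup>2) \<partial>lborel)
        = ennreal (integral {a y - y \<bullet> e..b y - y \<bullet> e} (\<lambda>t. (c h (y + t *\<^sub>R e))\<^sup>2))"
      by (rule nn_integral_eq_integral_interval[OF continuous_on_line[OF c2] _ z]) simp_all
    ultimately show ?thesis by simp
  qed
  have pt: "pt s t r = pt 0 t r + s *\<^sub>R e" for s t r by (simp add: pt_def)
  have "(\<integral>\<^sup>+q. ennreal (A h (pt 0 (fst q) (snd q))) \<partial>lborel)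
      = (\<integral>\<^sup>+q. (\<integral>\<^sup>+s. ennreal ((c h (pt s (fst q) (snd q)))\<^sup>2) \<partial>lborel) \<partial>lborel)"
    unfolding line by (simp add: pt[symmetric])
  also have "\<dots> = (\<integral>\<^sup>+x. ennreal ((c h x)\<^sup>2) \<partial>lborel)"
    using borel_measurable_continuous_onI[OF c2]
    by (intro nn_integral_frame[symmetric]) simp
  also have "\<dots> \<le> (\<integral>\<^sup>+x. ennreal ((norm (curl \<phi> x))\<^sup>2) \<partial>lborel)"
    by (intro nn_integral_mono ennreal_leI c_le_curl[OF assms])
  finally show ?thesis .
qed

text \<open>The pointwise bounds are constant along the column, so integration multiplies them by
  the chord length: \<open>1 / l^2\<close> becomes the Hardy weight \<open>1 / l\<close>, and
  \<open>l * A\<close> becomes \<open>l^2 * A\<close>, at most \<open>w^2 * A\<close>. With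
  \<open>y \<bullet> e = 0\<close> the parameter \<open>s\<close> is the height along
  \<open>e\<close>.\<close>

lemma column_integral:
  assumes M: "\<And>t. step' t \<le> M" and y: "y \<bullet> e = 0"
  shows "(\<integral>\<^sup>+s. ennreal ((norm (u (y + s *\<^sub>R e)))\<^sup>2) \<partial>lborel)
    \<le> ennreal (M\<^sup>2) * ennreal ((g y)\<^sup>2 / Lam y)
      + (ennreal (2 * w\<^sup>2) * ennreal (A f y) + ennreal (2 * M\<^sup>2) * ennreal ((g y)\<^sup>2 * S f y / Lam y))
      + (ennreal (2 * w\<^sup>2) * ennreal (A d y) + ennreal (2 * M\<^sup>2) * ennreal ((g y)\<^sup>2 * S d y / Lam y))"
    (is "_ \<le> ?W")
proof (cases "col y")
  case False
  then have "u (y + s *\<^sub>R e) = 0" for s using u_off[of "y + s *\<^sub>R e"] by (simp add: col_translate)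
  then show ?thesis by simp
next
  case True
  note l = l_bounds[OF True]
  have L: "Lam y = l y" by (rule Lam_col[OF True])
  define B where "B h = 2 * (l y * A h y) + 2 * (M\<^sup>2 * (g y)\<^sup>2 * S h y / (l y)\<^sup>2)" for h
  define C where "C = M\<^sup>2 * (g y)\<^sup>2 / (l y)\<^sup>2 + B f + B d"
  have B0: "B h \<ge> 0" for h unfolding B_def using l(1) A_nonneg S_nonneg by simp
  have C0: "C \<ge> 0" unfolding C_def using B0 by (intro add_nonneg_nonneg) auto
  have pw: "ennreal ((norm (u (y + s *\<^sub>R e)))\<^sup>2) \<le> ennreal C * indicator {a y..b y} s" for s
  proof (cases "s \<in> {a y..b y}")
    case s: True
    let ?x = "y + s *\<^sub>R e"
    have x: "col ?x" "a ?x \<le> ?x \<bullet> e" "?x \<bullet> e \<le> b ?x"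
      using True s y by (auto simp: col_translate inv_a inv_b inner_add_left)
    have "(norm (u ?x))\<^sup>2 = (u ?x \<bullet> e)\<^sup>2 + (u ?x \<bullet> f)\<^sup>2 + (u ?x \<bullet> d)\<^sup>2" by (rule norm_eq_frame)
    also have "\<dots> \<le> C"
      using u_bounds(1)[OF M x] u_bounds(2)[OF M x ef] u_bounds(2)[OF M x ed] unfolding C_def B_def invariant by simp
    finally show ?thesis using s by (simp add: ennreal_leI)
  next
    case s: False
    then have "u (y + s *\<^sub>R e) = 0"
      using y by (intro u_off) (auto simp: inv_a inv_b inner_add_left)
    then show ?thesis by simp
  qed
  have "(\<integral>\<^sup>+s. ennreal ((norm (u (y + s *\<^sub>R e)))\<^sup>2) \<partial>lborel) \<le> (\<integral>\<^sup>+s. ennreal C * indicator {a y..b y} s \<partial>lborel)"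
    by (intro nn_integral_mono pw)
  also have "\<dots> = ennreal (C * l y)"
    using col_bounds(1)[OF True] C0
    by (simp add: nn_integral_cmult l_def ennreal_mult)
  also have "\<dots> \<le> ennreal (M\<^sup>2 * ((g y)\<^sup>2 / Lam y)
      + ((2 * w\<^sup>2) * A f y + (2 * M\<^sup>2) * ((g y)\<^sup>2 * S f y / Lam y))
      + ((2 * w\<^sup>2) * A d y + (2 * M\<^sup>2) * ((g y)\<^sup>2 * S d y / Lam y)))"
  proof (intro ennreal_leI)
    have B: "B h * l y \<le> (2 * w\<^sup>2) * A h y + (2 * M\<^sup>2) * ((g y)\<^sup>2 * S h y / Lam y)" for h
    proof -
      have "B h * l y = 2 * (l y)\<^sup>2 * A h y + (2 * M\<^sup>2) * ((g y)\<^sup>2 * S h y / l y)"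
        using l by (simp add: B_def field_simps power2_eq_square)
      moreover have "2 * (l y)\<^sup>2 * A h y \<le> 2 * w\<^sup>2 * A h y"
        using l A_nonneg by (intro mult_right_mono mult_left_mono power_mono) auto
      ultimately show ?thesis unfolding L by linarith
    qed
    have "C * l y = M\<^sup>2 * ((g y)\<^sup>2 / Lam y) + B f * l y + B d * l y"
      using l unfolding C_def L by (simp add: field_simps power2_eq_square)
    then show "C * l y \<le> M\<^sup>2 * ((g y)\<^sup>2 / Lam y)
      + ((2 * w\<^sup>2) * A f y + (2 * M\<^sup>2) * ((g y)\<^sup>2 * S f y / Lam y))
      + ((2 * w\<^sup>2) * A d y + (2 * M\<^sup>2) * ((g y)\<^sup>2 * S d y / Lam y))"
      using B[of f] B[of d] by linarith
  qed
  also have "\<dots> = ?W"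
  proof -
    have "ennreal (m * x1 + (k * x2 + n * x3) + (k * x4 + n * x5))
        = ennreal m * ennreal x1 + (ennreal k * ennreal x2 + ennreal n * ennreal x3)
          + (ennreal k * ennreal x4 + ennreal n * ennreal x5)"
      if "0 \<le> m" "0 \<le> k" "0 \<le> n" "0 \<le> x1" "0 \<le> x2" "0 \<le> x3" "0 \<le> x4" "0 \<le> x5"
      for m k n x1 x2 x3 x4 x5 :: real
      using that by (simp flip: ennreal_plus ennreal_mult)
    then show ?thesis
      using A_nonneg S_nonneg less_imp_le[OF Lam_pos] by (meson divide_nonneg_nonneg mult_nonneg_nonneg zero_le_power2 zero_le_numeral)
  qed
  finally show ?thesis .
qed

lemma nn_integral_plane_cont:
  fixes F :: "real^3 \<Rightarrow> real"
  assumes "continuous_on UNIV F"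
  shows "(\<lambda>q. ennreal (F (pt 0 (fst q) (snd q)))) \<in> borel_measurable lborel"
proof -
  have "continuous_on UNIV (\<lambda>q. F (pt 0 (fst q) (snd q)))"
    by (rule continuous_on_compose2[OF assms]) (auto intro!: continuous_intros)
  from borel_measurable_continuous_onI[OF this] show ?thesis by simp
qed

text \<open>The constant adds up from \<open>M^2 * w^2\<close> for the term without slopes,
  \<open>2 * M^2 * (4 * w^2)\<close> for the slopes in each of the directions \<open>f\<close> and
  \<open>d\<close>, and \<open>2 * w^2\<close> for the curl integrals in each of them.\<close>

theorem residual_bound:
  assumes M: "\<And>t. step' t \<le> M"
  shows "(\<integral>\<^sup>+x. ennreal ((norm (u x))\<^sup>2) \<partial>lborel)
    \<le> ennreal ((17 * M\<^sup>2 + 4) * w\<^sup>2) * (\<integral>\<^sup>+x. ennreal ((norm (curl \<phi> x))\<^sup>2) \<partial>lborel)"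
proof -
  let ?I = "\<integral>\<^sup>+x. ennreal ((norm (curl \<phi> x))\<^sup>2) \<partial>lborel"
  define N where "N F = (\<integral>\<^sup>+q. ennreal (F (pt 0 (fst q) (snd q))) \<partial>lborel)" for F
  let ?G = "\<lambda>y. (g y)\<^sup>2 / Lam y" and ?S = "\<lambda>h y. (g y)\<^sup>2 * S h y / Lam y"
  have Lam0: "Lam x \<noteq> 0" for x using Lam_pos[of x] by simp
  have cont: "continuous_on UNIV ?G" "continuous_on UNIV (?S h)" "continuous_on UNIV (A h)" for h
    using Lam0 by (intro continuous_intros C_k_continuous[OF C_k_g] C_k_continuous[OF C_k_Lam]
        continuous_S C_k_continuous[OF C_k_A]; simp)+
  have meas: "(\<lambda>x. ennreal (F x)) \<in> borel_measurable borel" if "continuous_on UNIV F" for F :: "real^3 \<Rightarrow> real"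
    using borel_measurable_continuous_onI[OF that] by simp
  note m = nn_integral_plane_cont[OF cont(1)] nn_integral_plane_cont[OF cont(2)] nn_integral_plane_cont[OF cont(3)]
  have pt: "pt s t r = pt 0 t r + s *\<^sub>R e" for s t r by (simp add: pt_def)
  have N: "N F \<le> ennreal k * N (A h)"
    if h: "h = f \<or> h = d" and F: "continuous_on UNIV F"
      and le: "\<And>y. (\<integral>\<^sup>+t. ennreal (F (y + t *\<^sub>R h)) \<partial>lborel)
        \<le> ennreal k * (\<integral>\<^sup>+t. ennreal (A h (y + t *\<^sub>R h)) \<partial>lborel)" for F k h
  proof -
    have line: "(\<lambda>t. ennreal (A h (y + t *\<^sub>R h))) \<in> borel_measurable lborel" for y
      using borel_measurable_continuous_onI[OF continuous_on_line[OF cont(3), of UNIV h y h]] by simp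
    have "N F \<le> (\<integral>\<^sup>+q. ennreal k * ennreal (A h (pt 0 (fst q) (snd q))) \<partial>lborel)"
      unfolding N_def
      by (rule nn_integral_plane_mono_lines[of "\<lambda>x. ennreal (F x)" "\<lambda>x. ennreal k * ennreal (A h x)", OF _ _ h])
        (use meas[OF F] meas[OF cont(3)] le in \<open>simp_all add: nn_integral_cmult[OF line]\<close>)
    also have "\<dots> = ennreal k * N (A h)" unfolding N_def by (rule nn_integral_cmult[OF m(3)])
    finally show ?thesis .
  qed
  have "(\<integral>\<^sup>+x. ennreal ((norm (u x))\<^sup>2) \<partial>lborel)
      = (\<integral>\<^sup>+q. (\<integral>\<^sup>+s. ennreal ((norm (u (pt 0 (fst q) (snd q) + s *\<^sub>R e)))\<^sup>2) \<partial>lborel) \<partial>lborel)"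
    unfolding pt[symmetric]
    by (intro nn_integral_frame meas continuous_intros continuous_u)
  also have "\<dots> \<le> (\<integral>\<^sup>+q. ennreal (M\<^sup>2) * ennreal (?G (pt 0 (fst q) (snd q)))
      + (ennreal (2 * w\<^sup>2) * ennreal (A f (pt 0 (fst q) (snd q))) + ennreal (2 * M\<^sup>2) * ennreal (?S f (pt 0 (fst q) (snd q))))
      + (ennreal (2 * w\<^sup>2) * ennreal (A d (pt 0 (fst q) (snd q))) + ennreal (2 * M\<^sup>2) * ennreal (?S d (pt 0 (fst q) (snd q)))) \<partial>lborel)"
    by (intro nn_integral_mono column_integral[OF M]) simp
  also have "\<dots> = ennreal (M\<^sup>2) * N ?G + (ennreal (2 * w\<^sup>2) * N (A f) + ennreal (2 * M\<^sup>2) * N (?S f))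
      + (ennreal (2 * w\<^sup>2) * N (A d) + ennreal (2 * M\<^sup>2) * N (?S d))"
    unfolding N_def using m by (simp add: nn_integral_add nn_integral_cmult)
  also have "\<dots> \<le> ennreal (M\<^sup>2) * (ennreal (w\<^sup>2) * ?I)
      + (ennreal (2 * w\<^sup>2) * ?I + ennreal (2 * M\<^sup>2) * (ennreal (4 * w\<^sup>2) * ?I))
      + (ennreal (2 * w\<^sup>2) * ?I + ennreal (2 * M\<^sup>2) * (ennreal (4 * w\<^sup>2) * ?I))"
  proof -
    have Af: "N (A f) \<le> ?I" and Ad: "N (A d) \<le> ?I"
      unfolding N_def by (intro nn_integral_A norm_f norm_d ef ed)+
    \<comment> \<open>Estimated along \<open>f\<close>, where the width is at most \<open>w\<close>;
      along \<open>d\<close> the length of the set would enter instead.\<close>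
    have "N ?G \<le> ennreal (w\<^sup>2) * N (A f)"
      by (intro N cont hardy_line(2) norm_f ef width(2)) simp
    then have 1: "N ?G \<le> ennreal (w\<^sup>2) * ?I" using Af by (meson mult_left_mono order_trans zero_le)
    have "N (?S f) \<le> ennreal (4 * w\<^sup>2) * N (A f)" "N (?S d) \<le> ennreal (4 * w\<^sup>2) * N (A d)"
      by (intro N cont hardy_line(1) norm_f ef norm_d ed; simp)+
    then have 2: "N (?S f) \<le> ennreal (4 * w\<^sup>2) * ?I" "N (?S d) \<le> ennreal (4 * w\<^sup>2) * ?I"
      using Af Ad by (meson mult_left_mono order_trans zero_le)+
    show ?thesis by (intro add_mono mult_left_mono 1 2 Af Ad) auto
  qed
  also have "\<dots> = (ennreal (M\<^sup>2) * ennreal (w\<^sup>2) + (ennreal (2 * w\<^sup>2) + ennreal (2 * M\<^sup>2) * ennreal (4 * w\<^sup>2))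
      + (ennreal (2 * w\<^sup>2) + ennreal (2 * M\<^sup>2) * ennreal (4 * w\<^sup>2))) * ?I"
    by (simp only: distrib_right mult.assoc)
  also have "ennreal (M\<^sup>2) * ennreal (w\<^sup>2) + (ennreal (2 * w\<^sup>2) + ennreal (2 * M\<^sup>2) * ennreal (4 * w\<^sup>2))
      + (ennreal (2 * w\<^sup>2) + ennreal (2 * M\<^sup>2) * ennreal (4 * w\<^sup>2)) = ennreal ((17 * M\<^sup>2 + 4) * w\<^sup>2)"
    by (simp add: ennreal_mult[symmetric] ennreal_plus[symmetric] del: ennreal_plus) (simp add: algebra_simps)
  finally show ?thesis .
qed

end

section \<open>Lower bound for the Maxwell eigenvalue\<close>

text \<open>Barriers and potential depend on \<open>\<phi>\<close>, but the constant does not, so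
  the estimate survives the passage to the closure of the test fields.\<close>

lemma test_field_potential:
  fixes \<Omega> :: "(real^3) set"
  assumes \<Omega>: "open \<Omega>" "convex \<Omega>" "bounded \<Omega>" "\<Omega> \<noteq> {}" and "frame e f d"
    and width: "\<And>x y. x \<in> \<Omega> \<Longrightarrow> y \<in> \<Omega> \<Longrightarrow> \<bar>(x - y) \<bullet> e\<bar> \<le> w"
      "\<And>x y. x \<in> \<Omega> \<Longrightarrow> y \<in> \<Omega> \<Longrightarrow> \<bar>(x - y) \<bullet> f\<bar> \<le> w"
    and \<phi>: "\<phi> \<in> test_functions \<Omega>" and M: "\<And>t. step' t \<le> M"
  obtains \<psi> where "\<psi> \<in> test_functions \<Omega>"
    "(\<integral>\<^sup>+x. ennreal ((norm (\<phi> x - grad \<psi> x))\<^sup>2) \<partial>lborel)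
      \<le> ennreal ((17 * M\<^sup>2 + 4) * w\<^sup>2) * (\<integral>\<^sup>+x. ennreal ((norm (curl \<phi> x))\<^sup>2) \<partial>lborel)"
proof -
  interpret frame e f d by fact
  obtain x0 where x0: "x0 \<in> \<Omega>" using \<Omega>(4) by blast
  \<comment> \<open>The hull makes the set of columns convex; \<open>x0\<close> keeps
    \<open>K\<close> nonempty when \<open>\<phi>\<close> vanishes identically.\<close>
  define K where "K = convex hull (insert x0 (closure {x. \<phi> x \<noteq> 0}))"
  have sub: "insert x0 (closure {x. \<phi> x \<noteq> 0}) \<subseteq> \<Omega>"
    and comp: "compact (closure {x. \<phi> x \<noteq> 0})" and sm: "\<And>n. C_k n \<phi>"
    using \<phi> x0 by (auto simp: test_functions_def compact_support_in_def smooth_def)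
  have K: "compact K" "convex K" "K \<noteq> {}" "K \<subseteq> \<Omega>"
    using hull_minimal[where S=convex, OF sub \<Omega>(2)] comp unfolding K_def
    by (auto intro!: compact_convex_hull compact_insert)
  have off: "\<phi> x = 0" if "x \<notin> K" for x
  proof (rule ccontr)
    assume "\<phi> x \<noteq> 0"
    then have "x \<in> closure {x. \<phi> x \<noteq> 0}" using closure_subset[of "{x. \<phi> x \<noteq> 0}"] by blast
    then have "x \<in> K" unfolding K_def using hull_inc by (metis insertI2)
    with that show False ..
  qed
  obtain b Db where b: "\<And>n. C_k n b" "\<And>x. (b has_derivative Db x) (at x)"
    "\<And>x y. b y \<le> b x + Db x (y - x)" "\<And>x s. b (x + s *\<^sub>R e) = b x"
    "\<And>x. x \<in> K \<Longrightarrow> x \<bullet> e < b x" "\<And>x. x \<in> K \<Longrightarrow> x + (b x - x \<bullet> e) *\<^sub>R e \<in> \<Omega>"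
    by (rule upper_barrier[OF \<Omega>(1-3) norm_e K(1,3,4)], rule that)
  obtain a Da where a: "\<And>n. C_k n a" "\<And>x. (a has_derivative Da x) (at x)"
    "\<And>x y. a x + Da x (y - x) \<le> a y" "\<And>x s. a (x + s *\<^sub>R e) = a x"
    "\<And>x. x \<in> K \<Longrightarrow> a x < x \<bullet> e" "\<And>x. x \<in> K \<Longrightarrow> x + (a x - x \<bullet> e) *\<^sub>R e \<in> \<Omega>"
    by (rule lower_barrier[OF \<Omega>(1-3) norm_e K(1,3,4)], rule that)
  interpret cylinder e f d \<Omega> K \<phi> a b Da Db w
    by (rule cylinder.intro[OF frame_axioms], rule cylinder_axioms.intro)
      (rule \<Omega>(2) K width sm off a b; assumption)+
  show ?thesis
    using that[OF psi_test] residual_bound[OF M] by (simp add: u_def)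
qed

section \<open>Passage from test fields to the Maxwell space\<close>

lemma compact_support_integral:
  fixes F :: "real^3 \<Rightarrow> real"
  assumes "continuous_on UNIV F" "compact C" "C \<subseteq> \<Omega>" "\<And>x. x \<notin> C \<Longrightarrow> F x = 0" "open \<Omega>"
  shows "integrable (lebesgue_on \<Omega>) F" "(LINT x|lebesgue_on \<Omega>. F x) = (LINT x|lborel. F x)" "integrable lborel F"
proof -
  have eq: "(\<lambda>x. indicator C x *\<^sub>R F x) = F" "(\<lambda>x. indicator \<Omega> x *\<^sub>R F x) = F"
    using assms(3,4) by (fastforce simp: indicator_def)+
  show L: "integrable lborel F"
  proof -
    have "continuous_on C F" by (rule continuous_on_subset[OF assms(1)]) simp
    from borel_integrable_compact[OF assms(2) this] show ?thesis unfolding eq .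
  qed
  then have L': "integrable lebesgue F" by (simp add: integrable_completion)
  have S: "\<Omega> \<inter> space lebesgue \<in> sets lebesgue" using assms(5) by simp
  show "integrable (lebesgue_on \<Omega>) F"
    using integrable_restrict_space[OF S, of F] L' unfolding eq by simp
  show "(LINT x|lebesgue_on \<Omega>. F x) = (LINT x|lborel. F x)"
    using integral_restrict_space[OF S, of F] unfolding eq
    using L by (simp add: integral_completion)
qed

lemma compact_support_L2:
  fixes v :: "real^3 \<Rightarrow> real^3"
  assumes v: "continuous_on UNIV v" "compact C" "C \<subseteq> \<Omega>" "\<And>x. x \<notin> C \<Longrightarrow> v x = 0" "open \<Omega>"
  shows "v \<in> L2_fields \<Omega>" "ennreal (L2_norm_sq \<Omega> v) = (\<integral>\<^sup>+x. ennreal ((norm (v x))\<^sup>2) \<partial>lborel)"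
proof -
  have c: "continuous_on UNIV (\<lambda>x. (norm (v x))\<^sup>2)" by (intro continuous_intros v)
  note I = compact_support_integral[OF c v(2,3) _ v(5)]
  have "v \<in> borel_measurable (lebesgue_on \<Omega>)"
    by (intro measurable_restrict_space1 measurable_completion) (simp add: borel_measurable_continuous_onI v)
  then show "v \<in> L2_fields \<Omega>" unfolding L2_fields_def using I(1) v(4) by simp
  show "ennreal (L2_norm_sq \<Omega> v) = (\<integral>\<^sup>+x. ennreal ((norm (v x))\<^sup>2) \<partial>lborel)"
    unfolding L2_norm_sq_def using I(2,3) v(4)
    by (simp add: nn_integral_eq_integral)
qed

lemma L2_inner_integrable:
  assumes "u \<in> L2_fields \<Omega>" "v \<in> L2_fields \<Omega>"
  shows "integrable (lebesgue_on \<Omega>) (\<lambda>x. u x \<bullet> v x)"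
proof (rule Bochner_Integration.integrable_bound)
  show "integrable (lebesgue_on \<Omega>) (\<lambda>x. (norm (u x))\<^sup>2 + (norm (v x))\<^sup>2)"
    using assms by (auto simp: L2_fields_def)
  show "(\<lambda>x. u x \<bullet> v x) \<in> borel_measurable (lebesgue_on \<Omega>)"
    using assms by (auto simp: L2_fields_def)
  have "\<bar>x \<bullet> y\<bar> \<le> (norm x)\<^sup>2 + (norm y)\<^sup>2" for x y :: "real^3"
  proof -
    have "\<bar>x \<bullet> y\<bar> \<le> norm x * norm y" by (rule Cauchy_Schwarz_ineq2)
    also have "\<dots> \<le> 2 * norm x * norm y" by simp
    also have "\<dots> \<le> (norm x)\<^sup>2 + (norm y)\<^sup>2" by (rule sum_squares_bound)
    finally show ?thesis .
  qed
  then show "AE x in lebesgue_on \<Omega>. norm (u x \<bullet> v x) \<le> norm ((norm (u x))\<^sup>2 + (norm (v x))\<^sup>2)"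
    by simp
qed

lemma L2_diff:
  assumes "u \<in> L2_fields \<Omega>" "v \<in> L2_fields \<Omega>"
  shows "(\<lambda>x. u x - v x) \<in> L2_fields \<Omega>"
    and "L2_norm_sq \<Omega> (\<lambda>x. u x - v x) = L2_norm_sq \<Omega> u - 2 * (LINT x|lebesgue_on \<Omega>. u x \<bullet> v x) + L2_norm_sq \<Omega> v"
proof -
  have eq: "(norm (u x - v x))\<^sup>2 = (norm (u x))\<^sup>2 - 2 * (u x \<bullet> v x) + (norm (v x))\<^sup>2" for x
    by (simp add: power2_norm_eq_inner inner_diff_left inner_diff_right inner_commute)
  have I: "integrable (lebesgue_on \<Omega>) (\<lambda>x. (norm (u x))\<^sup>2)" "integrable (lebesgue_on \<Omega>) (\<lambda>x. (norm (v x))\<^sup>2)"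
    using assms by (auto simp: L2_fields_def)
  note J = L2_inner_integrable[OF assms]
  show "(\<lambda>x. u x - v x) \<in> L2_fields \<Omega>"
    using assms I J unfolding L2_fields_def mem_Collect_eq eq by auto
  show "L2_norm_sq \<Omega> (\<lambda>x. u x - v x) = L2_norm_sq \<Omega> u - 2 * (LINT x|lebesgue_on \<Omega>. u x \<bullet> v x) + L2_norm_sq \<Omega> v"
    unfolding L2_norm_sq_def eq using I J by simp
qed

lemma L2_norm_sq_nonneg: "L2_norm_sq \<Omega> u \<ge> 0"
  unfolding L2_norm_sq_def by simp

lemma L2_norm_sq_sum_le:
  assumes "u \<in> L2_fields \<Omega>" "v \<in> L2_fields \<Omega>" "\<And>x. s x = u x + v x \<or> s x = u x - v x" "s \<in> L2_fields \<Omega>"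
  shows "L2_norm_sq \<Omega> s \<le> 2 * L2_norm_sq \<Omega> u + 2 * L2_norm_sq \<Omega> v"
proof -
  have I: "integrable (lebesgue_on \<Omega>) (\<lambda>x. (norm (u x))\<^sup>2)" "integrable (lebesgue_on \<Omega>) (\<lambda>x. (norm (v x))\<^sup>2)"
    "integrable (lebesgue_on \<Omega>) (\<lambda>x. (norm (s x))\<^sup>2)"
    using assms by (auto simp: L2_fields_def)
  have pw: "(norm (s x))\<^sup>2 \<le> 2 * (norm (u x))\<^sup>2 + 2 * (norm (v x))\<^sup>2" for x
  proof -
    have "norm (s x) \<le> norm (u x) + norm (v x)"
      using assms(3)[of x] norm_triangle_ineq[of "u x" "v x"] norm_triangle_ineq4[of "u x" "v x"] by auto
    then have "(norm (s x))\<^sup>2 \<le> (norm (u x) + norm (v x))\<^sup>2" by (intro power_mono) auto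
    also have "\<dots> \<le> 2 * (norm (u x))\<^sup>2 + 2 * (norm (v x))\<^sup>2"
      using sum_squares_bound[of "norm (u x)" "norm (v x)"] by (simp add: power2_sum)
    finally show ?thesis .
  qed
  have "L2_norm_sq \<Omega> s \<le> (LINT x|lebesgue_on \<Omega>. 2 * (norm (u x))\<^sup>2 + 2 * (norm (v x))\<^sup>2)"
    unfolding L2_norm_sq_def using I pw by (intro integral_mono) auto
  also have "\<dots> = 2 * L2_norm_sq \<Omega> u + 2 * L2_norm_sq \<Omega> v"
    unfolding L2_norm_sq_def using I by simp
  finally show ?thesis .
qed

lemma continuous_on_curl:
  assumes "C_k (Suc n) \<phi>" shows "continuous_on UNIV (curl \<phi>)"
proof -
  have p: "continuous_on UNIV (partial i \<phi>)" for i
    using assms C_k_continuous by auto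
  have "continuous_on UNIV (\<lambda>x. \<chi> i. curl \<phi> x $ i)"
  proof (rule continuous_on_vec_lambda)
    fix i :: 3
    consider "i = 1" | "i = 2" | "i = 3" using exhaust_3 by blast
    then show "continuous_on UNIV (\<lambda>x. curl \<phi> x $ i)"
      by cases (auto simp: curl_def intro!: continuous_intros p)
  qed
  then show ?thesis by simp
qed

lemma curl_support: "x \<notin> closure {x. \<phi> x \<noteq> 0} \<Longrightarrow> curl \<phi> x = 0"
proof -
  assume x: "x \<notin> closure {x. \<phi> x \<noteq> 0}"
  have "partial i \<phi> x = 0" for i
    by (rule partial_vanishes(2)[of "- closure {x. \<phi> x \<noteq> 0}"])
      (use x closure_subset[of "{x. \<phi> x \<noteq> 0}"] in auto)
  then show ?thesis by (simp add: curl_def vec_eq_iff forall_3)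
qed

lemma grad_support: "x \<notin> closure {x. \<psi> x \<noteq> 0} \<Longrightarrow> grad \<psi> x = 0"
proof -
  assume x: "x \<notin> closure {x. \<psi> x \<noteq> 0}"
  have "partial i \<psi> x = 0" for i
    by (rule partial_vanishes(2)[of "- closure {x. \<psi> x \<noteq> 0}"])
      (use x closure_subset[of "{x. \<psi> x \<noteq> 0}"] in auto)
  then show ?thesis by (simp add: grad_def vec_eq_iff)
qed

text \<open>The passage between \<open>E\<close> and a nearby test field is made twice, once for the
  fields and once for the curls, each time at the cost of a factor 2; hence the 4. The potential
  changes with the accuracy \<open>\<eta>\<close>, the constant does not, so \<open>\<eta>\<close>
  may tend to 0.\<close>

lemma Maxwell_estimate:
  fixes \<Omega> :: "(real^3) set"
  assumes \<Omega>: "open \<Omega>" "convex \<Omega>" "bounded \<Omega>" "\<Omega> \<noteq> {}" and fr: "frame e f d"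
    and width: "\<And>x y. x \<in> \<Omega> \<Longrightarrow> y \<in> \<Omega> \<Longrightarrow> \<bar>(x - y) \<bullet> e\<bar> \<le> w"
      "\<And>x y. x \<in> \<Omega> \<Longrightarrow> y \<in> \<Omega> \<Longrightarrow> \<bar>(x - y) \<bullet> f\<bar> \<le> w"
    and M: "\<And>t. step' t \<le> M" and E: "E \<in> Maxwell_space \<Omega>" and W: "has_weak_curl \<Omega> E W"
  shows "L2_norm_sq \<Omega> E \<le> 4 * (17 * M\<^sup>2 + 4) * w\<^sup>2 * L2_norm_sq \<Omega> W"
proof -
  define k where "k = (17 * M\<^sup>2 + 4) * w\<^sup>2"
  have k: "k \<ge> 0" by (simp add: k_def)
  have E0: "E \<in> H0_curl \<Omega>" and div: "weakly_div_free \<Omega> E" using E by (auto simp: Maxwell_space_def)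
  have L2: "E \<in> L2_fields \<Omega>" "W \<in> L2_fields \<Omega>" using W by (auto simp: has_weak_curl_def)
  have est: "L2_norm_sq \<Omega> E \<le> 4 * k * L2_norm_sq \<Omega> W + (2 + 4 * k) * \<eta>" if \<eta>: "\<eta> > 0" for \<eta>
  proof -
    \<comment> \<open>\<open>H0_curl\<close> compares the squared graph norm with the square of its
      radius, so accuracy \<open>\<eta>\<close> calls for the radius
      \<open>sqrt \<eta>\<close>.\<close>
    have "sqrt \<eta> > 0" using \<eta> by simp
    then obtain \<phi> where \<phi>: "\<phi> \<in> test_functions \<Omega>"
      "L2_norm_sq \<Omega> (\<lambda>x. E x - \<phi> x) + L2_norm_sq \<Omega> (\<lambda>x. W x - curl \<phi> x) < (sqrt \<eta>)\<^sup>2"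
      using E0 W unfolding H0_curl_def by blast
    have \<phi>1: "L2_norm_sq \<Omega> (\<lambda>x. E x - \<phi> x) \<le> \<eta>" and \<phi>2: "L2_norm_sq \<Omega> (\<lambda>x. W x - curl \<phi> x) \<le> \<eta>"
      using \<phi>(2) \<eta> L2_norm_sq_nonneg[of \<Omega> "\<lambda>x. E x - \<phi> x"] L2_norm_sq_nonneg[of \<Omega> "\<lambda>x. W x - curl \<phi> x"] by auto
    obtain \<psi> where \<psi>: "\<psi> \<in> test_functions \<Omega>"
      "(\<integral>\<^sup>+x. ennreal ((norm (\<phi> x - grad \<psi> x))\<^sup>2) \<partial>lborel)
        \<le> ennreal k * (\<integral>\<^sup>+x. ennreal ((norm (curl \<phi> x))\<^sup>2) \<partial>lborel)"
      using test_field_potential[OF \<Omega> fr width \<phi>(1) M] unfolding k_def by blast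
    define C where "C = closure {x. \<phi> x \<noteq> 0} \<union> closure {x. \<psi> x \<noteq> 0}"
    have C: "compact C" "C \<subseteq> \<Omega>"
      using \<phi>(1) \<psi>(1) by (auto simp: C_def test_functions_def compact_support_in_def)
    have off: "\<phi> x = 0" "curl \<phi> x = 0" "grad \<psi> x = 0" if "x \<notin> C" for x
      using that closure_subset[of "{x. \<phi> x \<noteq> 0}"] curl_support[of x \<phi>] grad_support[of x \<psi>]
      unfolding C_def by auto
    have sm: "\<And>n. C_k n \<phi>" "\<And>n. C_k n \<psi>"
      using \<phi>(1) \<psi>(1) by (auto simp: test_functions_def smooth_def)
    have cont: "continuous_on UNIV \<phi>" "continuous_on UNIV (curl \<phi>)" "continuous_on UNIV (grad \<psi>)"
    proof -
      show "continuous_on UNIV \<phi>" by (rule C_k_continuous[OF sm(1)])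
      show "continuous_on UNIV (curl \<phi>)" by (rule continuous_on_curl[OF sm(1)])
      show "continuous_on UNIV (grad \<psi>)"
        unfolding grad_def[abs_def] using sm(2)[of "Suc 0"] by (intro continuous_on_vec_lambda) auto
    qed
    have cL2: "\<phi> \<in> L2_fields \<Omega>" "curl \<phi> \<in> L2_fields \<Omega>" "grad \<psi> \<in> L2_fields \<Omega>"
      using compact_support_L2(1)[OF _ C _ \<Omega>(1)] cont off by blast+
    have "ennreal (L2_norm_sq \<Omega> (\<lambda>x. \<phi> x - grad \<psi> x)) \<le> ennreal k * ennreal (L2_norm_sq \<Omega> (curl \<phi>))"
      using \<psi>(2) compact_support_L2(2)[OF _ C _ \<Omega>(1), of "\<lambda>x. \<phi> x - grad \<psi> x"]
        compact_support_L2(2)[OF _ C _ \<Omega>(1), of "curl \<phi>"] cont off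
      by (simp add: continuous_on_diff)
    then have 1: "L2_norm_sq \<Omega> (\<lambda>x. \<phi> x - grad \<psi> x) \<le> k * L2_norm_sq \<Omega> (curl \<phi>)"
      using k L2_norm_sq_nonneg by (simp add: ennreal_mult[symmetric])
    have 2: "L2_norm_sq \<Omega> (curl \<phi>) \<le> 2 * L2_norm_sq \<Omega> W + 2 * L2_norm_sq \<Omega> (\<lambda>x. W x - curl \<phi> x)"
      by (intro L2_norm_sq_sum_le L2_diff L2 cL2) simp
    have 3: "L2_norm_sq \<Omega> (\<lambda>x. E x - grad \<psi> x)
        \<le> 2 * L2_norm_sq \<Omega> (\<lambda>x. E x - \<phi> x) + 2 * L2_norm_sq \<Omega> (\<lambda>x. \<phi> x - grad \<psi> x)"
      by (intro L2_norm_sq_sum_le L2_diff L2 cL2) simp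
    have "(LINT x|lebesgue_on \<Omega>. E x \<bullet> grad \<psi> x) = 0"
      using div \<psi>(1) by (simp add: weakly_div_free_def)
    then have "L2_norm_sq \<Omega> E \<le> L2_norm_sq \<Omega> (\<lambda>x. E x - grad \<psi> x)"
      using L2_diff(2)[OF L2(1) cL2(3)] L2_norm_sq_nonneg[of \<Omega> "grad \<psi>"] by simp
    also have "\<dots> \<le> 2 * \<eta> + 2 * (k * (2 * L2_norm_sq \<Omega> W + 2 * \<eta>))"
    proof -
      have "k * L2_norm_sq \<Omega> (curl \<phi>) \<le> k * (2 * L2_norm_sq \<Omega> W + 2 * \<eta>)"
        using 2 \<phi>2 k by (intro mult_left_mono) auto
      then show ?thesis using 1 3 \<phi>1 by linarith
    qed
    finally show ?thesis by (simp add: algebra_simps)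
  qed
  have "L2_norm_sq \<Omega> E \<le> 4 * k * L2_norm_sq \<Omega> W"
  proof (rule field_le_epsilon)
    fix \<delta> :: real assume "\<delta> > 0"
    then have "\<delta> / (2 + 4 * k) > 0" using k by (simp add: add_pos_nonneg)
    from est[OF this] show "L2_norm_sq \<Omega> E \<le> 4 * k * L2_norm_sq \<Omega> W + \<delta>"
      using k by (simp add: add_pos_nonneg)
  qed
  then show ?thesis by (simp only: k_def mult.assoc)
qed

lemma lambda1_Max_lower_bound:
  fixes \<Omega> :: "(real^3) set"
  assumes \<Omega>: "open \<Omega>" "convex \<Omega>" "bounded \<Omega>" "\<Omega> \<noteq> {}" and fr: "frame e f d"
    and width: "\<And>x y. x \<in> \<Omega> \<Longrightarrow> y \<in> \<Omega> \<Longrightarrow> \<bar>(x - y) \<bullet> e\<bar> \<le> w"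
      "\<And>x y. x \<in> \<Omega> \<Longrightarrow> y \<in> \<Omega> \<Longrightarrow> \<bar>(x - y) \<bullet> f\<bar> \<le> w"
    and M: "\<And>t. step' t \<le> M" and w: "w > 0"
  shows "ereal (1 / (4 * (17 * M\<^sup>2 + 4) * w\<^sup>2)) \<le> lambda1_Max \<Omega>"
  unfolding lambda1_Max_def
proof (rule INF_greatest)
  fix q assume "q \<in> Maxwell_quotients \<Omega>"
  then obtain E W where q: "q = L2_norm_sq \<Omega> W / L2_norm_sq \<Omega> E" and E: "E \<in> Maxwell_space \<Omega>"
    and W: "has_weak_curl \<Omega> E W" and nz: "\<not> (AE x in lebesgue_on \<Omega>. E x = 0)"
    by (auto simp: Maxwell_quotients_def)
  define k where "k = 4 * (17 * M\<^sup>2 + 4) * w\<^sup>2"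
  have k: "k > 0" using w by (simp add: k_def add_nonneg_pos)
  have "integrable (lebesgue_on \<Omega>) (\<lambda>x. (norm (E x))\<^sup>2)"
    using W by (auto simp: has_weak_curl_def L2_fields_def)
  \<comment> \<open>A nonnegative function with integral 0 vanishes almost everywhere, which
    \<open>nz\<close> excludes; so the quotient is a genuine one.\<close>
  then have "L2_norm_sq \<Omega> E \<noteq> 0"
    using nz unfolding L2_norm_sq_def by (subst integral_nonneg_eq_0_iff_AE) auto
  then have pos: "L2_norm_sq \<Omega> E > 0" using L2_norm_sq_nonneg[of \<Omega> E] by simp
  have "L2_norm_sq \<Omega> E \<le> k * L2_norm_sq \<Omega> W"
    unfolding k_def by (rule Maxwell_estimate[OF \<Omega> fr width M E W])
  then have "1 / k \<le> q" using k pos unfolding q by (simp add: field_simps)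
  then show "ereal (1 / (4 * (17 * M\<^sup>2 + 4) * w\<^sup>2)) \<le> ereal q" unfolding k_def by simp
qed

section \<open>Lower bound for the perimeter\<close>

lemma C_k_inner_self: "C_k n (\<lambda>x::real^3. x \<bullet> x)"
proof -
  have "C_k n (\<lambda>x::real^3. \<Sum>i\<in>UNIV. x $ i * x $ i)"
    by (intro C_k_sum C_k_mult C_k_linear bounded_linear_vec_nth)
  then show ?thesis by (simp add: inner_vec_def)
qed

context frame
begin

text \<open>The rectangle is the base of a slab of height \<eta> inside \<Omega>. The competing
  field points along \<open>e\<close> and grows from 0 to 1 across the slab; on \<Omega> its
  divergence is nonnegative, and it integrates to 1 along each line crossing the slab. The integral
  is thus at least the area of the base, however thin the slab.\<close>

lemma perimeter_ge_rectangle_area: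
  fixes \<Omega> :: "(real^3) set"
  assumes \<Omega>: "open \<Omega>" "bounded \<Omega>" and pos: "\<eta> > 0" "A \<ge> 0" "B \<ge> 0"
    and box: "\<And>s t r. s \<in> {s0..s0 + \<eta>} \<Longrightarrow> t \<in> {t0..t0 + A} \<Longrightarrow> r \<in> {r0..r0 + B} \<Longrightarrow> pt s t r \<in> \<Omega>"
  shows "ereal (A * B) \<le> perimeter \<Omega>"
proof -
  obtain N where N: "\<And>x. x \<in> \<Omega> \<Longrightarrow> norm x \<le> N" using \<Omega>(2) by (auto simp: bounded_iff)
  define z where "z x = (e \<bullet> x - s0) / \<eta>" for x
  \<comment> \<open>\<open>y \<ge> 1\<close> on \<Omega>, so \<open>step (y x)\<close> is 1 with
    derivative 0 there and leaves the divergence alone; beyond radius \<open>sqrt (N^2 + 1)\<close>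
    it vanishes, which gives compact support.\<close>
  define y where "y x = N\<^sup>2 + 1 - x \<bullet> x" for x :: "real^3"
  define F where "F x = (step (z x) * step (y x)) *\<^sub>R e" for x
  have Cz: "C_k n z" for n
    unfolding z_def[abs_def] using pos(1)
    by (intro C_k_divide C_k_diff C_k_inner_right C_k_const) simp
  have Cy: "C_k n y" for n
    unfolding y_def[abs_def] by (intro C_k_diff C_k_inner_self C_k_const)
  have CF: "C_k 1 F"
    unfolding F_def[abs_def] by (intro C_k_scaleR C_k_mult C_k_step Cz Cy C_k_const)
  have "{x. F x \<noteq> 0} \<subseteq> cball 0 (sqrt (N\<^sup>2 + 1))"
  proof
    fix x assume "x \<in> {x. F x \<noteq> 0}"
    then have "step (y x) \<noteq> 0" by (auto simp: F_def)
    then have "y x > 0" using step_eq_0 not_le by blast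
    then have "(norm x)\<^sup>2 \<le> N\<^sup>2 + 1" by (simp add: y_def power2_norm_eq_inner)
    then show "x \<in> cball 0 (sqrt (N\<^sup>2 + 1))" by (simp add: real_le_rsqrt)
  qed
  then have "bounded {x. F x \<noteq> 0}" using bounded_cball bounded_subset by blast
  then have supp: "compact_support_in UNIV F" by (simp add: compact_support_in_def)
  have norm: "norm (F x) \<le> 1" for x
    unfolding F_def using step_bounds[of "z x"] step_bounds[of "y x"]
    by (simp add: norm_e abs_mult mult_le_one)
  define D where "D x = step' (z x) / \<eta>" for x
  have D0: "D x \<ge> 0" for x unfolding D_def using pos step'_nonneg by simp
  have div: "divergence F x = D x" if x: "x \<in> \<Omega>" for x
  proof -
    have "x \<bullet> x \<le> N\<^sup>2" using N[OF x] by (metis dot_square_norm norm_ge_zero power_mono)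
    then have y: "y x \<ge> 1" by (simp add: y_def)
    have "(z has_derivative (\<lambda>h. (e \<bullet> h) / \<eta>)) (at x)"
      unfolding z_def[abs_def] using pos(1) by (auto intro!: derivative_eq_intros)
    from has_derivative_compose[OF this step_DERIV[unfolded has_field_derivative_def]]
    have 1: "((\<lambda>x. step (z x)) has_derivative (\<lambda>h. step' (z x) * ((e \<bullet> h) / \<eta>))) (at x)" .
    from has_derivative_compose[OF C_k_has_derivative[OF Cy[of "Suc 0"]] step_DERIV[unfolded has_field_derivative_def]]
    have 2: "((\<lambda>x. step (y x)) has_derivative (\<lambda>h. step' (y x) * frechet_derivative y (at x) h)) (at x)" .
    have "(F has_derivative (\<lambda>h. (step (z x) * (step' (y x) * frechet_derivative y (at x) h)
        + step' (z x) * ((e \<bullet> h) / \<eta>) * step (y x)) *\<^sub>R e)) (at x)"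
      unfolding F_def[abs_def]
      by (rule bounded_linear.has_derivative[OF bounded_linear_scaleR_left has_derivative_mult[OF 1 2]])
    from partial_eq[OF this] have "partial i F x = (D x * e $ i) *\<^sub>R e" for i
      using y by (simp add: step'_outside step_eq_1 D_def inner_axis)
    then have "divergence F x = (\<Sum>i\<in>UNIV. D x * (e $ i * e $ i))" by (simp add: divergence_def mult_ac)
    also have "\<dots> = D x * (e \<bullet> e)" by (simp add: inner_vec_def sum_distrib_left)
    finally show ?thesis by simp
  qed
  have cD: "continuous_on UNIV D"
    unfolding D_def[abs_def] using pos(1)
    by (intro continuous_intros continuous_on_compose2[OF continuous_on_step'[of UNIV]] C_k_continuous[OF Cz]) auto
  have meas [measurable]: "D \<in> borel_measurable borel" "\<Omega> \<in> sets borel"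
    using borel_measurable_continuous_onI[OF cD] \<Omega>(1) by auto
  have mI: "(\<lambda>x. indicator \<Omega> x *\<^sub>R D x) \<in> borel_measurable borel"
    using meas by (intro borel_measurable_scaleR borel_measurable_indicator) simp_all
  obtain M where M: "\<And>t. step' t \<le> M" using step'_bounded by blast
  have int: "integrable lborel (\<lambda>x. indicator \<Omega> x *\<^sub>R D x)"
  proof (rule Bochner_Integration.integrable_bound)
    have "emeasure lborel \<Omega> < \<infinity>" using \<Omega>(2) by (rule emeasure_bounded_finite)
    then show "integrable lborel (\<lambda>x. indicator \<Omega> x *\<^sub>R (M / \<eta>))" using \<Omega>(1) by simp
    have "\<bar>D x\<bar> \<le> \<bar>M / \<eta>\<bar>" for x
    proof -
      have "D x \<le> M / \<eta>" using M[of "z x"] pos(1) by (simp add: D_def divide_right_mono)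
      then show ?thesis using D0[of x] by linarith
    qed
    then have "norm (indicator \<Omega> x *\<^sub>R D x) \<le> norm (indicator \<Omega> x *\<^sub>R (M / \<eta>))" for x
      by (cases "x \<in> \<Omega>") simp_all
    then show "AE x in lborel. norm (indicator \<Omega> x *\<^sub>R D x) \<le> norm (indicator \<Omega> x *\<^sub>R (M / \<eta>))"
      by simp
    show "(\<lambda>x. indicator \<Omega> x *\<^sub>R D x) \<in> borel_measurable lborel" using mI by simp
  qed
  have S: "\<Omega> \<inter> space lebesgue \<in> sets lebesgue" using \<Omega>(1) by simp
  have "(LINT x|lebesgue_on \<Omega>. divergence F x) = (LINT x|lebesgue_on \<Omega>. D x)"
    by (intro Bochner_Integration.integral_cong) (auto simp: div space_restrict_space)
  also have "\<dots> = (LINT x|lborel. indicator \<Omega> x *\<^sub>R D x)"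
    using integral_restrict_space[OF S, of D] int by (simp add: integral_completion)
  finally have L: "(LINT x|lebesgue_on \<Omega>. divergence F x) = (LINT x|lborel. indicator \<Omega> x *\<^sub>R D x)" .
  let ?Q = "{t0..t0 + A} \<times> {r0..r0 + B}"
  \<comment> \<open>Fundamental theorem of calculus across the slab, from \<open>step 0 = 0\<close>
    to \<open>step 1 = 1\<close>.\<close>
  have one: "(\<integral>\<^sup>+s. ennreal (D (pt s t r)) * indicator {s0..s0 + \<eta>} s \<partial>lborel) = 1" for t r
  proof -
    have zp: "z (pt s t r) = (s - s0) / \<eta>" for s
      using pt_inner(1)[of s t r] by (simp add: z_def inner_commute)
    have "((\<lambda>s. step ((s - s0) / \<eta>)) has_real_derivative step' ((s - s0) / \<eta>) * (1 / \<eta>)) (at s)" for s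
      by (rule DERIV_chain2[OF step_DERIV]) (use pos(1) in \<open>auto intro!: derivative_eq_intros\<close>)
    moreover have "continuous_on UNIV (\<lambda>s. step' ((s - s0) / \<eta>) / \<eta>)"
      using pos(1) by (intro continuous_intros continuous_on_compose2[OF continuous_on_step'[of UNIV]]) auto
    ultimately have "(\<integral>\<^sup>+s. ennreal (D (pt s t r)) * indicator {s0..s0 + \<eta>} s \<partial>lborel)
        = ennreal (step ((s0 + \<eta> - s0) / \<eta>) - step ((s0 - s0) / \<eta>))"
      using pos(1) D0 step'_nonneg
      by (intro nn_integral_FTC_Icc) (auto simp: D_def zp intro: has_field_derivative_at_within borel_measurable_continuous_onI)
    then show ?thesis using pos(1) by (simp add: step_eq_0 step_eq_1)
  qed
  have "ennreal (A * B) = (\<integral>\<^sup>+q. indicator ?Q q \<partial>lborel)"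
  proof -
    have "(\<integral>\<^sup>+q. indicator ?Q q \<partial>lborel) = emeasure lborel ?Q"
      by (rule nn_integral_indicator) (simp add: borel_closed closed_Times)
    also have "\<dots> = emeasure (lborel \<Otimes>\<^sub>M lborel) ?Q" by (simp only: lborel_prod)
    also have "\<dots> = ennreal (A * B)"
      using pos by (simp add: lborel.emeasure_pair_measure_Times ennreal_mult)
    finally show ?thesis by simp
  qed
  also have "\<dots> = (\<integral>\<^sup>+q. (\<integral>\<^sup>+s. indicator ?Q q * (ennreal (D (pt s (fst q) (snd q))) * indicator {s0..s0 + \<eta>} s) \<partial>lborel) \<partial>lborel)"
    by (intro nn_integral_cong) (simp add: nn_integral_cmult one)
  \<comment> \<open>What \<Omega> contributes outside the slab is nonnegative.\<close>
  also have "\<dots> \<le> (\<integral>\<^sup>+q. (\<integral>\<^sup>+s. ennreal (indicator \<Omega> (pt s (fst q) (snd q)) *\<^sub>R D (pt s (fst q) (snd q))) \<partial>lborel) \<partial>lborel)"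
    using box by (intro nn_integral_mono) (auto simp: indicator_def)
  also have "\<dots> = (\<integral>\<^sup>+x. ennreal (indicator \<Omega> x *\<^sub>R D x) \<partial>lborel)"
    by (rule nn_integral_frame[symmetric]) (use mI in simp)
  also have "\<dots> = ennreal (LINT x|lborel. indicator \<Omega> x *\<^sub>R D x)"
    using int D0 by (intro nn_integral_eq_integral) auto
  finally have "A * B \<le> (LINT x|lebesgue_on \<Omega>. divergence F x)"
    unfolding L using pos D0 by (subst (asm) ennreal_le_iff) (auto intro!: integral_nonneg_AE)
  also have "ereal \<dots> \<le> perimeter \<Omega>"
    unfolding perimeter_def using CF supp norm by (intro SUP_upper) auto
  finally show ?thesis by simp
qed

end

text \<open>Otherwise all of the open set lies on one line through \<open>p\<close>, and small
  displacements show every unit vector to be a multiple of \<open>d\<close>; two orthogonal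
  coordinate vectors cannot both be.\<close>

lemma orthogonal_component_nonzero:
  fixes \<Omega> :: "(real^3) set"
  assumes "open \<Omega>" "\<Omega> \<noteq> {}"
  obtains x where "x \<in> \<Omega>" "(x - p) - ((x - p) \<bullet> d) *\<^sub>R d \<noteq> 0"
proof -
  have "\<exists>x\<in>\<Omega>. (x - p) - ((x - p) \<bullet> d) *\<^sub>R d \<noteq> 0"
  proof (rule ccontr)
    assume "\<not> ?thesis"
    then have z: "\<And>x. x \<in> \<Omega> \<Longrightarrow> (x - p) - ((x - p) \<bullet> d) *\<^sub>R d = 0" by blast
    obtain x where x1: "x \<in> \<Omega>" using assms(2) by blast
    obtain r where "r > 0" "ball x r \<subseteq> \<Omega>" using openE[OF assms(1) x1] by blast
    note x = x1 this
    have h: "h = (h \<bullet> d) *\<^sub>R d" if "norm h = 1" for h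
    proof -
      have "dist x (x + (r/2) *\<^sub>R h) < r" using that x(2) by (simp add: dist_norm)
      then have "x + (r/2) *\<^sub>R h \<in> \<Omega>" using x(3) by auto
      from z[OF this] have "(x - p + (r/2) *\<^sub>R h) - ((x - p + (r/2) *\<^sub>R h) \<bullet> d) *\<^sub>R d = 0"
        by (simp only: diff_add_eq)
      moreover have "(y + k *\<^sub>R h) - ((y + k *\<^sub>R h) \<bullet> d) *\<^sub>R d
          = (y - (y \<bullet> d) *\<^sub>R d) + k *\<^sub>R (h - (h \<bullet> d) *\<^sub>R d)" for y k
        by (simp add: inner_add_left scaleR_add_left scaleR_diff_right)
      ultimately have "(r/2) *\<^sub>R (h - (h \<bullet> d) *\<^sub>R d) = 0" using z[OF x(1)] by simp
      then show ?thesis using x(2) by simp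
    qed
    have 1: "axis 1 1 = ((axis 1 1 :: real^3) \<bullet> d) *\<^sub>R d" "axis 2 1 = ((axis 2 1 :: real^3) \<bullet> d) *\<^sub>R d"
      by (intro h norm_axis_1)+
    have "(axis 1 1 :: real^3) \<bullet> axis 2 1 = 0" by (simp add: inner_axis_axis)
    moreover have "(axis 1 1 :: real^3) \<bullet> axis 2 1 = (axis 1 1 \<bullet> d) * (d \<bullet> axis 2 1)"
      using arg_cong[OF 1(1), of "\<lambda>v. v \<bullet> axis 2 1"] by simp
    ultimately have "(axis 1 1 :: real^3) \<bullet> d = 0 \<or> (axis 2 1 :: real^3) \<bullet> d = 0"
      by (simp add: inner_commute)
    then have "axis 1 1 = (0 :: real^3) \<or> axis 2 1 = (0 :: real^3)"
      using 1 by (metis scaleR_zero_left)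
    then show False by (metis norm_axis_1 norm_zero zero_neq_one)
  qed
  then show ?thesis using that by blast
qed

text \<open>256 is 16 times 16: the perimeter is at least \<epsilon>/16, the area of a rectangle
  with sides \<epsilon>/4 and 1/4, and the eigenvalue bound with width 2\<epsilon> has the factor
  \<open>4 * (2 * \<epsilon>)^2\<close> in its denominator.\<close>

lemma J_Per_lower_bound:
  fixes \<Omega> :: "(real^3) set"
  assumes \<Omega>: "\<Omega> \<noteq> {}" "bounded \<Omega>" "open \<Omega>" "convex \<Omega>" "diameter \<Omega> = 1"
    and M: "\<And>t. step' t \<le> M"
  obtains p q x where "p \<in> closure \<Omega>" "q \<in> closure \<Omega>" "x \<in> closure \<Omega>" "dist p q = 1"
    "norm ((x - p) - ((x - p) \<bullet> (q - p)) *\<^sub>R (q - p)) > 0"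
    "ereal (1 / (256 * (17 * M\<^sup>2 + 4) * norm ((x - p) - ((x - p) \<bullet> (q - p)) *\<^sub>R (q - p)))) \<le> J_Per \<Omega>"
proof -
  have cl: "compact (closure \<Omega>)" "closure \<Omega> \<noteq> {}" "convex (closure \<Omega>)"
    using \<Omega> by (auto simp: convex_closure)
  obtain p q where pq: "p \<in> closure \<Omega>" "q \<in> closure \<Omega>" "dist p q = 1"
    using diameter_compact_attained[OF cl(1,2)] \<Omega>(2,5) by (auto simp: diameter_closure)
  have dist1: "dist a b \<le> 1" if "a \<in> closure \<Omega>" "b \<in> closure \<Omega>" for a b
    using diameter_bounded_bound[OF compact_imp_bounded[OF cl(1)] that] \<Omega>(2,5) by (simp add: diameter_closure)
  define d where "d = q - p"
  have d: "norm d = 1" using pq(3) by (simp add: d_def dist_norm norm_minus_commute)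
  have dd: "d \<bullet> d = 1" using d by (simp add: dot_square_norm)
  define P where "P x = (x - p) - ((x - p) \<bullet> d) *\<^sub>R d" for x
  have "continuous_on (closure \<Omega>) (\<lambda>x. norm (P x))" unfolding P_def by (intro continuous_intros)
  then obtain x where x: "x \<in> closure \<Omega>" "\<And>y. y \<in> closure \<Omega> \<Longrightarrow> norm (P y) \<le> norm (P x)"
    using continuous_attains_sup[OF cl(1,2)] by blast
  define \<epsilon> where "\<epsilon> = norm (P x)"
  have \<epsilon>: "\<epsilon> > 0"
  proof -
    obtain y where "y \<in> \<Omega>" "P y \<noteq> 0"
      unfolding P_def by (rule orthogonal_component_nonzero[OF \<Omega>(3,1)])
    then show ?thesis using x(2)[of y] closure_subset[of \<Omega>] unfolding \<epsilon>_def
      by (metis less_le_trans subsetD zero_less_norm_iff)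
  qed
  define f where "f = (1 / \<epsilon>) *\<^sub>R P x"
  define e where "e = cross3 f d"
  have Pd: "P y \<bullet> d = 0" for y by (simp add: P_def inner_diff_left dd)
  have fr: "frame e f d"
  proof
    show f: "norm f = 1" using \<epsilon> by (simp add: f_def \<epsilon>_def)
    show fd: "f \<bullet> d = 0" by (simp add: f_def Pd)
    show "norm d = 1" by (rule d)
    have "(norm e)\<^sup>2 = 1" unfolding e_def norm_cross using f d fd by simp
    then show "norm e = 1" by (metis norm_ge_zero one_power2 power2_eq_imp_eq zero_le_one)
    show "e \<bullet> f = 0" "e \<bullet> d = 0" unfolding e_def by (simp_all add: dot_cross_self)
  qed
  interpret frame e f d by (rule fr)
  have half: "\<bar>(y - p) \<bullet> h\<bar> \<le> \<epsilon>" if "y \<in> \<Omega>" "norm h = 1" "h \<bullet> d = 0" for y h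
  proof -
    have "(y - p) \<bullet> h = P y \<bullet> h" using that(3) by (simp only: P_def inner_diff_left inner_scaleR_left inner_commute[of d h])
    also have "\<bar>\<dots>\<bar> \<le> norm (P y) * norm h" by (rule Cauchy_Schwarz_ineq2)
    also have "\<dots> \<le> \<epsilon>" using x(2)[of y] that closure_subset[of \<Omega>] by (auto simp: \<epsilon>_def)
    finally show ?thesis .
  qed
  \<comment> \<open>By the choice of \<open>x\<close>, all of \<Omega> is within \<epsilon> of the
    line through \<open>p\<close> and \<open>q\<close>, on either side of it.\<close>
  have width: "\<bar>(y - z) \<bullet> h\<bar> \<le> 2 * \<epsilon>" if "y \<in> \<Omega>" "z \<in> \<Omega>" "norm h = 1" "h \<bullet> d = 0" for y z h
  proof -
    have "(y - z) \<bullet> h = (y - p) \<bullet> h - (z - p) \<bullet> h" by (simp add: inner_diff_left)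
    then show ?thesis using half[OF that(1,3,4)] half[OF that(2,3,4)] by linarith
  qed
  have lam: "ereal (1 / (4 * (17 * M\<^sup>2 + 4) * (2 * \<epsilon>)\<^sup>2)) \<le> lambda1_Max \<Omega>"
    using \<epsilon> by (intro lambda1_Max_lower_bound[OF \<Omega>(3,4,2,1) fr _ _ M] width norm_e norm_f ed fd) auto
  \<comment> \<open>The position of the foot of \<open>x\<close> on the diameter; it falls between
    \<open>p\<close> and \<open>q\<close> because both have distance at most 1 from
    \<open>x\<close>.\<close>
  define \<rho> where "\<rho> = (x - p) \<bullet> d"
  have \<rho>: "0 \<le> \<rho>" "\<rho> \<le> 1"
  proof -
    have "\<bar>(x - p) \<bullet> d\<bar> \<le> 1" "\<bar>(x - q) \<bullet> d\<bar> \<le> 1"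
      using Cauchy_Schwarz_ineq2[of "x - p" d] Cauchy_Schwarz_ineq2[of "x - q" d] d
        dist1[OF x(1) pq(1)] dist1[OF x(1) pq(2)] by (auto simp: dist_norm)
    moreover have "(x - q) \<bullet> d = \<rho> - 1"
    proof -
      have "x - q = (x - p) - d" by (simp add: d_def)
      then show ?thesis by (simp only: \<rho>_def inner_diff_left dd)
    qed
    ultimately show "0 \<le> \<rho>" "\<rho> \<le> 1" by (auto simp: \<rho>_def)
  qed
  have xe: "x = p + \<rho> *\<^sub>R d + \<epsilon> *\<^sub>R f"
    using \<epsilon> by (simp add: f_def P_def \<rho>_def)
  have seg: "p + \<sigma> *\<^sub>R d \<in> closure \<Omega>" if "0 \<le> \<sigma>" "\<sigma> \<le> 1" for \<sigma>
    using convexD[OF cl(3) pq(1,2), of "1 - \<sigma>" \<sigma>] that by (simp add: d_def algebra_simps)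
  \<comment> \<open>At height \<epsilon>/2 the segment joining the midpoints of two sides of the
    triangle runs from \<rho>/2 to \<rho>/2 + 1/2, and the rectangle below it is inside the
    triangle. \<open>\<theta>\<close> interpolates between the base and this segment;
    \<open>\<sigma>\<close> is the point of the base whose midpoint with \<open>x\<close> is
    used.\<close>
  have rect: "p + t *\<^sub>R f + r *\<^sub>R d \<in> closure \<Omega>" if "t \<in> {0..\<epsilon>/2}" "r \<in> {\<rho>/2..\<rho>/2 + 1/2}" for t r
  proof -
    define \<theta> where "\<theta> = 2 * t / \<epsilon>"
    have \<theta>: "0 \<le> \<theta>" "\<theta> \<le> 1" "t = \<theta> * (\<epsilon> / 2)" using that \<epsilon> by (auto simp: \<theta>_def field_simps)
    define \<sigma> where "\<sigma> = 2 * r - \<rho>"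
    have \<sigma>: "0 \<le> \<sigma>" "\<sigma> \<le> 1" "r = \<rho> / 2 + \<sigma> / 2" using that by (auto simp: \<sigma>_def field_simps)
    have 1: "(1/2) *\<^sub>R x + (1/2) *\<^sub>R (p + \<sigma> *\<^sub>R d) \<in> closure \<Omega>"
      by (intro convexD[OF cl(3) x(1) seg]) (use \<sigma> in auto)
    have 2: "p + r *\<^sub>R d \<in> closure \<Omega>" using \<sigma> \<rho> by (intro seg) auto
    have "(1 - \<theta>) *\<^sub>R (p + r *\<^sub>R d) + \<theta> *\<^sub>R ((1/2) *\<^sub>R x + (1/2) *\<^sub>R (p + \<sigma> *\<^sub>R d)) \<in> closure \<Omega>"
      by (intro convexD[OF cl(3) 2 1]) (use \<theta> in auto)
    also have "(1/2) *\<^sub>R x + (1/2) *\<^sub>R (p + \<sigma> *\<^sub>R d) = p + (\<epsilon> / 2) *\<^sub>R f + r *\<^sub>R d"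
    proof -
      have "p = (1/2) *\<^sub>R p + (1/2) *\<^sub>R p" by (simp flip: scaleR_left_distrib)
      then show ?thesis unfolding \<sigma>(3) xe by (simp add: algebra_simps)
    qed
    also have "(1 - \<theta>) *\<^sub>R (p + r *\<^sub>R d) + \<theta> *\<^sub>R (p + (\<epsilon> / 2) *\<^sub>R f + r *\<^sub>R d) = p + t *\<^sub>R f + r *\<^sub>R d"
      unfolding \<theta>(3) by (simp add: algebra_simps)
    finally show ?thesis .
  qed
  obtain c where c: "c \<in> \<Omega>" using \<Omega>(1) by blast
  \<comment> \<open>Halving towards the point \<open>c\<close> of \<Omega> moves the rectangle from
    the closure into \<Omega> itself, at the price of half of each side.\<close>
  define m where "m = (1/2) *\<^sub>R c + (1/2) *\<^sub>R p"
  define Q where "Q = (\<lambda>(t, r). m + t *\<^sub>R f + r *\<^sub>R d) ` ({0..\<epsilon>/4} \<times> {\<rho>/4..\<rho>/4 + 1/4})"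
  have "compact Q" unfolding Q_def case_prod_unfold
    by (intro compact_continuous_image compact_Times compact_Icc continuous_intros)
  moreover have "Q \<subseteq> \<Omega>"
  proof
    fix z assume "z \<in> Q"
    then obtain t r where t: "t \<in> {0..\<epsilon>/4}" "r \<in> {\<rho>/4..\<rho>/4 + 1/4}" "z = m + t *\<^sub>R f + r *\<^sub>R d"
      by (auto simp: Q_def)
    let ?y = "p + (2 * t) *\<^sub>R f + (2 * r) *\<^sub>R d"
    have "?y \<in> closure \<Omega>" using t by (intro rect) auto
    then have "?y - (1/2) *\<^sub>R (?y - c) \<in> interior \<Omega>"
      using \<Omega>(3,4) c by (intro mem_interior_closure_convex_shrink) (auto simp: interior_open)
    moreover have "?y - (1/2) *\<^sub>R (?y - c) = z"
      unfolding t(3) m_def by (simp add: vec_eq_iff field_simps)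
    ultimately show "z \<in> \<Omega>" using \<Omega>(3) by (simp add: interior_open)
  qed
  \<comment> \<open>A neighbourhood of the compact rectangle remains in \<Omega> and provides the
    height of the slab.\<close>
  ultimately obtain \<delta> where \<delta>: "\<delta> > 0" "(\<Union>y\<in>Q. ball y \<delta>) \<subseteq> \<Omega>"
    using compact_subset_open_imp_ball_epsilon_subset[OF _ \<Omega>(3)] by blast
  have per: "ereal (\<epsilon> / 4 * (1 / 4)) \<le> perimeter \<Omega>"
  proof (rule perimeter_ge_rectangle_area[OF \<Omega>(3,2), of "\<delta> / 2" _ _ "m \<bullet> e" "m \<bullet> f" "m \<bullet> d + \<rho> / 4"])
    fix s t r
    assume s: "s \<in> {m \<bullet> e..m \<bullet> e + \<delta> / 2}" "t \<in> {m \<bullet> f..m \<bullet> f + \<epsilon> / 4}" "r \<in> {m \<bullet> d + \<rho> / 4..m \<bullet> d + \<rho> / 4 + 1 / 4}"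
    define y where "y = m + (t - m \<bullet> f) *\<^sub>R f + (r - m \<bullet> d) *\<^sub>R d"
    have "y \<in> Q" unfolding Q_def y_def using s by (intro image_eqI[of _ _ "(t - m \<bullet> f, r - m \<bullet> d)"]) auto
    moreover have "pt s t r = y + (s - m \<bullet> e) *\<^sub>R e"
    proof -
      have "y + (s - m \<bullet> e) *\<^sub>R e
          = (m - ((m \<bullet> e) *\<^sub>R e + (m \<bullet> f) *\<^sub>R f + (m \<bullet> d) *\<^sub>R d)) + pt s t r"
        by (simp add: y_def pt_def algebra_simps)
      also have "(m \<bullet> e) *\<^sub>R e + (m \<bullet> f) *\<^sub>R f + (m \<bullet> d) *\<^sub>R d = m"
        using pt_coords[of m] by (simp add: pt_def)
      finally show ?thesis by simp
    qed
    moreover have "norm ((s - m \<bullet> e) *\<^sub>R e) < \<delta>" using s \<delta>(1) norm_e by auto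
    ultimately have "pt s t r \<in> ball y \<delta>" by (simp add: dist_norm)
    then show "pt s t r \<in> \<Omega>" using \<delta>(2) \<open>y \<in> Q\<close> by blast
  qed (use \<delta> \<epsilon> in auto)
  have "ereal (1 / (256 * (17 * M\<^sup>2 + 4) * \<epsilon>))
      = ereal (\<epsilon> / 4 * (1 / 4)) * ereal (1 / (4 * (17 * M\<^sup>2 + 4) * (2 * \<epsilon>)\<^sup>2))"
  proof -
    have "1 / (256 * k * \<epsilon>) = \<epsilon> / 4 * (1 / 4) * (1 / (4 * k * (2 * \<epsilon>)\<^sup>2))" if "k > 0" for k
      using \<epsilon> that by (simp add: field_simps power2_eq_square)
    from this[of "17 * M\<^sup>2 + 4"] show ?thesis by (simp add: add_nonneg_pos)
  qed
  also have "\<dots> \<le> J_Per \<Omega>"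
    unfolding J_Per_def
  proof (rule ereal_mult_mono')
    show "0 \<le> ereal (\<epsilon> / 4 * (1 / 4))" "0 \<le> ereal (1 / (4 * (17 * M\<^sup>2 + 4) * (2 * \<epsilon>)\<^sup>2))"
      using \<epsilon> by (auto intro!: divide_nonneg_nonneg mult_nonneg_nonneg add_nonneg_nonneg)
  qed (fact per lam)+
  finally have J: "ereal (1 / (256 * (17 * M\<^sup>2 + 4) * \<epsilon>)) \<le> J_Per \<Omega>" .
  show thesis
    using that[OF pq(1,2) x(1) pq(3)] \<epsilon> J unfolding \<epsilon>_def P_def d_def by blast
qed

section \<open>Collapsing sequences\<close>

text \<open>Boundedness of \<open>A\<close> makes the supremum in the definition a true upper bound;
  compactness of the segment supplies a nearest point.\<close>

lemma dist_segment_le_hausdorff_distance: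
  assumes "bounded A" "x \<in> A"
  shows "\<exists>t. 0 \<le> t \<and> t \<le> 1 \<and> norm (x - t *\<^sub>R axis 3 1) \<le> hausdorff_distance A unit_segment"
proof -
  have seg: "unit_segment = (\<lambda>t. t *\<^sub>R axis 3 1) ` {0..1}"
  proof -
    have "(vector [0, 0, t] :: real^3) = t *\<^sub>R axis 3 1" for t :: real
      by (simp add: vec_eq_iff forall_3 axis_def)
    then show ?thesis by (auto simp: unit_segment_def)
  qed
  have "compact unit_segment" unfolding seg by (intro compact_continuous_image continuous_intros compact_Icc)
  then have cl: "closed unit_segment" "unit_segment \<noteq> {}" by (auto simp: compact_imp_closed seg)
  obtain N where N: "\<And>y. y \<in> A \<Longrightarrow> norm y \<le> N" using assms(1) by (auto simp: bounded_iff)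
  have "0 \<in> unit_segment" unfolding seg by (auto intro!: image_eqI[of _ _ 0])
  then have "infdist y unit_segment \<le> N" if "y \<in> A" for y
    using infdist_le[of 0 unit_segment y] N[OF that] by (simp add: dist_norm)
  then have "bdd_above ((\<lambda>a. infdist a unit_segment) ` A)" by (auto intro!: bdd_aboveI)
  then have "infdist x unit_segment \<le> hausdorff_distance A unit_segment"
    unfolding hausdorff_distance_def using cSUP_upper[OF assms(2), of "\<lambda>a. infdist a unit_segment"] by simp
  moreover obtain y where "y \<in> unit_segment" "infdist x unit_segment = dist x y"
    using infdist_attains_inf[OF cl] by blast
  ultimately show ?thesis by (auto simp: seg dist_norm)
qed

text \<open>The orthogonal component is the shortest among all \<open>(x - p) - \<tau> (q - p)\<close>, and \<open>\<tau>\<close> can be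
  read off from the points of the segment near the images of \<open>p\<close>, \<open>q\<close> and \<open>x\<close>.\<close>

lemma thickness_le:
  fixes p q x :: "real^3"
  assumes T: "rigid_motion T" and pqx: "p \<in> closure \<Omega>" "q \<in> closure \<Omega>" "x \<in> closure \<Omega>" and pq: "dist p q = 1"
    and "bounded \<Omega>" and h: "hausdorff_distance (closure (T ` \<Omega>)) unit_segment = h" "h \<le> 1/4"
  shows "norm ((x - p) - ((x - p) \<bullet> (q - p)) *\<^sub>R (q - p)) \<le> 6 * h"
proof -
  obtain A a where A: "orthogonal_transformation A" and Ta: "T = (\<lambda>x. A x + a)"
    using T by (auto simp: rigid_motion_def)
  have lin: "linear A" using A by (rule orthogonal_transformation_linear)
  have nA: "norm (A v) = norm v" for v using A by (rule orthogonal_transformation_norm)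
  have cT: "continuous_on UNIV T" unfolding Ta
    by (intro continuous_intros linear_continuous_on) (use lin in \<open>simp add: linear_conv_bounded_linear\<close>)
  have Tc: "T y \<in> closure (T ` \<Omega>)" if "y \<in> closure \<Omega>" for y
  proof -
    have "T ` closure \<Omega> \<subseteq> closure (T ` \<Omega>)"
      by (rule image_closure_subset[OF continuous_on_subset[OF cT]]) (simp_all add: closure_subset)
    then show ?thesis using that by blast
  qed
  have "bounded (T ` closure \<Omega>)"
    using \<open>bounded \<Omega>\<close> by (intro compact_imp_bounded compact_continuous_image continuous_on_subset[OF cT]) auto
  then have "bounded (T ` \<Omega>)" by (rule bounded_subset) (use closure_subset in blast)
  then have "bounded (closure (T ` \<Omega>))" by (rule bounded_closure)
  note near = dist_segment_le_hausdorff_distance[OF this Tc, unfolded h]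
  obtain \<alpha> where \<alpha>: "0 \<le> \<alpha>" "\<alpha> \<le> 1" "norm (T p - \<alpha> *\<^sub>R axis 3 1) \<le> h" using near[OF pqx(1)] by blast
  obtain \<beta> where \<beta>: "0 \<le> \<beta>" "\<beta> \<le> 1" "norm (T q - \<beta> *\<^sub>R axis 3 1) \<le> h" using near[OF pqx(2)] by blast
  obtain \<gamma> where \<gamma>: "0 \<le> \<gamma>" "\<gamma> \<le> 1" "norm (T x - \<gamma> *\<^sub>R axis 3 1) \<le> h" using near[OF pqx(3)] by blast
  define dp where "dp = T p - \<alpha> *\<^sub>R axis 3 1"
  define dq where "dq = T q - \<beta> *\<^sub>R axis 3 1"
  define dx where "dx = T x - \<gamma> *\<^sub>R axis 3 1"
  have diff: "A (y - z) = T y - T z" for y z unfolding Ta by (simp add: linear_diff[OF lin])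
  have "1 = norm (T q - T p)"
    using pq nA[of "q - p"] unfolding diff by (simp add: dist_norm norm_minus_commute)
  also have "T q - T p = (\<beta> - \<alpha>) *\<^sub>R axis 3 1 + (dq - dp)" by (simp add: dp_def dq_def algebra_simps)
  also have "norm \<dots> \<le> norm ((\<beta> - \<alpha>) *\<^sub>R (axis 3 1 :: real^3)) + norm (dq - dp)" by (rule norm_triangle_ineq)
  also have "\<dots> \<le> \<bar>\<beta> - \<alpha>\<bar> + (h + h)"
    using norm_triangle_ineq4[of dq dp] \<alpha>(3) \<beta>(3) by (simp add: dp_def dq_def norm_axis_1)
  \<comment> \<open>The images of \<open>p\<close> and \<open>q\<close> are at distance 1 and each
    moves by at most 1/4, so their partners on the segment stay 1/2 apart.\<close>
  finally have ba: "\<bar>\<beta> - \<alpha>\<bar> \<ge> 1/2" using h(2) by simp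
  \<comment> \<open>Chosen so that the contributions of the segment cancel and only the errors
    \<open>dp\<close>, \<open>dq\<close>, \<open>dx\<close> are left.\<close>
  define \<tau> where "\<tau> = (\<gamma> - \<alpha>) / (\<beta> - \<alpha>)"
  have \<tau>1: "\<tau> * (\<beta> - \<alpha>) = \<gamma> - \<alpha>" using ba by (auto simp: \<tau>_def)
  have \<tau>2: "\<bar>\<tau>\<bar> \<le> 2"
  proof -
    have "\<bar>\<gamma> - \<alpha>\<bar> \<le> 1" using \<alpha> \<gamma> by auto
    also have "1 \<le> 2 * \<bar>\<beta> - \<alpha>\<bar>" using ba by simp
    finally show ?thesis using ba by (simp add: \<tau>_def abs_divide divide_le_eq)
  qed
  define v where "v = q - p"
  have vv: "v \<bullet> v = 1" using pq by (simp add: v_def dist_norm norm_minus_commute dot_square_norm)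
  have "(norm ((x - p) - ((x - p) \<bullet> v) *\<^sub>R v))\<^sup>2 \<le> (norm ((x - p) - \<tau> *\<^sub>R v))\<^sup>2"
  proof -
    have eq: "(norm (u - \<sigma> *\<^sub>R v))\<^sup>2 = (norm u)\<^sup>2 - 2 * \<sigma> * (u \<bullet> v) + \<sigma>\<^sup>2" for u \<sigma>
      unfolding power2_norm_eq_inner
      by (simp add: inner_diff_left inner_diff_right inner_commute[of v u] power2_eq_square vv right_diff_distrib)
    have "2 * s * s - s\<^sup>2 \<ge> 2 * \<tau> * s - \<tau>\<^sup>2" for s
      using zero_le_power2[of "\<tau> - s"] by (simp add: power2_eq_square algebra_simps)
    from this[of "(x - p) \<bullet> v"] show ?thesis unfolding eq by linarith
  qed
  then have "norm ((x - p) - ((x - p) \<bullet> v) *\<^sub>R v) \<le> norm ((x - p) - \<tau> *\<^sub>R v)"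
    by (rule power2_le_imp_le) simp
  also have "\<dots> = norm (A ((x - p) - \<tau> *\<^sub>R v))" by (simp add: nA)
  also have "A ((x - p) - \<tau> *\<^sub>R v) = (T x - T p) - \<tau> *\<^sub>R (T q - T p)"
    unfolding v_def
    by (subst linear_diff[OF lin, of "x - p"], subst linear_cmul[OF lin]) (simp only: diff)
  also have "\<dots> = (\<gamma> - \<alpha> - \<tau> * (\<beta> - \<alpha>)) *\<^sub>R axis 3 1 + ((dx - dp) - \<tau> *\<^sub>R (dq - dp))"
    by (simp add: dp_def dq_def dx_def algebra_simps)
  also have "\<dots> = (dx - dp) - \<tau> *\<^sub>R (dq - dp)" by (simp add: \<tau>1)
  also have "norm \<dots> \<le> norm (dx - dp) + \<bar>\<tau>\<bar> * norm (dq - dp)"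
    using norm_triangle_ineq4[of "dx - dp" "\<tau> *\<^sub>R (dq - dp)"] by simp
  \<comment> \<open>The factor 6: two errors in \<open>dx - dp\<close>, and two in
    \<open>dq - dp\<close> weighted by at most 2.\<close>
  also have "\<dots> \<le> (h + h) + 2 * (h + h)"
  proof (intro add_mono mult_mono)
    show "norm (dx - dp) \<le> h + h" using norm_triangle_ineq4[of dx dp] \<gamma>(3) \<alpha>(3) by (simp add: dx_def dp_def)
    show "norm (dq - dp) \<le> h + h" using norm_triangle_ineq4[of dq dp] \<beta>(3) \<alpha>(3) by (simp add: dq_def dp_def)
  qed (use \<tau>2 in auto)
  finally show ?thesis unfolding v_def by simp
qed

theorem theorem1p4:
  fixes \<Omega> :: "nat \<Rightarrow> (real^3) set" and T :: "nat \<Rightarrow> real^3 \<Rightarrow> real^3"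
  assumes "\<And>k. \<Omega> k \<noteq> {}" and "\<And>k. bounded (\<Omega> k)" and "\<And>k. open (\<Omega> k)"
    and "\<And>k. convex (\<Omega> k)" and "\<And>k. diameter (\<Omega> k) = 1"
    and "\<And>k. rigid_motion (T k)"
    and "(\<lambda>k. hausdorff_distance (closure (T k ` \<Omega> k)) unit_segment) \<longlonglongrightarrow> 0"
  shows "(\<lambda>k. J_Per (\<Omega> k)) \<longlonglongrightarrow> \<infinity>"
proof -
  define h where "h k = hausdorff_distance (closure (T k ` \<Omega> k)) unit_segment" for k
  obtain M where M: "\<And>t. step' t \<le> M" using step'_bounded by blast
  define C where "C = 256 * (17 * M\<^sup>2 + 4)"
  have C: "C > 0" by (simp add: C_def add_nonneg_pos)
  \<comment> \<open>The bound on \<open>J_Per\<close> is available for every \<open>k\<close>, the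
    comparison of \<epsilon> with \<open>h k\<close> only once \<open>h k\<close> is small. The
    witness is the largest distance from the line through the diameter.\<close>
  have key: "\<exists>\<epsilon>>0. ereal (1 / (C * \<epsilon>)) \<le> J_Per (\<Omega> k) \<and> (h k \<le> 1/4 \<longrightarrow> \<epsilon> \<le> 6 * h k)" for k
  proof -
    obtain p q x where *: "p \<in> closure (\<Omega> k)" "q \<in> closure (\<Omega> k)" "x \<in> closure (\<Omega> k)" "dist p q = 1"
      "norm ((x - p) - ((x - p) \<bullet> (q - p)) *\<^sub>R (q - p)) > 0"
      "ereal (1 / (C * norm ((x - p) - ((x - p) \<bullet> (q - p)) *\<^sub>R (q - p)))) \<le> J_Per (\<Omega> k)"
      unfolding C_def by (rule J_Per_lower_bound[OF assms(1,2,3,4,5) M])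
    show ?thesis
      using *(5,6) thickness_le[OF assms(6) *(1-4) assms(2) h_def[symmetric]] by blast
  qed
  show ?thesis unfolding tendsto_PInfty
  proof
    fix B :: real
    define X where "X = C * (\<bar>B\<bar> + 1)"
    have X: "X > 0" using C by (simp add: X_def)
    \<comment> \<open>\<open>h k < \<delta>\<close> gives \<open>\<epsilon> < 1 / X\<close>, hence
      \<open>1 / (C * \<epsilon>) > \<bar>B\<bar> + 1\<close>; the 1/4 is the smallness that
      \<open>key\<close> asks for.\<close>
    define \<delta> where "\<delta> = min (1/4) (1 / (6 * X))"
    have \<delta>: "\<delta> > 0" using X by (simp add: \<delta>_def)
    have "eventually (\<lambda>k. h k < \<delta>) sequentially"
      using order_tendstoD(2)[OF assms(7) \<delta>] by (simp add: h_def)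
    then show "eventually (\<lambda>k. ereal B < J_Per (\<Omega> k)) sequentially"
    proof (rule eventually_mono)
      fix k assume k: "h k < \<delta>"
      obtain \<epsilon> where \<epsilon>: "\<epsilon> > 0" "ereal (1 / (C * \<epsilon>)) \<le> J_Per (\<Omega> k)" "\<epsilon> \<le> 6 * h k"
        using key[of k] k by (auto simp: \<delta>_def)
      have "h k < 1 / (6 * X)" using k by (simp add: \<delta>_def)
      then have "6 * h k < 1 / X" using X by (simp add: field_simps)
      then have "\<epsilon> < 1 / X" using \<epsilon>(3) by linarith
      then have "\<epsilon> * (C * (\<bar>B\<bar> + 1)) < 1" using X unfolding X_def[symmetric] by (simp add: field_simps)
      then have "\<bar>B\<bar> + 1 < 1 / (C * \<epsilon>)" using \<epsilon>(1) C by (simp add: pos_less_divide_eq mult_ac)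
      then have "ereal B < ereal (1 / (C * \<epsilon>))" by simp
      then show "ereal B < J_Per (\<Omega> k)" using \<epsilon>(2) by (rule less_le_trans)
    qed
  qed
qed

end
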